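(* Assume hypotheses H(A), H(B), H(F), H(G), H(0), H(W), H($\ell$) and H($\varphi$) spelled out in the context, and let $\mathcal P\subset\Lambda\times\Xi$ be a nonempty compact set. Then there exists a triplet $(w^*,\zeta^*,\eta^* )\in\mathcal W_{ad}\times\mathcal P$ (meaning $w^*\in\mathcal W_{ad}$ and $(\zeta^*,\eta^* )\in\mathcal P$) such that $$m_{\zeta^*,\eta^*}(w^* )+\mathcal R(w^* )=\inf_{(w,\zeta,\eta)\in\mathcal W_{ad}\times\mathcal P}\{m_{\zeta,\eta}(w)+\mathcal R(w)\}.$$
   Context: **Setting.** $E,H,Y$ are real separable Hilbert spaces with norms $\|\cdot\|_E,\|\cdot\|,\|\cdot\|_Y$ ($\langle\cdot,\cdot\rangle$ is the inner product of $H$), $I=[0,b]$ with $b>0$, $(\Lambda,d_\Lambda)$ and $(\Xi,d_\Xi)$ are metric spaces, $\Lambda\times\Xi$ has the product metric. Spaces $C(I,\cdot)$ carry the sup norm. $\operatorname{Haus}$ is the Hausdorff metric between sets; for a set $S$ in a normed space $\|S\|:=\sup_{s\in S}\|s\|$. A multifunction $\Phi$ on $I$ is measurable if $\{t:\Phi(t)\subset O\}$ is Lebesgue measurable for every open $O$. A set $S\subset H$ is ball-relatively compact if its intersection with every closed ball centered at $0$ is relatively compact. For a maximal monotone $B:D(B)\subset H\rightrightarrows H$, $B^0(v)$ is the minimal-norm element of $B(v)$. The pseudo-distance of maximal monotone operators is $$\operatorname{dis}(B_1,B_2)=\sup\Big\{\tfrac{\langle y-y',x'-x\rangle}{1+\|y\|+\|y'\|}: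 x\in D(B_1),y\in B_1(x),x'\in D(B_2),y'\in B_2(x')\Big\}\in[0,\infty].$$ **Data.** Linear operators $A_\zeta:D(A_\zeta)\subset E\to E$ ($\zeta\in\Lambda$); maximal monotone operators $B(t,u,\eta):D(B(t,u,\eta))\subset H\rightrightarrows H$ ($(t,u,\eta)\in I\times H\times\Xi$); multifunctions $F:I\times E\times H\times\Lambda\rightrightarrows E$, $G:I\times E\times H\times\Xi\rightrightarrows H$, $W:I\rightrightarrows Y$; a bounded linear operator $\mathcal B:Y\to E$; maps $x_0:\Lambda\to E$, $u_0:\Xi\to H$ with $u_0(\eta)\in D(B(0,u_0(\eta),\eta))$; functions $\ell:I\times E\times H\times\Lambda\times\Xi\to\mathbb R$, $\varphi:E\times H\times\Lambda\times\Xi\to\mathbb R$. **H(A).** Each $A_\zeta$ generates a $C_0$-semigroup $\{T_\zeta(t)\}_{t\ge0}$ on $E$ with $T_\zeta(t)$ compact for all $t>0$; for every bounded $D\subset\Lambda$ there is $M_D>0$ with $\sup_{t\in I}\|T_\zeta(t)\|_{\mathcal L(E)}\le M_D$ for all $\zeta\in D$; whenever $\zeta_n\to\zeta$, $\sup_{t\in I}\|T_{\zeta_n}(t)x-T_\zeta(t)x\|_E\to0$ for every $x\in E$, and $\sup_{t\in[\delta,b]}\|T_{\zeta_n}(t)-T_\zeta(t)\|_{\mathcal L(E)}\to0$ for every $0<\delta<b$. **H(B).** (i) There are $\theta\in W^{1,2}(I,\mathbb R)$, $\lambda\in[0,1)$, $\lambda'>0$ with $\operatorname{dis}(B(t,u,\eta_1),B(s,v,\eta_2))\le|\theta(t)-\theta(s)|+\lambda\|u-v\|+\lambda'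 d_\Xi(\eta_1,\eta_2)$ for all $t,s\in I$, $u,v\in H$, $\eta_1,\eta_2\in\Xi$. (ii) There is $M_B>0$ with $\|B^0(t,u,\eta)v\|\le M_B(1+\|u\|+\|v\|)$ for all $t\in I$, $u\in H$, $\eta\in\Xi$, $v\in D(B(t,u,\eta))$. (iii) For every bounded $\Omega\subset H\times\Xi$, $\bigcup_{t\in I,(u,\eta)\in\Omega}D(B(t,u,\eta))$ is ball-relatively compact in $H$. (iv) For every bounded $D\subset\Xi$ and $r>0$ there is $\varrho_D\in L^1(I,\mathbb R_+)$ with $\langle v_1-v_2,u_1-u_2\rangle\ge-\varrho_D(t)\|u_1-u_2\|^2$ for all $t\in I$, $\|u_1\|,\|u_2\|\le r$, $\eta_1,\eta_2\in D$, $v_i\in B(t,u_i,\eta_i)(u_i)$. **H(F).** $F$ has nonempty weakly compact convex values and: (i) $t\mapsto F(t,x,u,\zeta)$ is measurable for all $(x,u,\zeta)$; (ii) for every bounded $D\subset\Lambda$ there is $k_D\in L^1(I,\mathbb R_+)$ with $\operatorname{Haus}(F(t,x,u,\zeta),F(t,y,v,\zeta))\le k_D(t)(\|x-y\|_E+\|u-v\|)$ for all $(x,u),(y,v)$, $\zeta\in D$, a.e. $t$; (iii) for every bounded $D\subset\Lambda$ there is $M_F>0$ with $\|F(t,x,u,\zeta)\|_E\le M_F(1+\|x\|_E+\|u\|)$ for a.e. $t$ and all $(x,u,\zeta)\in E\times H\times D$; (iv) $\operatorname{Haus}(F(t,x,u,\zeta_1),F(t,x,u,\zeta_2))\le\gamma_1(d_\Lambda(\zeta_1,\zeta_2))\rho_1(t,\|x\|_E,\|u\|)$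 for all $(x,u)$, $\zeta_1,\zeta_2$, a.e. $t$, where $\gamma_1(r)\to0$ as $r\to0^+$ and for every bounded $S\subset L^2(I,E)\times L^2(I,H)$ there is $\omega_S\in L^1(I,\mathbb R_+)$ with $\rho_1(t,\|x(t)\|_E,\|u(t)\|)\le\omega_S(t)$ for a.e. $t$ and all $(x,u)\in S$. **H(G).** $G$ has nonempty weakly compact convex values and: (i) $t\mapsto G(t,x,u,\eta)$ is measurable; (ii) for every bounded $D\subset\Xi$ there is $l_D\in L^1(I,\mathbb R_+)$ with $\operatorname{Haus}(G(t,x,u,\eta),G(t,y,v,\eta))\le l_D(t)(\|x-y\|_E+\|u-v\|)$ for all $(x,u),(y,v)$, $\eta\in D$, a.e. $t$; (iii) for every bounded $D\subset\Xi$ there is $M_G>0$ with $\|G(t,x,u,\eta)\|\le M_G(1+\|x\|_E+\|u\|)$ for a.e. $t$ and all $(x,u,\eta)\in E\times H\times D$; (iv) $\operatorname{Haus}(G(t,x,u,\eta_1),G(t,x,u,\eta_2))\le\gamma_2(d_\Xi(\eta_1,\eta_2))\rho_2(t,\|x\|_E,\|u\|)$ for all $(x,u)$, $\eta_1,\eta_2$, a.e. $t$, where $\gamma_2(r)\to0$ as $r\to0^+$ and for every bounded $Q\subset C(I,E)\times C(I,H)$ there is $\omega_Q\in L^1(I,\mathbb R_+)$ with $\rho_2(t,\|x(t)\|_E,\|u(t)\|)\le\omega_Q(t)$ for a.e. $t$ and all $(x,u)\in Q$. **H(0).** $x_0$ and $u_0$ are continuous, and for every bounded $D\subset\Lambda\times\Xi$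 there is $\varpi_D>0$ with $\max\{\|x_0(\zeta)\|_E,\|u_0(\eta)\|\}\le\varpi_D$ for all $(\zeta,\eta)\in D$. **H(W).** $W$ is measurable with nonempty closed convex values, and there is $\phi_W\in L^2(I,\mathbb R_+)$ with $\sup_{v\in W(t)}\|v\|_Y\le\phi_W(t)$ for a.e. $t$. **H($\ell$).** (i) $t\mapsto\ell(t,x,u,\zeta,\eta)$ is measurable for all $(x,u,\zeta,\eta)$. (ii) For a.e. $t$, all $x,y\in E$ and all $(u,\zeta,\eta)$, $|\ell(t,x,u,\zeta,\eta)-\ell(t,y,u,\zeta,\eta)|\le(1+\max\{\|x\|_E,\|y\|_E\})\,\kappa(t,\|x-y\|_E)$, where $\kappa:I\times\mathbb R_+\to\mathbb R_+$ is Carath\'eodory, $\kappa(t,0)=0$ for a.e. $t$, and for each $R>0$ there is $\beta_R\in L^1(I,\mathbb R_+)$ with $\sup_{0\le r\le R}\kappa(t,r)\le\beta_R(t)$ for a.e. $t$. (iii) For a.e. $t$ and all $(x,\zeta,\eta)$, $u\mapsto\ell(t,x,u,\zeta,\eta)$ is convex. (iv) For every bounded $D\subset\Lambda\times\Xi$ there is $\vartheta_D\in L^1(I,\mathbb R_+)$ with $|\ell(t,0,u,\zeta,\eta)|\le\vartheta_D(t)(1+\|u\|)$ for a.e. $t$, all $u\in H$, $(\zeta,\eta)\in D$. (v) For a.e. $t$, $(x,u,\zeta,\eta)\mapsto\ell(t,x,u,\zeta,\eta)$ is continuous. **H($\varphi$).** $\varphi$ is continuous. **Controls and controlled solution sets.**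 $\mathcal W_{ad}=\{w\in L^2(I,Y):w(t)\in W(t)\text{ for a.e. }t\in I\}$. For $w\in\mathcal W_{ad}$ and $(\zeta,\eta)\in\Lambda\times\Xi$, $\mathcal S_{\zeta,\eta}(w)$ is the set of mild solutions of $\dot x\in A_\zeta x+F(t,x,u,\zeta)+\mathcal Bw(t)$, $\dot u\in-B(t,u,\eta)(u)+G(t,x,u,\eta)$, $x(0)=x_0(\zeta)$, $u(0)=u_0(\eta)$, i.e. pairs $(x,u)\in C(I,E)\times W^{1,2}(I,H)$ with $u(0)=u_0(\eta)$ for which there are integrable $f:I\to E$, $g:I\to H$ such that, for a.e. $t\in I$, $f(t)\in F(t,x(t),u(t),\zeta)$, $g(t)\in G(t,x(t),u(t),\eta)$, $-\dot u(t)+g(t)\in B(t,u(t),\eta)(u(t))$ (in particular $u(t)\in D(B(t,u(t),\eta))$), and for all $t\in I$, $x(t)=T_\zeta(t)x_0(\zeta)+\int_0^tT_\zeta(t-s)(f(s)+\mathcal Bw(s))\,ds$. **Costs.** $\mathcal J_{\zeta,\eta}(x,u)=\int_0^b\ell(t,x(t),u(t),\zeta,\eta)\,dt+\varphi(x(b),u(b),\zeta,\eta)$; $m_{\zeta,\eta}(w)=\inf_{(x,u)\in\mathcal S_{\zeta,\eta}(w)}\mathcal J_{\zeta,\eta}(x,u)$; $\mathcal R(w)=\frac12\int_0^b\|w(t)\|_Y^2\,dt$. *)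

theory Defs
  imports "HOL-Analysis.Analysis"
begin

text \<open>
  Real separable Hilbert spaces are types of sort
  \<open>{real_inner, banach, second_countable_topology}\<close>. Functions on \<open>I = [0,b]\<close> are functions on
  \<open>real\<close> of which only the values on \<open>{0..b}\<close> are ever used; elements of Lebesgue spaces are
  represented by functions, not by classes.
\<close>

section \<open>Function spaces on \<open>[0,b]\<close>\<close>

definition L1_nonneg :: "real \<Rightarrow> (real \<Rightarrow> real) set" where
  "L1_nonneg b = {k. integrable (lebesgue_on {0..b}) k \<and> (\<forall>t\<in>{0..b}. 0 \<le> k t)}"

definition L2_space :: "real \<Rightarrow> (real \<Rightarrow> 'a::{real_inner, banach, second_countable_topology}) set" where
  "L2_space b = {f. f \<in> borel_measurable (lebesgue_on {0..b}) \<and>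
                    integrable (lebesgue_on {0..b}) (\<lambda>t. (norm (f t))\<^sup>2)}"

definition L2_norm :: "real \<Rightarrow> (real \<Rightarrow> 'a::{real_inner, banach, second_countable_topology}) \<Rightarrow> real" where
  "L2_norm b f = sqrt (\<integral>t. (norm (f t))\<^sup>2 \<partial>lebesgue_on {0..b})"

text \<open>
  \<open>u\<close> lies in \<open>W^{1,2}(I,H)\<close> (continuous representative) with weak derivative \<open>v\<close>; \<open>v\<close> is
  determined by \<open>u\<close> up to a null set.
\<close>

definition has_W12_derivative ::
    "real \<Rightarrow> (real \<Rightarrow> 'a::{real_inner, banach, second_countable_topology}) \<Rightarrow> (real \<Rightarrow> 'a) \<Rightarrow> bool" where
  "has_W12_derivative b u v \<longleftrightarrow>
     v \<in> L2_space b \<and> (\<forall>t\<in>{0..b}. u t = u 0 + (\<integral>s. v s \<partial>lebesgue_on {0..t}))"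

definition W12_space :: "real \<Rightarrow> (real \<Rightarrow> 'a::{real_inner, banach, second_countable_topology}) set" where
  "W12_space b = {u. \<exists>v. has_W12_derivative b u v}"

section \<open>Sets and multifunctions\<close>

definition Haus :: "'a::metric_space set \<Rightarrow> 'a set \<Rightarrow> ereal" where
  "Haus S S' = max (SUP s\<in>S. ereal (infdist s S')) (SUP s\<in>S'. ereal (infdist s S))"

definition set_norm :: "'a::real_normed_vector set \<Rightarrow> ereal" where
  "set_norm S = (SUP s\<in>S. ereal (norm s))"

definition multi_measurable :: "real \<Rightarrow> (real \<Rightarrow> 'a::topological_space set) \<Rightarrow> bool" where
  "multi_measurable b \<Phi> \<longleftrightarrow>
     (\<forall>U. open U \<longrightarrow> {t\<in>{0..b}. \<Phi> t \<subseteq> U} \<in> sets (lebesgue_on {0..b}))"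

definition weak_topology :: "'a::real_normed_vector topology" where
  "weak_topology = topology_generated_by {f -` U | (f :: 'a \<Rightarrow> real) U. bounded_linear f \<and> open U}"

definition weakly_compact :: "'a::real_normed_vector set \<Rightarrow> bool" where
  "weakly_compact S \<longleftrightarrow> compactin weak_topology S"

definition ball_relatively_compact :: "'a::real_normed_vector set \<Rightarrow> bool" where
  "ball_relatively_compact S \<longleftrightarrow> (\<forall>r\<ge>0. compact (closure (S \<inter> cball 0 r)))"

section \<open>Maximal monotone operators\<close>

text \<open>A multivalued operator is a set-valued map on the whole space; its domain is where it is nonempty.\<close>

definition op_dom :: "('a \<Rightarrow> 'b set) \<Rightarrow> 'a set" where
  "op_dom B = {v. B v \<noteq> {}}"

definition monotone_op :: "('a::real_inner \<Rightarrow> 'a set) \<Rightarrow> bool" where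
  "monotone_op B \<longleftrightarrow> (\<forall>x x'. \<forall>y\<in>B x. \<forall>y'\<in>B x'. 0 \<le> (y - y') \<bullet> (x - x'))"

definition maximal_monotone :: "('a::real_inner \<Rightarrow> 'a set) \<Rightarrow> bool" where
  "maximal_monotone B \<longleftrightarrow>
     monotone_op B \<and> (\<forall>B'. monotone_op B' \<and> (\<forall>x. B x \<subseteq> B' x) \<longrightarrow> B' = B)"

definition minimal_section :: "('a::real_inner \<Rightarrow> 'a set) \<Rightarrow> 'a \<Rightarrow> 'a" where
  "minimal_section B v = (THE y. y \<in> B v \<and> (\<forall>z\<in>B v. norm y \<le> norm z))"

definition op_dis :: "('a::real_inner \<Rightarrow> 'a set) \<Rightarrow> ('a \<Rightarrow> 'a set) \<Rightarrow> ereal" where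
  "op_dis B\<^sub>1 B\<^sub>2 =
     Sup {ereal (((y - y') \<bullet> (x' - x)) / (1 + norm y + norm y')) | x y x' y'.
            x \<in> op_dom B\<^sub>1 \<and> y \<in> B\<^sub>1 x \<and> x' \<in> op_dom B\<^sub>2 \<and> y' \<in> B\<^sub>2 x'}"

section \<open>Semigroups\<close>

definition linear_operator_on :: "'a::real_vector set \<Rightarrow> ('a \<Rightarrow> 'a) \<Rightarrow> bool" where
  "linear_operator_on D A \<longleftrightarrow>
     subspace D \<and> (\<forall>x\<in>D. \<forall>y\<in>D. A (x + y) = A x + A y) \<and> (\<forall>c. \<forall>x\<in>D. A (c *\<^sub>R x) = c *\<^sub>R A x)"

definition C0_semigroup :: "(real \<Rightarrow> 'a::real_normed_vector \<Rightarrow>\<^sub>L 'a) \<Rightarrow> bool" where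
  "C0_semigroup T \<longleftrightarrow>
     T 0 = id_blinfun \<and>
     (\<forall>s\<ge>0. \<forall>t\<ge>0. T (s + t) = T s o\<^sub>L T t) \<and>
     (\<forall>x. ((\<lambda>t. blinfun_apply (T t) x) \<longlongrightarrow> x) (at_right 0))"

definition generates ::
    "'a::real_normed_vector set \<Rightarrow> ('a \<Rightarrow> 'a) \<Rightarrow> (real \<Rightarrow> 'a \<Rightarrow>\<^sub>L 'a) \<Rightarrow> bool" where
  "generates D A T \<longleftrightarrow>
     C0_semigroup T \<and>
     D = {x. \<exists>y. ((\<lambda>h. (blinfun_apply (T h) x - x) /\<^sub>R h) \<longlongrightarrow> y) (at_right 0)} \<and>
     (\<forall>x\<in>D. ((\<lambda>h. (blinfun_apply (T h) x - x) /\<^sub>R h) \<longlongrightarrow> A x) (at_right 0))"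

definition compact_operator :: "('a::real_normed_vector \<Rightarrow>\<^sub>L 'a) \<Rightarrow> bool" where
  "compact_operator S \<longleftrightarrow> (\<forall>K. bounded K \<longrightarrow> compact (closure (blinfun_apply S ` K)))"

section \<open>Hypotheses\<close>

text \<open>
  In the Lipschitz and parameter-continuity conditions on \<open>F\<close> and \<open>G\<close> the exceptional null set may
  depend on the parameters, but not on the state \<open>(x,u)\<close>.
\<close>

definition hyp_A ::
    "real \<Rightarrow> ('l::metric_space \<Rightarrow> 'e::{real_inner, banach, second_countable_topology} set) \<Rightarrow>
     ('l \<Rightarrow> 'e \<Rightarrow> 'e) \<Rightarrow> ('l \<Rightarrow> real \<Rightarrow> 'e \<Rightarrow>\<^sub>L 'e) \<Rightarrow> bool" where
  "hyp_A b domA A T \<longleftrightarrow>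
     (\<forall>\<zeta>. generates (domA \<zeta>) (A \<zeta>) (T \<zeta>)) \<and>
     (\<forall>\<zeta>. \<forall>t>0. compact_operator (T \<zeta> t)) \<and>
     (\<forall>D. bounded D \<longrightarrow> (\<exists>M>0. \<forall>\<zeta>\<in>D. \<forall>t\<in>{0..b}. norm (T \<zeta> t) \<le> M)) \<and>
     (\<forall>z \<zeta>. z \<longlonglongrightarrow> \<zeta> \<longrightarrow>
        (\<forall>x. uniform_limit {0..b} (\<lambda>n t. blinfun_apply (T (z n) t) x)
                (\<lambda>t. blinfun_apply (T \<zeta> t) x) sequentially) \<and>
        (\<forall>\<delta>. 0 < \<delta> \<and> \<delta> < b \<longrightarrow>
                uniform_limit {\<delta>..b} (\<lambda>n t. T (z n) t) (\<lambda>t. T \<zeta> t) sequentially))"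

definition hyp_B ::
    "real \<Rightarrow> (real \<Rightarrow> 'h::{real_inner, banach, second_countable_topology} \<Rightarrow> 'x::metric_space \<Rightarrow> 'h \<Rightarrow> 'h set)
     \<Rightarrow> bool" where
  "hyp_B b B \<longleftrightarrow>
     (\<exists>\<theta>\<in>W12_space b. \<exists>c c'. 0 \<le> c \<and> c < 1 \<and> 0 < c' \<and>
        (\<forall>t\<in>{0..b}. \<forall>s\<in>{0..b}. \<forall>u v \<eta>\<^sub>1 \<eta>\<^sub>2.
           op_dis (B t u \<eta>\<^sub>1) (B s v \<eta>\<^sub>2)
             \<le> ereal (\<bar>\<theta> t - \<theta> s :: real\<bar> + c * norm (u - v) + c' * dist \<eta>\<^sub>1 \<eta>\<^sub>2))) \<and>
     (\<exists>M>0. \<forall>t\<in>{0..b}. \<forall>u \<eta>. \<forall>v\<in>op_dom (B t u \<eta>).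
        norm (minimal_section (B t u \<eta>) v) \<le> M * (1 + norm u + norm v)) \<and>
     (\<forall>\<Omega>. bounded \<Omega> \<longrightarrow>
        ball_relatively_compact (\<Union>t\<in>{0..b}. \<Union>(u, \<eta>)\<in>\<Omega>. op_dom (B t u \<eta>))) \<and>
     (\<forall>D. bounded D \<longrightarrow> (\<forall>r>0. \<exists>\<rho>\<in>L1_nonneg b.
        \<forall>t\<in>{0..b}. \<forall>u\<^sub>1\<in>cball 0 r. \<forall>u\<^sub>2\<in>cball 0 r. \<forall>\<eta>\<^sub>1\<in>D. \<forall>\<eta>\<^sub>2\<in>D.
        \<forall>v\<^sub>1\<in>B t u\<^sub>1 \<eta>\<^sub>1 u\<^sub>1. \<forall>v\<^sub>2\<in>B t u\<^sub>2 \<eta>\<^sub>2 u\<^sub>2.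
          (v\<^sub>1 - v\<^sub>2) \<bullet> (u\<^sub>1 - u\<^sub>2) \<ge> - \<rho> t * (norm (u\<^sub>1 - u\<^sub>2))\<^sup>2))"

definition hyp_F ::
    "real \<Rightarrow> (real \<Rightarrow> 'e::{real_inner, banach, second_countable_topology} \<Rightarrow>
       'h::{real_inner, banach, second_countable_topology} \<Rightarrow> 'l::metric_space \<Rightarrow> 'e set) \<Rightarrow> bool" where
  "hyp_F b F \<longleftrightarrow>
     (\<forall>t\<in>{0..b}. \<forall>x u \<zeta>. F t x u \<zeta> \<noteq> {} \<and> weakly_compact (F t x u \<zeta>) \<and> convex (F t x u \<zeta>)) \<and>
     (\<forall>x u \<zeta>. multi_measurable b (\<lambda>t. F t x u \<zeta>)) \<and>
     (\<forall>D. bounded D \<longrightarrow> (\<exists>k\<in>L1_nonneg b. \<forall>\<zeta>\<in>D. AE t in lebesgue_on {0..b}. \<forall>x u y v.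
        Haus (F t x u \<zeta>) (F t y v \<zeta>) \<le> ereal (k t * (norm (x - y) + norm (u - v))))) \<and>
     (\<forall>D. bounded D \<longrightarrow> (\<exists>M>0. AE t in lebesgue_on {0..b}. \<forall>x u. \<forall>\<zeta>\<in>D.
        set_norm (F t x u \<zeta>) \<le> ereal (M * (1 + norm x + norm u)))) \<and>
     (\<exists>(\<gamma> :: real \<Rightarrow> real) \<rho>.
        (\<gamma> \<longlongrightarrow> 0) (at_right 0) \<and>
        (\<forall>S. S \<subseteq> L2_space b \<times> L2_space b \<and> (\<exists>R. \<forall>(x, u)\<in>S. L2_norm b x \<le> R \<and> L2_norm b u \<le> R) \<longrightarrow>
           (\<exists>\<omega>\<in>L1_nonneg b. \<forall>(x :: real \<Rightarrow> 'e, u :: real \<Rightarrow> 'h)\<in>S.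
              AE t in lebesgue_on {0..b}. \<rho> t (norm (x t)) (norm (u t)) \<le> \<omega> t)) \<and>
        (\<forall>\<zeta>\<^sub>1 \<zeta>\<^sub>2. AE t in lebesgue_on {0..b}. \<forall>x u.
           Haus (F t x u \<zeta>\<^sub>1) (F t x u \<zeta>\<^sub>2) \<le> ereal (\<gamma> (dist \<zeta>\<^sub>1 \<zeta>\<^sub>2) * \<rho> t (norm x) (norm u))))"

definition hyp_G ::
    "real \<Rightarrow> (real \<Rightarrow> 'e::{real_inner, banach, second_countable_topology} \<Rightarrow>
       'h::{real_inner, banach, second_countable_topology} \<Rightarrow> 'x::metric_space \<Rightarrow> 'h set) \<Rightarrow> bool" where
  "hyp_G b G \<longleftrightarrow>
     (\<forall>t\<in>{0..b}. \<forall>x u \<eta>. G t x u \<eta> \<noteq> {} \<and> weakly_compact (G t x u \<eta>) \<and> convex (G t x u \<eta>)) \<and>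
     (\<forall>x u \<eta>. multi_measurable b (\<lambda>t. G t x u \<eta>)) \<and>
     (\<forall>D. bounded D \<longrightarrow> (\<exists>l\<in>L1_nonneg b. \<forall>\<eta>\<in>D. AE t in lebesgue_on {0..b}. \<forall>x u y v.
        Haus (G t x u \<eta>) (G t y v \<eta>) \<le> ereal (l t * (norm (x - y) + norm (u - v))))) \<and>
     (\<forall>D. bounded D \<longrightarrow> (\<exists>M>0. AE t in lebesgue_on {0..b}. \<forall>x u. \<forall>\<eta>\<in>D.
        set_norm (G t x u \<eta>) \<le> ereal (M * (1 + norm x + norm u)))) \<and>
     (\<exists>(\<gamma> :: real \<Rightarrow> real) \<rho>.
        (\<gamma> \<longlongrightarrow> 0) (at_right 0) \<and>
        (\<forall>Q. Q \<subseteq> {x. continuous_on {0..b} x} \<times> {u. continuous_on {0..b} u} \<and>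
             (\<exists>R. \<forall>(x, u)\<in>Q. \<forall>t\<in>{0..b}. norm (x t) \<le> R \<and> norm (u t) \<le> R) \<longrightarrow>
           (\<exists>\<omega>\<in>L1_nonneg b. AE t in lebesgue_on {0..b}. \<forall>(x :: real \<Rightarrow> 'e, u :: real \<Rightarrow> 'h)\<in>Q.
              \<rho> t (norm (x t)) (norm (u t)) \<le> \<omega> t)) \<and>
        (\<forall>\<eta>\<^sub>1 \<eta>\<^sub>2. AE t in lebesgue_on {0..b}. \<forall>x u.
           Haus (G t x u \<eta>\<^sub>1) (G t x u \<eta>\<^sub>2) \<le> ereal (\<gamma> (dist \<eta>\<^sub>1 \<eta>\<^sub>2) * \<rho> t (norm x) (norm u))))"

definition hyp_0 ::
    "('l::metric_space \<Rightarrow> 'e::real_normed_vector) \<Rightarrow> ('x::metric_space \<Rightarrow> 'h::real_normed_vector) \<Rightarrow> bool" where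
  "hyp_0 x\<^sub>0 u\<^sub>0 \<longleftrightarrow>
     continuous_on UNIV x\<^sub>0 \<and> continuous_on UNIV u\<^sub>0 \<and>
     (\<forall>D. bounded D \<longrightarrow> (\<exists>M>0. \<forall>(\<zeta>, \<eta>)\<in>D. max (norm (x\<^sub>0 \<zeta>)) (norm (u\<^sub>0 \<eta>)) \<le> M))"

definition hyp_W ::
    "real \<Rightarrow> (real \<Rightarrow> 'y::{real_inner, banach, second_countable_topology} set) \<Rightarrow> bool" where
  "hyp_W b W \<longleftrightarrow>
     multi_measurable b W \<and>
     (\<forall>t\<in>{0..b}. W t \<noteq> {} \<and> closed (W t) \<and> convex (W t)) \<and>
     (\<exists>\<phi>\<in>L2_space b. (\<forall>t\<in>{0..b}. 0 \<le> \<phi> t) \<and>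
        (AE t in lebesgue_on {0..b}. set_norm (W t) \<le> ereal (\<phi> t)))"

definition hyp_kappa :: "real \<Rightarrow> (real \<Rightarrow> real \<Rightarrow> real) \<Rightarrow> bool" where
  "hyp_kappa b \<kappa> \<longleftrightarrow>
     (\<forall>t\<in>{0..b}. \<forall>r\<ge>0. 0 \<le> \<kappa> t r) \<and>
     (\<forall>r\<ge>0. (\<lambda>t. \<kappa> t r) \<in> borel_measurable (lebesgue_on {0..b})) \<and>
     (AE t in lebesgue_on {0..b}. continuous_on {0..} (\<kappa> t)) \<and>
     (AE t in lebesgue_on {0..b}. \<kappa> t 0 = 0) \<and>
     (\<forall>R>0. \<exists>\<beta>\<in>L1_nonneg b. AE t in lebesgue_on {0..b}. \<forall>r\<in>{0..R}. \<kappa> t r \<le> \<beta> t)"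

definition hyp_ell ::
    "real \<Rightarrow> (real \<Rightarrow> 'e::real_normed_vector \<Rightarrow> 'h::real_normed_vector \<Rightarrow>
       'l::metric_space \<Rightarrow> 'x::metric_space \<Rightarrow> real) \<Rightarrow> bool" where
  "hyp_ell b ell \<longleftrightarrow>
     (\<forall>x u \<zeta> \<eta>. (\<lambda>t. ell t x u \<zeta> \<eta>) \<in> borel_measurable (lebesgue_on {0..b})) \<and>
     (\<exists>\<kappa>. hyp_kappa b \<kappa> \<and> (AE t in lebesgue_on {0..b}. \<forall>x y u \<zeta> \<eta>.
        \<bar>ell t x u \<zeta> \<eta> - ell t y u \<zeta> \<eta>\<bar> \<le> (1 + max (norm x) (norm y)) * \<kappa> t (norm (x - y)))) \<and>
     (AE t in lebesgue_on {0..b}. \<forall>x \<zeta> \<eta>. convex_on UNIV (\<lambda>u. ell t x u \<zeta> \<eta>)) \<and>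
     (\<forall>D. bounded D \<longrightarrow> (\<exists>\<theta>\<in>L1_nonneg b. AE t in lebesgue_on {0..b}. \<forall>u. \<forall>(\<zeta>, \<eta>)\<in>D.
        \<bar>ell t 0 u \<zeta> \<eta>\<bar> \<le> \<theta> t * (1 + norm u))) \<and>
     (AE t in lebesgue_on {0..b}. continuous_on UNIV (\<lambda>(x, u, \<zeta>, \<eta>). ell t x u \<zeta> \<eta>))"

definition hyp_phi ::
    "('e::real_normed_vector \<Rightarrow> 'h::real_normed_vector \<Rightarrow> 'l::metric_space \<Rightarrow> 'x::metric_space \<Rightarrow> real) \<Rightarrow> bool" where
  "hyp_phi \<phi> \<longleftrightarrow> continuous_on UNIV (\<lambda>(x, u, \<zeta>, \<eta>). \<phi> x u \<zeta> \<eta>)"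

section \<open>Controls, solutions and costs\<close>

definition admissible_controls ::
    "real \<Rightarrow> (real \<Rightarrow> 'y::{real_inner, banach, second_countable_topology} set) \<Rightarrow> (real \<Rightarrow> 'y) set" where
  "admissible_controls b W = {w \<in> L2_space b. AE t in lebesgue_on {0..b}. w t \<in> W t}"

definition mild_solutions ::
    "real \<Rightarrow> ('l \<Rightarrow> real \<Rightarrow> 'e \<Rightarrow>\<^sub>L 'e) \<Rightarrow> (real \<Rightarrow> 'h \<Rightarrow> 'x \<Rightarrow> 'h \<Rightarrow> 'h set) \<Rightarrow>
     (real \<Rightarrow> 'e \<Rightarrow> 'h \<Rightarrow> 'l \<Rightarrow> 'e set) \<Rightarrow> (real \<Rightarrow> 'e \<Rightarrow> 'h \<Rightarrow> 'x \<Rightarrow> 'h set) \<Rightarrow>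
     ('y \<Rightarrow>\<^sub>L 'e) \<Rightarrow> ('l \<Rightarrow> 'e) \<Rightarrow> ('x \<Rightarrow> 'h) \<Rightarrow> 'l::metric_space \<Rightarrow> 'x::metric_space \<Rightarrow>
     (real \<Rightarrow> 'y::{real_inner, banach, second_countable_topology}) \<Rightarrow>
     ((real \<Rightarrow> 'e::{real_inner, banach, second_countable_topology}) \<times>
      (real \<Rightarrow> 'h::{real_inner, banach, second_countable_topology})) set" where
  "mild_solutions b T B F G \<B> x\<^sub>0 u\<^sub>0 \<zeta> \<eta> w =
     {(x, u). continuous_on {0..b} x \<and> u 0 = u\<^sub>0 \<eta> \<and>
        (\<exists>u' f g. has_W12_derivative b u u' \<and>
           integrable (lebesgue_on {0..b}) f \<and> integrable (lebesgue_on {0..b}) g \<and>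
           (AE t in lebesgue_on {0..b}.
              f t \<in> F t (x t) (u t) \<zeta> \<and> g t \<in> G t (x t) (u t) \<eta> \<and>
              - u' t + g t \<in> B t (u t) \<eta> (u t)) \<and>
           (\<forall>t\<in>{0..b}. x t = blinfun_apply (T \<zeta> t) (x\<^sub>0 \<zeta>) +
              (\<integral>s. blinfun_apply (T \<zeta> (t - s)) (f s + blinfun_apply \<B> (w s)) \<partial>lebesgue_on {0..t})))}"

definition cost ::
    "real \<Rightarrow> (real \<Rightarrow> 'e \<Rightarrow> 'h \<Rightarrow> 'l \<Rightarrow> 'x \<Rightarrow> real) \<Rightarrow> ('e \<Rightarrow> 'h \<Rightarrow> 'l \<Rightarrow> 'x \<Rightarrow> real) \<Rightarrow>
     'l \<Rightarrow> 'x \<Rightarrow> (real \<Rightarrow> 'e) \<times> (real \<Rightarrow> 'h) \<Rightarrow> real" where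
  "cost b ell \<phi> \<zeta> \<eta> = (\<lambda>(x, u).
     (\<integral>t. ell t (x t) (u t) \<zeta> \<eta> \<partial>lebesgue_on {0..b}) + \<phi> (x b) (u b) \<zeta> \<eta>)"

definition control_cost ::
    "real \<Rightarrow> (real \<Rightarrow> 'y::{real_inner, banach, second_countable_topology}) \<Rightarrow> real" where
  "control_cost b w = 1 / 2 * (\<integral>t. (norm (w t))\<^sup>2 \<partial>lebesgue_on {0..b})"

text \<open>The infimum over the solution set, taken in the extended reals.\<close>

definition min_cost ::
    "real \<Rightarrow> ('l \<Rightarrow> real \<Rightarrow> 'e::{real_inner, banach, second_countable_topology} \<Rightarrow>\<^sub>L 'e) \<Rightarrow>
     (real \<Rightarrow> 'h::{real_inner, banach, second_countable_topology} \<Rightarrow> 'x \<Rightarrow> 'h \<Rightarrow> 'h set) \<Rightarrow>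
     (real \<Rightarrow> 'e \<Rightarrow> 'h \<Rightarrow> 'l \<Rightarrow> 'e set) \<Rightarrow> (real \<Rightarrow> 'e \<Rightarrow> 'h \<Rightarrow> 'x \<Rightarrow> 'h set) \<Rightarrow>
     ('y \<Rightarrow>\<^sub>L 'e) \<Rightarrow> ('l \<Rightarrow> 'e) \<Rightarrow> ('x \<Rightarrow> 'h) \<Rightarrow>
     (real \<Rightarrow> 'e \<Rightarrow> 'h \<Rightarrow> 'l \<Rightarrow> 'x \<Rightarrow> real) \<Rightarrow> ('e \<Rightarrow> 'h \<Rightarrow> 'l \<Rightarrow> 'x \<Rightarrow> real) \<Rightarrow>
     'l::metric_space \<Rightarrow> 'x::metric_space \<Rightarrow>
     (real \<Rightarrow> 'y::{real_inner, banach, second_countable_topology}) \<Rightarrow> ereal" where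
  "min_cost b T B F G \<B> x\<^sub>0 u\<^sub>0 ell \<phi> \<zeta> \<eta> w =
     (INF p \<in> mild_solutions b T B F G \<B> x\<^sub>0 u\<^sub>0 \<zeta> \<eta> w. ereal (cost b ell \<phi> \<zeta> \<eta> p))"

end

theory Submission
  imports Defs "HOL-Library.Diagonal_Subsequence"
begin

text \<open>
  If every solution set is empty, all values are \<open>\<infinity>\<close> and any measurable selection of \<open>W\<close> is optimal,
  so no existence theory for the system is needed. Otherwise the direct method is applied to a
  minimizing sequence. Comparing the monotone inclusion at \<open>t\<close> and \<open>t - h\<close> bounds the derivative
  of \<open>u\<close> pointwise, and Gronwall's inequality bounds all trajectories uniformly. The compactness of
  the semigroup and of the domains of \<open>B\<close>, with a diagonal argument over rational times, yields
  a subsequence whose states converge strongly at every time.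

  Weak compactness in \<open>L^2\<close> is replaced by convex combinations: suitable convex combinations of the
  tails of the controls, selections and derivatives converge almost everywhere, and convexity of
  \<open>W\<close>, of the values of \<open>F\<close> and \<open>G\<close>, of the graph condition for \<open>B\<close> in its second component and of
  the control cost carries every inclusion, and the lower bound for the cost, to the limit.
\<close>

section \<open>Convex sets and monotone operators\<close>

text \<open>The parameters move along the minimizing sequence, so all bounds must be uniform over
  \<open>P\<close> and each limit passage must also exchange the data at \<open>\<zeta> n\<close>,
  \<open>\<eta> n\<close> for those at the limit. The semigroups converge in operator norm only away
  from time 0, and the values \<open>x n s\<close> are merely bounded. Trajectories are therefore
  restarted at a rational time shortly before \<open>t\<close>: the piece in between is small by an
  integrable majorant, and a compact operator of the limit semigroup acts on \<open>x n s\<close>.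
  Strong convergence of the states is what makes averaging harmless: for fixed \<open>t\<close> the
  selections lie ever closer to one fixed closed convex set, and tail averages keep every limit
  already obtained. A single family of weights has to serve controls, selections and derivatives,
  since these are coupled in the inclusion for \<open>- u' + g\<close> and in the mild formula. The
  comparison of times \<open>t\<close> and \<open>t - h\<close> requires almost everywhere
  differentiation of Hilbert-valued integrals. Convergence in L1 of backward difference quotients,
  followed by a subsequence, is enough for this.\<close>

lemma infdist_lessE:
  assumes "infdist x S < e" "S \<noteq> {}"
  obtains y where "y \<in> S" "dist x y < e"
  using assms cInf_lessD[of "dist x ` S" e] by (auto simp: infdist_def)

text \<open>Midpoints stay in the convex set, so the parallelogram identity bounds the distance of
  two points by the gap of their norms to the infimum. This makes a minimizing sequence Cauchy and
  the minimizer unique. It serves both the minimal section of \<open>B\<close> and the selection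
  from \<open>W\<close>.\<close>

lemma ex1_min_norm:
  fixes S :: "'a::{real_inner, complete_space} set"
  assumes "closed S" "convex S" "S \<noteq> {}"
  shows "\<exists>!y. y \<in> S \<and> (\<forall>z\<in>S. norm y \<le> norm z)"
proof -
  define d where "d = infdist 0 S"
  have d0: "d \<ge> 0" unfolding d_def by (rule infdist_nonneg)
  have dle: "d \<le> norm z" if "z \<in> S" for z
    unfolding d_def using infdist_le[OF that, of 0] by simp
  have par: "(norm (x - y))\<^sup>2 \<le> 2 * (norm x)\<^sup>2 + 2 * (norm y)\<^sup>2 - 4 * d\<^sup>2" if "x \<in> S" "y \<in> S" for x y
  proof -
    have "(1/2) *\<^sub>R x + (1/2) *\<^sub>R y \<in> S"
      using assms(2) that by (intro convexD) auto
    then have "d\<^sup>2 \<le> (norm ((1/2) *\<^sub>R x + (1/2) *\<^sub>R y))\<^sup>2"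
      using dle d0 by (intro power_mono) auto
    moreover have "(norm ((1/2) *\<^sub>R x + (1/2) *\<^sub>R y))\<^sup>2 * 4 + (norm (x - y))\<^sup>2 = 2 * (norm x)\<^sup>2 + 2 * (norm y)\<^sup>2"
      unfolding power2_norm_eq_inner by (simp add: inner_simps inner_commute)
    ultimately show ?thesis by linarith
  qed
  have "\<exists>y\<in>S. norm y < d + 1 / real (Suc n)" for n
  proof -
    have "infdist 0 S < d + 1 / real (Suc n)" unfolding d_def by simp
    then show ?thesis using infdist_lessE[OF _ assms(3)] by (metis dist_0_norm)
  qed
  then obtain y where y: "\<And>n. y n \<in> S" "\<And>n. norm (y n) < d + 1 / real (Suc n)" by metis
  define e where "e n = 4 * ((d + 1 / real (Suc n))\<^sup>2 - d\<^sup>2)" for n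
  have elim: "e \<longlonglongrightarrow> 0"
  proof -
    have "(\<lambda>n. 4 * ((d + 1 / real (Suc n))\<^sup>2 - d\<^sup>2)) \<longlonglongrightarrow> 4 * ((d + 0)\<^sup>2 - d\<^sup>2)"
      by (intro tendsto_intros) (rule LIMSEQ_Suc[OF lim_1_over_n])
    then show ?thesis by (simp add: e_def[abs_def])
  qed
  have ybd: "(norm (y m))\<^sup>2 \<le> (d + 1 / real (Suc n))\<^sup>2" if "n \<le> m" for m n
  proof (rule power_mono)
    have "1 / real (Suc m) \<le> 1 / real (Suc n)" using that by (simp add: frac_le)
    then show "norm (y m) \<le> d + 1 / real (Suc n)" using y(2)[of m] by linarith
  qed auto
  have ee: "(norm (y m - y k))\<^sup>2 \<le> e n" if "n \<le> m" "n \<le> k" for m n k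
    using par[OF y(1)[of m] y(1)[of k]] ybd[OF that(1)] ybd[OF that(2)] by (simp add: e_def)
  have "Cauchy y"
  proof (rule CauchyI)
    fix \<epsilon> :: real assume "0 < \<epsilon>"
    then have "eventually (\<lambda>n. e n < \<epsilon>\<^sup>2) sequentially" using elim by (intro order_tendstoD(2)) auto
    then obtain N where "e N < \<epsilon>\<^sup>2" by (auto simp: eventually_sequentially)
    then have "norm (y m - y k) < \<epsilon>" if "N \<le> m" "N \<le> k" for m k
      using ee[OF that] \<open>0 < \<epsilon>\<close> by (meson le_less_trans less_imp_le power_less_imp_less_base)
    then show "\<exists>M. \<forall>m\<ge>M. \<forall>n\<ge>M. norm (y m - y n) < \<epsilon>" by blast
  qed
  then obtain l where l: "y \<longlonglongrightarrow> l" using Cauchy_convergent convergent_def by blast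
  have lS: "l \<in> S" using closed_sequentially[OF assms(1)] y(1) l by blast
  have "norm l \<le> d + 0"
  proof (rule LIMSEQ_le[OF tendsto_norm[OF l]])
    show "(\<lambda>n. d + 1 / real (Suc n)) \<longlonglongrightarrow> d + 0" 
      by (intro tendsto_intros) (rule LIMSEQ_Suc[OF lim_1_over_n])
    show "\<exists>N. \<forall>n\<ge>N. norm (y n) \<le> d + 1 / real (Suc n)" using y(2) less_imp_le by blast
  qed
  then have ld: "norm l = d" using dle[OF lS] by simp
  show ?thesis
  proof (rule ex1I[of _ l])
    show "l \<in> S \<and> (\<forall>z\<in>S. norm l \<le> norm z)" using lS ld dle by auto
    fix z assume z: "z \<in> S \<and> (\<forall>w\<in>S. norm z \<le> norm w)"
    then have "norm z = d" using lS ld dle by force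
    then show "z = l" using par[of z l] z lS ld by auto
  qed
qed

section \<open>Maximal monotone operators and their graph inequalities\<close>

text \<open>Adjoining a pair that satisfies all inequalities gives a monotone extension, which
  maximality forces to be \<open>B\<close> itself. Closedness, convexity and the later limit passage
  all reduce to these inequalities, which are affine in \<open>y\<close>.\<close>

lemma maximal_monotone_iff_mem:
  assumes "maximal_monotone B"
  shows "y \<in> B v \<longleftrightarrow> (\<forall>x'. \<forall>y'\<in>B x'. 0 \<le> (y - y') \<bullet> (v - x'))"
proof
  assume "y \<in> B v"
  then show "\<forall>x'. \<forall>y'\<in>B x'. 0 \<le> (y - y') \<bullet> (v - x')"
    using assms unfolding maximal_monotone_def monotone_op_def by blast
next
  assume a: "\<forall>x'. \<forall>y'\<in>B x'. 0 \<le> (y - y') \<bullet> (v - x')"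
  have a': "0 \<le> (y' - y) \<bullet> (x' - v)" if "y' \<in> B x'" for x' y'
  proof -
    have "(y' - y) \<bullet> (x' - v) = (y - y') \<bullet> (v - x')" by (simp add: inner_simps)
    then show ?thesis using a that by simp
  qed
  have mon: "monotone_op B" using assms unfolding maximal_monotone_def by blast
  then have m: "\<And>x y x' y'. y \<in> B x \<Longrightarrow> y' \<in> B x' \<Longrightarrow> 0 \<le> (y - y') \<bullet> (x - x')"
    unfolding monotone_op_def by blast
  define B' where "B' = B(v := insert y (B v))"
  have B': "y1 \<in> B' x1 \<longleftrightarrow> y1 \<in> B x1 \<or> (x1 = v \<and> y1 = y)" for x1 y1
    by (auto simp: B'_def)
  have "monotone_op B'"
    unfolding monotone_op_def Ball_def B' using m a a' by auto
  moreover have "\<forall>x. B x \<subseteq> B' x" by (auto simp: B')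
  ultimately have "B' = B" using assms unfolding maximal_monotone_def by blast
  then show "y \<in> B v" using B'[of y v] by simp
qed

lemma maximal_monotone_closed:
  assumes "maximal_monotone B"
  shows "closed (B v)"
proof -
  have "B v = (\<Inter>x'. \<Inter>y'\<in>B x'. {y. 0 \<le> (y - y') \<bullet> (v - x')})"
    by (rule set_eqI) (subst maximal_monotone_iff_mem[OF assms], simp)
  also have "closed \<dots>"
    by (intro closed_INT ballI closed_Collect_le continuous_intros)
  finally show ?thesis .
qed

lemma maximal_monotone_convex:
  assumes "maximal_monotone B"
  shows "convex (B v)"
proof (rule convexI)
  fix x y :: 'a and s t :: real
  assume h: "x \<in> B v" "y \<in> B v" "0 \<le> s" "0 \<le> t" "s + t = 1"
  show "s *\<^sub>R x + t *\<^sub>R y \<in> B v"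
  proof (subst maximal_monotone_iff_mem[OF assms], intro allI ballI)
    fix x' y' assume "y' \<in> B x'"
    then have "0 \<le> (x - y') \<bullet> (v - x')" "0 \<le> (y - y') \<bullet> (v - x')"
      using h maximal_monotone_iff_mem[OF assms] by blast+
    then have "0 \<le> s * ((x - y') \<bullet> (v - x')) + t * ((y - y') \<bullet> (v - x'))"
      using h by simp
    also have "\<dots> = (s *\<^sub>R x + t *\<^sub>R y - (s + t) *\<^sub>R y') \<bullet> (v - x')"
      by (simp add: inner_simps algebra_simps)
    finally show "0 \<le> (s *\<^sub>R x + t *\<^sub>R y - y') \<bullet> (v - x')" using h by simp
  qed
qed

text \<open>The definite description is meaningful here because the values are closed and convex, so
  that a unique element of least norm exists.\<close>

lemma minimal_section_mem:
  fixes B :: "'a::{real_inner, complete_space} \<Rightarrow> 'a set"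
  assumes "maximal_monotone B" "v \<in> op_dom B"
  shows "minimal_section B v \<in> B v"
proof -
  have "\<exists>!y. y \<in> B v \<and> (\<forall>z\<in>B v. norm y \<le> norm z)"
    using assms by (intro ex1_min_norm maximal_monotone_closed maximal_monotone_convex) (auto simp: op_dom_def)
  from theI'[OF this] show ?thesis unfolding minimal_section_def by blast
qed

text \<open>For \<open>r = 0\<close> this is monotonicity across the two graphs; \<open>r\<close>
  thus measures how far it fails between \<open>B1\<close> and \<open>B2\<close>, relative to the
  size of the chosen values.\<close>

lemma op_dis_le_imp_inner_le:
  assumes "op_dis B1 B2 \<le> ereal r" "y \<in> B1 x" "y' \<in> B2 x'"
  shows "(y - y') \<bullet> (x' - x) \<le> r * (1 + norm y + norm y')"
proof -
  have "ereal (((y - y') \<bullet> (x' - x)) / (1 + norm y + norm y')) \<le> op_dis B1 B2"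
    unfolding op_dis_def
    by (rule Sup_upper, rule CollectI, rule exI[of _ x], rule exI[of _ y], rule exI[of _ x'], rule exI[of _ y'])
       (use assms in \<open>auto simp: op_dom_def\<close>)
  with assms(1) have "((y - y') \<bullet> (x' - x)) / (1 + norm y + norm y') \<le> r"
    using order_trans ereal_less_eq(3) by blast
  moreover have "0 < 1 + norm y + norm y'" by (simp add: add_pos_nonneg)
  ultimately show ?thesis by (simp add: pos_divide_le_eq)
qed

section \<open>Weakly compact sets, distances to convex sets, Hausdorff bounds\<close>

text \<open>For \<open>l\<close> outside \<open>S\<close>, let \<open>V y\<close> be the weakly open
  half-space beyond the perpendicular bisector of \<open>l\<close> and \<open>y\<close>. These cover
  \<open>S\<close>, so finitely many do, yet a sequence converging to \<open>l\<close> eventually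
  leaves each of them.\<close>

lemma weakly_compact_imp_closed:
  fixes S :: "'a::real_inner set"
  assumes "weakly_compact S"
  shows "closed S"
  unfolding closed_sequential_limits
proof (intro allI impI)
  fix s l assume h: "(\<forall>n. s n \<in> S) \<and> s \<longlonglongrightarrow> l"
  show "l \<in> S"
  proof (rule ccontr)
    assume "l \<notin> S"
    define V where "V y = {z. (norm (y - l))\<^sup>2 / 2 < (z - l) \<bullet> (y - l)}" for y
    have "openin weak_topology (V y)" for y
    proof -
      have "V y = (\<lambda>z. z \<bullet> (y - l)) -` {l \<bullet> (y - l) + (norm (y - l))\<^sup>2 / 2 <..}"
        by (auto simp: V_def inner_diff_left)
      moreover have "bounded_linear (\<lambda>z. z \<bullet> (y - l))" by (rule bounded_linear_inner_left)
      ultimately show ?thesis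
        unfolding weak_topology_def by (intro topology_generated_by_Basis) (use open_greaterThan in blast)
    qed
    moreover have "S \<subseteq> \<Union>(V ` S)"
    proof
      fix y assume "y \<in> S"
      then have "y \<noteq> l" using \<open>l \<notin> S\<close> by auto
      then have "y \<in> V y" unfolding V_def by (simp add: power2_norm_eq_inner[symmetric])
      then show "y \<in> \<Union>(V ` S)" using \<open>y \<in> S\<close> by blast
    qed
    ultimately obtain \<F> where \<F>: "finite \<F>" "\<F> \<subseteq> V ` S" "S \<subseteq> \<Union>\<F>"
      using assms unfolding weakly_compact_def compactin_def by (metis (no_types, lifting) imageE)
    then obtain Y where Y: "finite Y" "Y \<subseteq> S" "\<F> = V ` Y" by (meson finite_subset_image)
    have "\<forall>\<^sub>F n in sequentially. s n \<notin> V y" if "y \<in> Y" for y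
    proof -
      have "y \<noteq> l" using that Y \<open>l \<notin> S\<close> by auto
      have "(\<lambda>n. (s n - l) \<bullet> (y - l)) \<longlonglongrightarrow> (l - l) \<bullet> (y - l)"
        using h by (intro tendsto_intros) auto
      then have "(\<lambda>n. (s n - l) \<bullet> (y - l)) \<longlonglongrightarrow> 0" by simp
      then have "\<forall>\<^sub>F n in sequentially. (s n - l) \<bullet> (y - l) < (norm (y - l))\<^sup>2 / 2"
        using \<open>y \<noteq> l\<close> by (intro order_tendstoD(2)) auto
      then show ?thesis by eventually_elim (auto simp: V_def)
    qed
    then have "\<forall>\<^sub>F n in sequentially. \<forall>y\<in>Y. s n \<notin> V y" using Y(1) by (simp add: eventually_ball_finite)
    then obtain n where "\<forall>y\<in>Y. s n \<notin> V y" by (auto simp: eventually_sequentially)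
    then show False using h \<F> Y by blast
  qed
qed

text \<open>The distance to a convex set is a convex function: near points in \<open>K\<close>,
  chosen up to \<open>\<epsilon>\<close>, are averaged with the same weights. Nearest points need
  not exist, hence the slack.\<close>

lemma infdist_convex_comb_le:
  fixes y :: "'i \<Rightarrow> 'a::real_normed_vector"
  assumes "convex K" "K \<noteq> {}" "finite I" "\<And>i. i \<in> I \<Longrightarrow> 0 \<le> c i" "sum c I = 1"
    "\<And>i. i \<in> I \<Longrightarrow> infdist (y i) K \<le> e i"
  shows "infdist (\<Sum>i\<in>I. c i *\<^sub>R y i) K \<le> (\<Sum>i\<in>I. c i * e i)"
proof (rule field_le_epsilon)
  fix \<epsilon> :: real assume "0 < \<epsilon>"
  have "\<exists>k\<in>K. dist (y i) k < e i + \<epsilon>" if "i \<in> I" for i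
    using infdist_lessE[OF _ assms(2), of "y i" "e i + \<epsilon>"] assms(6)[OF that] \<open>0 < \<epsilon>\<close> by (smt (verit))
  then obtain k where k: "\<And>i. i \<in> I \<Longrightarrow> k i \<in> K" "\<And>i. i \<in> I \<Longrightarrow> dist (y i) (k i) < e i + \<epsilon>" by metis
  have "(\<Sum>i\<in>I. c i *\<^sub>R k i) \<in> K"
    using assms k by (intro convex_sum) auto
  then have "infdist (\<Sum>i\<in>I. c i *\<^sub>R y i) K \<le> dist (\<Sum>i\<in>I. c i *\<^sub>R y i) (\<Sum>i\<in>I. c i *\<^sub>R k i)"
    by (rule infdist_le)
  also have "\<dots> = norm (\<Sum>i\<in>I. c i *\<^sub>R (y i - k i))"
    by (simp add: dist_norm sum_subtractf scaleR_diff_right)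
  also have "\<dots> \<le> (\<Sum>i\<in>I. c i * (e i + \<epsilon>))"
  proof (rule sum_norm_le)
    fix i assume "i \<in> I"
    then show "norm (c i *\<^sub>R (y i - k i)) \<le> c i * (e i + \<epsilon>)"
      using k(2)[of i] assms(4)[of i] by (auto simp: dist_norm intro!: mult_left_mono)
  qed
  also have "\<dots> = (\<Sum>i\<in>I. c i * e i) + (\<Sum>i\<in>I. c i) * \<epsilon>"
    by (simp add: algebra_simps sum.distrib sum_distrib_left)
  finally show "infdist (\<Sum>i\<in>I. c i *\<^sub>R y i) K \<le> (\<Sum>i\<in>I. c i * e i) + \<epsilon>" using assms by simp
qed

lemma infdist_le_Haus:
  assumes "Haus S S' \<le> ereal r" "s \<in> S"
  shows "infdist s S' \<le> r"
proof -
  have "ereal (infdist s S') \<le> Haus S S'"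
    unfolding Haus_def by (rule max.coboundedI1) (rule SUP_upper[OF assms(2)])
  then show ?thesis using assms(1) by (meson ereal_less_eq(3) order_trans)
qed

text \<open>The triangle inequality passes through a near point of \<open>S'\<close>. Nonemptiness
  matters because \<open>infdist\<close> to the empty set is 0 by convention and would supply no
  such point.\<close>

lemma infdist_le_Haus_trans:
  assumes "Haus S S' \<le> ereal r" "Haus S' S'' \<le> ereal r'" "s \<in> S" "S' \<noteq> {}"
  shows "infdist s S'' \<le> r + r'"
proof (rule field_le_epsilon)
  fix \<epsilon> :: real assume "0 < \<epsilon>"
  have "infdist s S' < r + \<epsilon>" using infdist_le_Haus[OF assms(1,3)] \<open>0 < \<epsilon>\<close> by linarith
  then obtain k where k: "k \<in> S'" "dist s k < r + \<epsilon>" using infdist_lessE[OF _ assms(4)] by blast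
  have "infdist s S'' \<le> infdist k S'' + dist s k" by (rule infdist_triangle)
  also have "\<dots> \<le> r' + (r + \<epsilon>)" using infdist_le_Haus[OF assms(2) k(1)] k(2) by linarith
  finally show "infdist s S'' \<le> r + r' + \<epsilon>" by simp
qed

lemma norm_le_set_norm:
  assumes "set_norm S \<le> ereal r" "s \<in> S"
  shows "norm s \<le> r"
  using assms SUP_upper[OF assms(2), of "\<lambda>s. ereal (norm s)"] unfolding set_norm_def
  by (meson ereal_less_eq(3) order_trans)

section \<open>Measurable selection of controls\<close>

text \<open>Balls with centres in a countable dense set and rational radii suffice. Closed balls are
  wanted because preimages under the selection below are first shown measurable for closed convex
  sets only.\<close>

lemma open_countable_Union_cballs:
  fixes U :: "'a::{metric_space, second_countable_topology} set"
  assumes "open U"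
  obtains \<C> where "countable \<C>" "U = \<Union>\<C>" "\<And>C. C \<in> \<C> \<Longrightarrow> \<exists>y r. C = cball y r"
proof -
  obtain D :: "'a set" where D: "countable D" "\<And>X. open X \<Longrightarrow> X \<noteq> {} \<Longrightarrow> \<exists>d\<in>D. d \<in> X"
    using countable_dense_setE by metis
  define \<C> where "\<C> = {C \<in> (\<lambda>(y, r). cball y r) ` (D \<times> \<rat>). C \<subseteq> U}"
  show ?thesis
  proof (rule that[of \<C>])
    show "countable \<C>" unfolding \<C>_def
      by (rule countable_subset[OF _ countable_image[OF countable_SIGMA[OF D(1) countable_rat]]]) blast
    show "U = \<Union>\<C>"
    proof
      show "U \<subseteq> \<Union>\<C>"
      proof
        fix x assume "x \<in> U"
        then obtain e where e: "0 < e" "ball x e \<subseteq> U" using assms open_contains_ball by blast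
        obtain r where r: "r \<in> \<rat>" "0 < r" "r < e / 2" using Rats_dense_in_real[of 0 "e / 2"] e by auto
        obtain d where d: "d \<in> D" "d \<in> ball x r" using D(2)[of "ball x r"] r by auto
        have "cball d r \<subseteq> ball x e"
        proof
          fix z assume "z \<in> cball d r"
          then have "dist x z < e" using d r dist_triangle[of x z d] by (simp add: dist_commute)
          then show "z \<in> ball x e" by simp
        qed
        then have "cball d r \<in> \<C>" unfolding \<C>_def using d r e by auto
        moreover have "x \<in> cball d r" using d by (simp add: dist_commute)
        ultimately show "x \<in> \<Union>\<C>" by blast
      qed
    qed (auto simp: \<C>_def)
    show "\<exists>y r. C = cball y r" if "C \<in> \<C>" for C using that by (auto simp: \<C>_def)
  qed
qed

text \<open>The selection is the projection of 0 onto \<open>W t\<close>. Measurability of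
  \<open>W\<close> makes \<open>hit C\<close> measurable for closed \<open>C\<close>, and membership
  of the projection in a closed convex set can be expressed by countably many such sets.\<close>

lemma measurable_min_norm_selection:
  fixes W :: "real \<Rightarrow> 'y::{real_inner, banach, second_countable_topology} set"
  assumes W: "multi_measurable b W" "\<And>t. t \<in> {0..b} \<Longrightarrow> W t \<noteq> {} \<and> closed (W t) \<and> convex (W t)"
  obtains p where "p \<in> borel_measurable (lebesgue_on {0..b})" "\<And>t. t \<in> {0..b} \<Longrightarrow> p t \<in> W t"
proof -
  define M where "M = lebesgue_on {0..b}"
  have sp: "space M = {0..b}" by (simp add: M_def)
  define hit where "hit C = {t \<in> {0..b}. W t \<inter> C \<noteq> {}}" for C
  have hit [measurable]: "hit C \<in> sets M" if "closed C" for C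
  proof -
    have "{t\<in>{0..b}. W t \<subseteq> - C} \<in> sets M"
      using W(1) that unfolding multi_measurable_def M_def by auto
    then have "space M - {t\<in>{0..b}. W t \<subseteq> - C} \<in> sets M" by blast
    also have "space M - {t\<in>{0..b}. W t \<subseteq> - C} = hit C" by (auto simp: hit_def sp)
    finally show ?thesis .
  qed
  define p where "p t = (THE y. y \<in> W t \<and> (\<forall>z\<in>W t. norm y \<le> norm z))" for t
  have p: "p t \<in> W t" "\<And>z. z \<in> W t \<Longrightarrow> norm (p t) \<le> norm z"
    and pu: "\<And>z. z \<in> W t \<Longrightarrow> norm z \<le> norm (p t) \<Longrightarrow> z = p t" if "t \<in> {0..b}" for t
  proof -
    have ex: "\<exists>!y. y \<in> W t \<and> (\<forall>z\<in>W t. norm y \<le> norm z)"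
      using W(2)[OF that] by (intro ex1_min_norm) auto
    from theI'[OF this] show *: "p t \<in> W t" "\<And>z. z \<in> W t \<Longrightarrow> norm (p t) \<le> norm z"
      unfolding p_def by blast+
    show "z = p t" if "z \<in> W t" "norm z \<le> norm (p t)" for z
    proof -
      have "z \<in> W t \<and> (\<forall>y\<in>W t. norm z \<le> norm y)" using that * order_trans by blast
      then show ?thesis using ex * by blast
    qed
  qed
  \<comment> \<open>\<open>p t\<close> lies in \<open>C\<close> exactly when, for each rational
    \<open>q\<close>, a set \<open>W t\<close> that meets the ball of radius \<open>q\<close>
    already meets it inside \<open>C\<close>.\<close>
  have key: "p -` C \<inter> space M \<in> sets M" if C: "closed C" "convex C" for C
  proof -
    have "p -` C \<inter> space M = space M \<inter> (\<Inter>q\<in>\<rat>. (space M - hit (cball 0 q)) \<union> hit (C \<inter> cball 0 q))"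
    proof (intro equalityI subsetI)
      fix t assume t: "t \<in> p -` C \<inter> space M"
      then have tb: "t \<in> {0..b}" by (simp add: sp)
      have "t \<in> hit (C \<inter> cball 0 q)" if "t \<in> hit (cball 0 q)" for q
      proof -
        have "norm (p t) \<le> q" using that p(2)[OF tb] by (force simp: hit_def)
        then show ?thesis using t tb p(1)[OF tb] by (auto simp: hit_def)
      qed
      then show "t \<in> space M \<inter> (\<Inter>q\<in>\<rat>. (space M - hit (cball 0 q)) \<union> hit (C \<inter> cball 0 q))"
        using t by auto
    next
      fix t assume t: "t \<in> space M \<inter> (\<Inter>q\<in>\<rat>. (space M - hit (cball 0 q)) \<union> hit (C \<inter> cball 0 q))"
      then have tb: "t \<in> {0..b}" by (simp add: sp)
      have h: "W t \<inter> (C \<inter> cball 0 q) \<noteq> {}" if "q \<in> \<rat>" "norm (p t) \<le> q" for q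
      proof -
        have "t \<in> hit (cball 0 q)" using tb p(1)[OF tb] that by (auto simp: hit_def)
        then show ?thesis using t that unfolding hit_def by blast
      qed
      obtain q where q: "q \<in> \<rat>" "norm (p t) < q"
        using Rats_dense_in_real[of "norm (p t)" "norm (p t) + 1"] by auto
      have "W t \<inter> C \<noteq> {}" using h[OF q(1)] q by force
      \<comment> \<open>Convexity of \<open>C\<close> enters here: \<open>W t \<inter> C\<close> has
        its own element of least norm. Its norm cannot exceed that of \<open>p t\<close>, so
        uniqueness in \<open>W t\<close> identifies the two.\<close>
      then obtain y where y: "y \<in> W t \<inter> C" "\<And>z. z \<in> W t \<inter> C \<Longrightarrow> norm y \<le> norm z"
        using ex1_min_norm[of "W t \<inter> C"] W(2)[OF tb] C by (metis closed_Int convex_Int)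
      have "norm y \<le> norm (p t)"
      proof (rule ccontr)
        assume "\<not> norm y \<le> norm (p t)"
        then obtain q where q: "q \<in> \<rat>" "norm (p t) < q" "q < norm y"
          using Rats_dense_in_real[of "norm (p t)" "norm y"] by auto
        obtain z where "z \<in> W t \<inter> C" "norm z \<le> q" using h[OF q(1)] q by force
        then show False using y(2)[of z] q by simp
      qed
      then have "y = p t" using pu[OF tb] y by blast
      then show "t \<in> p -` C \<inter> space M" using y t by auto
    qed
    also have "\<dots> \<in> sets M"
      using C Rats_0 by (intro sets.Int sets.top sets.countable_INT' countable_rat image_subsetI sets.Un sets.Diff hit) auto
    finally show ?thesis .
  qed
  have "p \<in> borel_measurable M"
  proof (rule borel_measurableI)
    fix U :: "'y set" assume "open U"
    then obtain \<C> where \<C>: "countable \<C>" "U = \<Union>\<C>" "\<And>C. C \<in> \<C> \<Longrightarrow> \<exists>y r. C = cball y r"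
      using open_countable_Union_cballs by metis
    have "p -` U \<inter> space M = (\<Union>C\<in>\<C>. p -` C \<inter> space M)" using \<C> by auto
    also have "\<dots> \<in> sets M"
    proof (rule sets.countable_UN''[OF \<C>(1)])
      fix C assume "C \<in> \<C>"
      then obtain y r where "C = cball y r" using \<C>(3) by blast
      then show "p -` C \<inter> space M \<in> sets M" using key[of C] by auto
    qed
    finally show "p -` U \<inter> space M \<in> sets M" .
  qed
  then show ?thesis using that p(1) unfolding M_def by blast
qed

lemma admissible_controls_nonempty:
  assumes "hyp_W b W"
  shows "admissible_controls b W \<noteq> {}"
proof -
  from assms obtain \<phi> where W: "multi_measurable b W"
      "\<And>t. t \<in> {0..b} \<Longrightarrow> W t \<noteq> {} \<and> closed (W t) \<and> convex (W t)"
    and \<phi>: "\<phi> \<in> L2_space b" "AE t in lebesgue_on {0..b}. set_norm (W t) \<le> ereal (\<phi> t)"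
    unfolding hyp_W_def by blast
  obtain p where p: "p \<in> borel_measurable (lebesgue_on {0..b})" "\<And>t. t \<in> {0..b} \<Longrightarrow> p t \<in> W t"
    using measurable_min_norm_selection[OF W] by blast
  have "integrable (lebesgue_on {0..b}) (\<lambda>t. (norm (p t))\<^sup>2)"
  proof (rule Bochner_Integration.integrable_bound)
    show "integrable (lebesgue_on {0..b}) (\<lambda>t. (norm (\<phi> t))\<^sup>2)" using \<phi> by (simp add: L2_space_def)
    show "AE t in lebesgue_on {0..b}. norm ((norm (p t))\<^sup>2) \<le> norm ((norm (\<phi> t))\<^sup>2)"
      using \<phi>(2) AE_space
    proof eventually_elim
      case (elim t)
      then have "norm (p t) \<le> \<phi> t" using norm_le_set_norm p(2)[of t] by auto
      then have "(norm (p t))\<^sup>2 \<le> (\<phi> t)\<^sup>2" by (intro power_mono) auto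
      then show ?case by simp
    qed
  qed (use p(1) in measurable)
  then have "p \<in> admissible_controls b W"
    unfolding admissible_controls_def L2_space_def using p by (auto intro!: AE_I2)
  then show ?thesis by blast
qed

section \<open>Convergent convex combinations\<close>

text \<open>Weights of a convex combination of terms with indices from \<open>n\<close> to
  \<open>N\<close>. Zeros outside that range allow the summation bound to be enlarged freely, as
  needed for averaging two combinations.\<close>

definition tail_weights :: "nat \<Rightarrow> (nat \<Rightarrow> real) \<Rightarrow> nat \<Rightarrow> bool" where
  "tail_weights n c N \<longleftrightarrow> (\<forall>k. 0 \<le> c k) \<and> (\<forall>k<n. c k = 0) \<and> (\<forall>k>N. c k = 0) \<and> sum c {..N} = 1"

lemma tail_weights_sum_extend:
  fixes y :: "nat \<Rightarrow> 'a::real_vector"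
  assumes "tail_weights n c N" "N \<le> N'"
  shows "(\<Sum>k\<le>N'. c k *\<^sub>R y k) = (\<Sum>k\<le>N. c k *\<^sub>R y k)"
  using assms by (intro sum.mono_neutral_right) (auto simp: tail_weights_def)

text \<open>Supplies the midpoint for the parallelogram identity: the average of combinations of two
  tails is again a combination of the longer tail.\<close>

lemma tail_weights_average:
  assumes "tail_weights n c N" "tail_weights j c' N'" "n \<le> j"
  shows "tail_weights n (\<lambda>k. (c k + c' k) / 2) (max N N')"
proof -
  have "sum c {..max N N'} = sum c {..N}" "sum c' {..max N N'} = sum c' {..N'}"
    using tail_weights_sum_extend[OF assms(1), of "max N N'" "\<lambda>_. 1 :: real"]
      tail_weights_sum_extend[OF assms(2), of "max N N'" "\<lambda>_. 1 :: real"] by simp_all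
  then have "(\<Sum>k\<le>max N N'. (c k + c' k) / 2) = 1"
    using assms by (simp add: tail_weights_def sum.distrib add_divide_distrib flip: sum_divide_distrib)
  then show ?thesis
    using assms by (auto simp: tail_weights_def)
qed

lemma tail_weights_norm_le:
  fixes y :: "nat \<Rightarrow> 'a::real_normed_vector"
  assumes "tail_weights n c N" "\<And>k. n \<le> k \<Longrightarrow> norm (y k) \<le> e"
  shows "norm (\<Sum>k\<le>N. c k *\<^sub>R y k) \<le> e"
proof -
  have "norm (\<Sum>k\<le>N. c k *\<^sub>R y k) \<le> (\<Sum>k\<le>N. c k * e)"
  proof (rule sum_norm_le)
    fix k
    show "norm (c k *\<^sub>R y k) \<le> c k * e"
      using assms by (cases "k < n") (auto simp: tail_weights_def intro!: mult_left_mono)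
  qed
  also have "\<dots> = e" using assms(1) by (simp add: tail_weights_def flip: sum_distrib_right)
  finally show ?thesis .
qed

text \<open>The reason for weights on tails: late combinations see only terms that are already close
  to the limit, so averaging preserves every limit known beforehand.\<close>

lemma tail_weights_tendsto:
  fixes y :: "nat \<Rightarrow> 'a::real_normed_vector"
  assumes c: "\<And>n. tail_weights n (c n) (N n)" and y: "y \<longlonglongrightarrow> l"
  shows "(\<lambda>n. \<Sum>k\<le>N n. c n k *\<^sub>R y k) \<longlonglongrightarrow> l"
proof (rule LIMSEQ_I)
  fix e :: real assume "0 < e"
  then obtain n0 where n0: "\<And>k. n0 \<le> k \<Longrightarrow> norm (y k - l) < e / 2"
    using LIMSEQ_D[OF y, of "e / 2"] by auto
  have "norm ((\<Sum>k\<le>N n. c n k *\<^sub>R y k) - l) < e" if "n0 \<le> n" for n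
  proof -
    have "(\<Sum>k\<le>N n. c n k *\<^sub>R y k) - l = (\<Sum>k\<le>N n. c n k *\<^sub>R (y k - l))"
      using c[of n] by (simp add: tail_weights_def scaleR_diff_right sum_subtractf flip: scaleR_left.sum)
    also have "norm \<dots> \<le> e / 2"
      using n0 that by (intro tail_weights_norm_le[OF c[of n]]) (meson less_imp_le order_trans)
    finally show ?thesis using \<open>0 < e\<close> by simp
  qed
  then show "\<exists>no. \<forall>n\<ge>no. norm ((\<Sum>k\<le>N n. c n k *\<^sub>R y k) - l) < e" by blast
qed

text \<open>
  Convex combinations of the tails whose norms are nearly minimal form a Cauchy sequence by the
  parallelogram identity; no weak compactness is involved.
\<close>

lemma AE_convergent_convex_combinations:
  fixes z :: "nat \<Rightarrow> 'a \<Rightarrow> 'b::{real_inner, banach, second_countable_topology}"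
  assumes "finite_measure M"
    and z [measurable]: "\<And>k. z k \<in> borel_measurable M"
    and \<psi>: "\<And>k. AE x in M. norm (z k x) \<le> \<psi> x" "integrable M (\<lambda>x. (\<psi> x)\<^sup>2)"
  obtains c N zl where "\<And>n. tail_weights n (c n) (N n)" "zl \<in> borel_measurable M"
    "AE x in M. (\<lambda>n. \<Sum>k\<le>N n. c n k *\<^sub>R z k x) \<longlonglongrightarrow> zl x"
proof -
  interpret finite_measure M by fact
  define Z where "Z c N x = (\<Sum>k\<le>N. c k *\<^sub>R z k x)" for c N x
  have Zm [measurable]: "Z c N \<in> borel_measurable M" for c N unfolding Z_def[abs_def] by measurable
  have Zle: "AE x in M. norm (Z c N x) \<le> \<psi> x" if "tail_weights n c N" for n c N
  proof -
    have "AE x in M. \<forall>k. norm (z k x) \<le> \<psi> x" using \<psi>(1) by (simp add: AE_all_countable)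
    then show ?thesis
    proof eventually_elim
      case (elim x)
      then show ?case unfolding Z_def by (intro tail_weights_norm_le[OF that]) blast
    qed
  qed
  have Zle2: "AE x in M. (norm (Z c N x))\<^sup>2 \<le> (\<psi> x)\<^sup>2" if "tail_weights n c N" for n c N
    using Zle[OF that] by eventually_elim (auto intro: power_mono)
  have Zint: "integrable M (\<lambda>x. (norm (Z c N x))\<^sup>2)" if "tail_weights n c N" for n c N
    by (rule Bochner_Integration.integrable_bound[OF \<psi>(2)]) (use Zle2[OF that] in auto)
  define Q where "Q c N = (\<integral>x. (norm (Z c N x))\<^sup>2 \<partial>M)" for c N
  define K where "K = (\<integral>x. (\<psi> x)\<^sup>2 \<partial>M)"
  have Q0: "0 \<le> Q c N" for c N unfolding Q_def by simp
  have QK: "Q c N \<le> K" if "tail_weights n c N" for n c N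
    unfolding Q_def K_def by (rule integral_mono_AE[OF Zint[OF that] \<psi>(2) Zle2[OF that]])
  \<comment> \<open>The families shrink with \<open>n\<close>, so their infima \<open>m n\<close>
    increase, and they are bounded by \<open>K\<close>. Hence they converge to some
    \<open>L\<close>, and near-minimizers of different late tails have nearly equal norms.\<close>
  define S where "S n = {Q c N | c N. tail_weights n c N}" for n
  define m where "m n = Inf (S n)" for n
  have bdd: "bdd_below (S n)" for n
    by (rule bdd_belowI[of _ 0]) (auto simp: S_def Q0)
  have delta: "tail_weights n (\<lambda>k. if k = n then 1 else 0) n" for n
    by (auto simp: tail_weights_def)
  have Sne: "S n \<noteq> {}" for n using delta[of n] by (auto simp: S_def)
  have mQ: "m n \<le> Q c N" if "tail_weights n c N" for n c N
    unfolding m_def by (rule cInf_lower[OF _ bdd]) (use that in \<open>auto simp: S_def\<close>)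
  have "mono m"
  proof (rule monoI)
    fix n n' :: nat assume "n \<le> n'"
    then have "tail_weights n c N" if "tail_weights n' c N" for c N using that by (auto simp: tail_weights_def)
    then have "S n' \<subseteq> S n" unfolding S_def by blast
    then show "m n \<le> m n'" unfolding m_def by (intro cInf_superset_mono Sne bdd)
  qed
  moreover have mK: "m n \<le> K" for n using mQ[OF delta] QK[OF delta] by (rule order_trans)
  ultimately obtain L where L: "m \<longlonglongrightarrow> L" "\<And>n. m n \<le> L"
    using incseq_convergent[of m K] by blast
  have "\<exists>c N. tail_weights n c N \<and> Q c N < m n + 1 / real (Suc n)" for n
  proof -
    have "Inf (S n) < m n + 1 / real (Suc n)" unfolding m_def by simp
    then show ?thesis using cInf_lessD[OF Sne] unfolding S_def by fastforce
  qed
  then obtain c N where c: "\<And>n. tail_weights n (c n) (N n)" "\<And>n. Q (c n) (N n) < m n + 1 / real (Suc n)"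
    by metis
  \<comment> \<open>The parallelogram identity gives at most
    \<open>2 * (m n + 1 / Suc n) + 2 * (L + 1 / Suc n) - 4 * m n\<close>: the midpoint belongs to
    tail \<open>n\<close>, and \<open>m j \<le> L\<close>.\<close>
  define E where "E n = 2 * (L - m n) + 4 / real (Suc n)" for n
  have dist: "integrable M (\<lambda>x. (norm (Z (c n) (N n) x - Z (c j) (N j) x))\<^sup>2)"
    "(\<integral>x. (norm (Z (c n) (N n) x - Z (c j) (N j) x))\<^sup>2 \<partial>M) \<le> E n" if "n \<le> j" for n j
  proof -
    define c' N' where "c' = (\<lambda>k. (c n k + c j k) / 2)" and "N' = max (N n) (N j)"
    have t: "tail_weights n c' N'" unfolding c'_def N'_def by (rule tail_weights_average[OF c(1) c(1) that])
    have "Z c' N' x = (1/2) *\<^sub>R (Z (c n) N' x + Z (c j) N' x)" for x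
      by (simp add: Z_def c'_def scaleR_add_left sum.distrib scaleR_sum_right add_divide_distrib scaleR_add_right)
    moreover have "Z (c n) N' x = Z (c n) (N n) x" "Z (c j) N' x = Z (c j) (N j) x" for x
      unfolding Z_def N'_def by (rule tail_weights_sum_extend[OF c(1)]; simp)+
    ultimately have Z': "Z c' N' x = (1/2) *\<^sub>R (Z (c n) (N n) x + Z (c j) (N j) x)" for x by simp
    have eq: "(norm (Z (c n) (N n) x - Z (c j) (N j) x))\<^sup>2 =
        2 * (norm (Z (c n) (N n) x))\<^sup>2 + 2 * (norm (Z (c j) (N j) x))\<^sup>2 - 4 * (norm (Z c' N' x))\<^sup>2" for x
      unfolding Z' power2_norm_eq_inner by (simp add: inner_simps inner_commute field_simps)
    show "integrable M (\<lambda>x. (norm (Z (c n) (N n) x - Z (c j) (N j) x))\<^sup>2)"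
      unfolding eq using Zint[OF c(1)] Zint[OF t] by simp
    have "(\<integral>x. (norm (Z (c n) (N n) x - Z (c j) (N j) x))\<^sup>2 \<partial>M) = 2 * Q (c n) (N n) + 2 * Q (c j) (N j) - 4 * Q c' N'"
      unfolding eq Q_def using Zint[OF c(1)] Zint[OF t] by simp
    also have "\<dots> \<le> E n"
    proof -
      have "1 / real (Suc j) \<le> 1 / real (Suc n)" using that by (simp add: frac_le)
      then show ?thesis using c(2)[of n] c(2)[of j] mQ[OF t] L(2)[of j] unfolding E_def by simp
    qed
    finally show "(\<integral>x. (norm (Z (c n) (N n) x - Z (c j) (N j) x))\<^sup>2 \<partial>M) \<le> E n" .
  qed
  have "(\<lambda>n. 2 * (L - m n) + 4 * (1 / real (Suc n))) \<longlonglongrightarrow> 2 * (L - L) + 4 * 0"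
    using L(1) by (intro tendsto_intros LIMSEQ_Suc[OF lim_1_over_n])
  then have "E \<longlonglongrightarrow> 0" by (simp add: E_def[abs_def])
  then have "\<exists>s. \<forall>n\<ge>s. E n < (1/4) ^ i" for i
    using order_tendstoD(2)[of E 0 sequentially "(1/4) ^ i"] by (simp add: eventually_sequentially)
  then obtain s where s: "\<And>i n. s i \<le> n \<Longrightarrow> E n < (1/4) ^ i" by metis
  \<comment> \<open>Adding all earlier thresholds and \<open>i\<close> makes the index at once
    monotone, beyond \<open>s i\<close> and at least \<open>i\<close>; the last property keeps the
    reindexed weights on tails.\<close>
  define r where "r i = sum s {..i} + i" for i
  have r: "s i \<le> r i" "i \<le> r i" "r i \<le> r (Suc i)" for i
  proof -
    have "s i \<le> sum s {..i}" by (rule member_le_sum) auto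
    then show "s i \<le> r i" by (simp add: r_def)
  qed (auto simp: r_def)
  define y where "y i x = Z (c (r i)) (N (r i)) x" for i x
  define d where "d i x = y (Suc i) x - y i x" for i x
  have ym [measurable]: "y i \<in> borel_measurable M" for i unfolding y_def[abs_def] by measurable
  have dm [measurable]: "d i \<in> borel_measurable M" for i unfolding d_def[abs_def] by measurable
  have dn: "(norm (d i x))\<^sup>2 = (norm (Z (c (r i)) (N (r i)) x - Z (c (r (Suc i))) (N (r (Suc i))) x))\<^sup>2" for i x
    by (simp add: d_def y_def norm_minus_commute)
  \<comment> \<open>The decay by powers of 1/4 leaves room for the factor \<open>2 ^ i\<close>: the
    weighted squares still have a finite total integral, so the weighted series converges almost
    everywhere.\<close>
  have d2: "integrable M (\<lambda>x. (norm (d i x))\<^sup>2)" "(\<integral>x. (norm (d i x))\<^sup>2 \<partial>M) \<le> (1/4) ^ i" for i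
    unfolding dn using dist[OF r(3)[of i]] s[OF r(1)[of i]] by auto
  have "(\<integral>\<^sup>+x. (\<Sum>i. ennreal (2 ^ i * (norm (d i x))\<^sup>2)) \<partial>M) = (\<Sum>i. \<integral>\<^sup>+x. ennreal (2 ^ i * (norm (d i x))\<^sup>2) \<partial>M)"
    by (rule nn_integral_suminf) measurable
  also have "\<dots> \<le> (\<Sum>i. ennreal ((1/2) ^ i))"
  proof (intro suminf_le summableI)
    fix i
    have "(\<integral>\<^sup>+x. ennreal (2 ^ i * (norm (d i x))\<^sup>2) \<partial>M) = ennreal (\<integral>x. 2 ^ i * (norm (d i x))\<^sup>2 \<partial>M)"
      using d2(1) by (intro nn_integral_eq_integral) auto
    also have "\<dots> \<le> ennreal ((1/2) ^ i)"
    proof (rule ennreal_leI)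
      have "(\<integral>x. 2 ^ i * (norm (d i x))\<^sup>2 \<partial>M) = 2 ^ i * (\<integral>x. (norm (d i x))\<^sup>2 \<partial>M)" by simp
      also have "\<dots> \<le> 2 ^ i * (1/4) ^ i" using d2(2)[of i] by (intro mult_left_mono) auto
      also have "\<dots> = (1/2) ^ i" by (simp flip: power_mult_distrib)
      finally show "(\<integral>x. 2 ^ i * (norm (d i x))\<^sup>2 \<partial>M) \<le> (1/2) ^ i" .
    qed
    finally show "(\<integral>\<^sup>+x. ennreal (2 ^ i * (norm (d i x))\<^sup>2) \<partial>M) \<le> ennreal ((1/2) ^ i)" .
  qed
  also have "\<dots> < \<infinity>"
    by (subst suminf_ennreal2) (auto simp: summable_geometric)
  finally have "AE x in M. (\<Sum>i. ennreal (2 ^ i * (norm (d i x))\<^sup>2)) \<noteq> \<infinity>"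
    by (intro nn_integral_PInf_AE) auto
  then have conv: "AE x in M. convergent (\<lambda>n. y n x)"
  proof eventually_elim
    case (elim x)
    then have "summable (\<lambda>i. 2 ^ i * (norm (d i x))\<^sup>2)" by (intro summable_suminf_not_top) auto
    then have "summable (\<lambda>i. (1/2) ^ i + 2 ^ i * (norm (d i x))\<^sup>2)"
      by (intro summable_add summable_geometric) auto
    \<comment> \<open>The arithmetic-geometric mean inequality with weight \<open>2 ^ i\<close>
      trades the summable weighted squares for absolute summability of the increments.\<close>
    moreover have "norm (norm (d i x)) \<le> (1/2) ^ i + 2 ^ i * (norm (d i x))\<^sup>2" for i
    proof -
      define p :: real where "p = 2 ^ i"
      have p: "p > 0" "(1/2) ^ i = 1 / p" by (auto simp: p_def power_divide)
      have "0 \<le> (1 - p * norm (d i x))\<^sup>2" by simp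
      then have "p * norm (d i x) * 2 \<le> 1 + p * (p * (norm (d i x))\<^sup>2)" by (simp add: power2_eq_square algebra_simps)
      moreover have "0 \<le> p * norm (d i x)" using p by simp
      ultimately have "p * norm (d i x) \<le> 1 + p * (p * (norm (d i x))\<^sup>2)" by linarith
      also have "\<dots> = p * (1 / p + p * (norm (d i x))\<^sup>2)" using p by (simp add: field_simps)
      finally have "norm (d i x) \<le> 1 / p + p * (norm (d i x))\<^sup>2" using p(1) by simp
      then show ?thesis unfolding p(2) by (simp add: p_def)
    qed
    ultimately have "summable (\<lambda>i. norm (d i x))" 
      using summable_comparison_test'[of "\<lambda>i. (1/2) ^ i + 2 ^ i * (norm (d i x))\<^sup>2" 0 "\<lambda>i. norm (d i x)"] by simp
    then have "summable (\<lambda>i. d i x)" by (rule summable_norm_cancel)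
    then have "convergent (\<lambda>n. \<Sum>i<n. d i x)" by (simp add: summable_iff_convergent)
    moreover have "(\<Sum>i<n. d i x) = y n x - y 0 x" for n
      unfolding d_def by (rule sum_lessThan_telescope)
    ultimately have "convergent (\<lambda>n. (y n x - y 0 x) + y 0 x)" by (intro convergent_add convergent_const) simp
    then show ?case by simp
  qed
  define zl where "zl x = lim (\<lambda>n. y n x)" for x
  show ?thesis
  proof (rule that[of "\<lambda>i. c (r i)" "\<lambda>i. N (r i)" zl])
    show "tail_weights n (c (r n)) (N (r n))" for n
      using c(1)[of "r n"] r(2)[of n] by (auto simp: tail_weights_def)
    show "zl \<in> borel_measurable M" unfolding zl_def[abs_def] by (rule borel_measurable_lim_metric) measurable
    show "AE x in M. (\<lambda>n. \<Sum>k\<le>N (r n). c (r n) k *\<^sub>R z k x) \<longlonglongrightarrow> zl x"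
      using conv by eventually_elim (simp add: convergent_LIMSEQ_iff zl_def y_def Z_def)
  qed
qed

section \<open>Bochner integrals over intervals\<close>

lemma integrable_lebesgue_on_subset:
  fixes f :: "'a::euclidean_space \<Rightarrow> 'b::{banach, second_countable_topology}"
  assumes "integrable (lebesgue_on S) f" "A \<subseteq> S" "A \<in> sets lebesgue" "S \<in> sets lebesgue"
  shows "integrable (lebesgue_on A) f"
proof -
  have "integrable lebesgue (\<lambda>x. indicator S x *\<^sub>R f x)"
    using assms by (simp add: integrable_restrict_space)
  from integrable_mult_indicator[OF assms(3) this]
  have "integrable lebesgue (\<lambda>x. indicator A x *\<^sub>R indicator S x *\<^sub>R f x)" .
  also have "(\<lambda>x. indicator A x *\<^sub>R indicator S x *\<^sub>R f x) = (\<lambda>x. indicator A x *\<^sub>R f x)"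
    using assms(2) by (auto simp: indicator_def fun_eq_iff)
  finally show ?thesis using assms by (simp add: integrable_restrict_space)
qed

lemma AE_lebesgue_on_subset:
  assumes "AE x in lebesgue_on S. P x" "A \<subseteq> S" "A \<in> sets lebesgue" "S \<in> sets lebesgue"
  shows "AE x in lebesgue_on A. P x"
  using assms by (auto simp: AE_restrict_space_iff)

lemma AE_lebesgue_on_neq:
  assumes "S \<in> sets lebesgue"
  shows "AE x in lebesgue_on S. x \<noteq> (c::real)"
proof -
  have "AE x in lebesgue. x \<noteq> c"
    using AE_completion[OF AE_lborel_singleton[of c]] by simp
  then show ?thesis using assms by (auto simp: AE_restrict_space_iff)
qed

lemma integral_lebesgue_on_split:
  fixes f :: "real \<Rightarrow> 'b::{banach, second_countable_topology}"
  assumes f: "integrable (lebesgue_on {a..c}) f" and s: "a \<le> s" "s \<le> c"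
  shows "(\<integral>x. f x \<partial>lebesgue_on {a..c}) = (\<integral>x. f x \<partial>lebesgue_on {a..s}) + (\<integral>x. f x \<partial>lebesgue_on {s..c})"
proof -
  have i: "integrable (lebesgue_on {a..s}) f" "integrable (lebesgue_on {s..c}) f"
    using integrable_lebesgue_on_subset[OF f] s by auto
  have ae: "AE x in lebesgue. indicator {a..c} x *\<^sub>R f x = indicator {a..s} x *\<^sub>R f x + indicator {s..c} x *\<^sub>R f x"
  proof -
    have "AE x in lebesgue. x \<noteq> s"
      using AE_completion[OF AE_lborel_singleton[of s]] by simp
    then show ?thesis by eventually_elim (use s in \<open>auto simp: indicator_def\<close>)
  qed
  have "(\<integral>x. f x \<partial>lebesgue_on {a..c}) = (\<integral>x. indicator {a..c} x *\<^sub>R f x \<partial>lebesgue)"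
    by (simp add: integral_restrict_space)
  also have "\<dots> = (\<integral>x. indicator {a..s} x *\<^sub>R f x + indicator {s..c} x *\<^sub>R f x \<partial>lebesgue)"
    using f i ae by (intro integral_cong_AE) (auto simp: integrable_restrict_space)
  also have "\<dots> = (\<integral>x. indicator {a..s} x *\<^sub>R f x \<partial>lebesgue) + (\<integral>x. indicator {s..c} x *\<^sub>R f x \<partial>lebesgue)"
    using i by (intro Bochner_Integration.integral_add) (auto simp: integrable_restrict_space)
  finally show ?thesis by (simp add: integral_restrict_space)
qed

lemma integral_norm_le_AE:
  fixes f :: "'a \<Rightarrow> 'b::{banach, second_countable_topology}"
  assumes "integrable M f" "integrable M g" "AE x in M. norm (f x) \<le> g x"
  shows "norm (\<integral>x. f x \<partial>M) \<le> (\<integral>x. g x \<partial>M)"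
proof -
  have "norm (\<integral>x. f x \<partial>M) \<le> (\<integral>x. norm (f x) \<partial>M)" by (rule integral_norm_bound)
  also have "\<dots> \<le> (\<integral>x. g x \<partial>M)" using assms by (intro integral_mono_AE) auto
  finally show ?thesis .
qed

lemma integral_lebesgue_on_subset_mono:
  fixes g :: "real \<Rightarrow> real"
  assumes "integrable (lebesgue_on S) g" "A \<subseteq> S" "A \<in> sets lebesgue" "S \<in> sets lebesgue"
    "AE x in lebesgue_on S. 0 \<le> g x"
  shows "(\<integral>x. g x \<partial>lebesgue_on A) \<le> (\<integral>x. g x \<partial>lebesgue_on S)"
proof -
  have "integrable (lebesgue_on A) g" by (rule integrable_lebesgue_on_subset[OF assms(1-4)])
  then have "(\<integral>x. indicator A x *\<^sub>R g x \<partial>lebesgue) \<le> (\<integral>x. indicator S x *\<^sub>R g x \<partial>lebesgue)"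
    using assms by (intro integral_mono_AE) (auto simp: integrable_restrict_space AE_restrict_space_iff indicator_def)
  then show ?thesis using assms by (simp add: integral_restrict_space)
qed

lemma finite_measure_lebesgue_on_Icc: "finite_measure (lebesgue_on {a..b::real})"
  by (rule finite_measure_lebesgue_on) auto

lemma integrable_square_imp_integrable:
  fixes f :: "real \<Rightarrow> 'b::{banach, second_countable_topology}"
  assumes [measurable]: "f \<in> borel_measurable (lebesgue_on {a..b})"
    and "integrable (lebesgue_on {a..b}) (\<lambda>t. (norm (f t))\<^sup>2)"
  shows "integrable (lebesgue_on {a..b}) f"
proof (rule Bochner_Integration.integrable_bound)
  interpret finite_measure "lebesgue_on {a..b}" by (rule finite_measure_lebesgue_on_Icc)
  show "integrable (lebesgue_on {a..b}) (\<lambda>t. 1 + (norm (f t))\<^sup>2)" using assms(2) by simp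
  have "norm (f t) \<le> 1 + (norm (f t))\<^sup>2" for t
  proof -
    have "0 \<le> (1 - norm (f t))\<^sup>2" by simp
    then have "2 * norm (f t) \<le> 1 + (norm (f t))\<^sup>2" by (simp add: power2_diff)
    then show ?thesis using norm_ge_zero[of "f t"] by linarith
  qed
  then show "AE t in lebesgue_on {a..b}. norm (f t) \<le> norm (1 + (norm (f t))\<^sup>2)" by auto
qed simp

lemma continuous_on_integral_to_variable_bound:
  fixes \<Phi> :: "real \<Rightarrow> real \<Rightarrow> 'a::{banach, second_countable_topology}"
  assumes m: "\<And>t. t \<le> b \<Longrightarrow> \<Phi> t \<in> borel_measurable (lebesgue_on {0..b})"
    and w: "integrable (lebesgue_on {0..b}) w"
      "\<And>t. t \<le> b \<Longrightarrow> AE s in lebesgue_on {0..b}. norm (\<Phi> t s) \<le> w s"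
    and c: "\<And>s. s \<in> {0..b} \<Longrightarrow> continuous_on {s..b} (\<lambda>t. \<Phi> t s)"
  shows "continuous_on {..b} (\<lambda>t. \<integral>s. \<Phi> t s \<partial>lebesgue_on {0..t})"
  unfolding continuous_on_sequentially
proof (intro allI ballI impI, elim conjE)
  fix t :: "nat \<Rightarrow> real" and a assume a: "a \<in> {..b}" and t: "\<forall>n. t n \<in> {..b}" "t \<longlonglongrightarrow> a"
  define M where "M = lebesgue_on {0..b}"
  have eq: "(\<integral>s. \<Phi> t s \<partial>lebesgue_on {0..t}) = (\<integral>s. indicator {..t} s *\<^sub>R \<Phi> t s \<partial>M)" if "t \<le> b" for t
  proof -
    have "(\<integral>s. indicator {..t} s *\<^sub>R \<Phi> t s \<partial>M) = (\<integral>s. indicator {0..b} s *\<^sub>R indicator {..t} s *\<^sub>R \<Phi> t s \<partial>lebesgue)"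
      by (simp add: M_def integral_restrict_space)
    also have "\<dots> = (\<integral>s. indicator {0..t} s *\<^sub>R \<Phi> t s \<partial>lebesgue)"
      using that by (intro Bochner_Integration.integral_cong) (auto simp: indicator_def)
    finally show ?thesis by (simp add: integral_restrict_space)
  qed
  have im [measurable]: "(\<lambda>s. indicator {..u} s :: real) \<in> borel_measurable M" for u
    unfolding M_def by (intro measurable_restrict_space1 borel_measurable_indicator) auto
  have mm: "(\<lambda>s. indicator {..u} s *\<^sub>R \<Phi> u s) \<in> borel_measurable M" if "u \<le> b" for u
    using m[OF that] by (intro borel_measurable_scaleR im) (simp add: M_def)
  have "(\<lambda>n. \<integral>s. indicator {..t n} s *\<^sub>R \<Phi> (t n) s \<partial>M) \<longlonglongrightarrow> (\<integral>s. indicator {..a} s *\<^sub>R \<Phi> a s \<partial>M)"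
  proof (rule integral_dominated_convergence[where w = w])
    show "AE s in M. norm (indicator {..t n} s *\<^sub>R \<Phi> (t n) s) \<le> w s" for n
    proof -
      have "AE s in M. norm (\<Phi> (t n) s) \<le> w s" using w(2)[of "t n", folded M_def] t(1) by simp
      then show ?thesis
      proof eventually_elim
        case (elim s)
        then show ?case using norm_ge_zero[of "\<Phi> (t n) s"] by (auto simp: indicator_def simp del: norm_ge_zero)
      qed
    qed
    have "AE s in M. s \<noteq> a" "AE s in M. s \<in> {0..b}"
      unfolding M_def using AE_lebesgue_on_neq AE_space[of "lebesgue_on {0..b}"] by auto
    then show "AE s in M. (\<lambda>n. indicator {..t n} s *\<^sub>R \<Phi> (t n) s) \<longlonglongrightarrow> indicator {..a} s *\<^sub>R \<Phi> a s"
    proof eventually_elim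
      case (elim s)
      show ?case
      proof (cases "s < a")
        case True
        have ev: "\<forall>\<^sub>F n in sequentially. s < t n" using order_tendstoD(1)[OF t(2) True] .
        have "((\<lambda>t. \<Phi> t s) \<longlongrightarrow> \<Phi> a s) (at a within {s..b})"
          using c[OF elim(2)] True a by (auto simp: continuous_on_def)
        moreover have "\<forall>\<^sub>F n in sequentially. t n \<in> {s..b}"
          using ev by eventually_elim (use t(1) in auto)
        ultimately have "(\<lambda>n. \<Phi> (t n) s) \<longlonglongrightarrow> \<Phi> a s"
          using c[OF elim(2)] True a t(2) by (intro continuous_on_tendsto_compose[where s = "{s..b}" and f = "\<lambda>t. \<Phi> t s"]) auto
        moreover have "\<forall>\<^sub>F n in sequentially. \<Phi> (t n) s = indicator {..t n} s *\<^sub>R \<Phi> (t n) s"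
          using ev by eventually_elim (auto simp: indicator_def)
        ultimately show ?thesis using True by (simp add: Lim_transform_eventually indicator_def)
      next
        case False
        with elim have "a < s" by simp
        then have "\<forall>\<^sub>F n in sequentially. t n < s" using order_tendstoD(2)[OF t(2)] by blast
        then have "\<forall>\<^sub>F n in sequentially. 0 = indicator {..t n} s *\<^sub>R \<Phi> (t n) s"
          by eventually_elim (auto simp: indicator_def)
        then show ?thesis using \<open>a < s\<close> by (auto simp: indicator_def intro: Lim_transform_eventually[OF tendsto_const])
      qed
    qed
    show "integrable M w" using w by (simp add: M_def)
  qed (use mm a t(1) in auto)
  then show "((\<lambda>t. \<integral>s. \<Phi> t s \<partial>lebesgue_on {0..t}) \<circ> t) \<longlonglongrightarrow> (\<integral>s. \<Phi> a s \<partial>lebesgue_on {0..a})"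
    using a t(1) eq by (simp add: o_def)
qed

section \<open>Almost everywhere differentiation\<close>

lemma continuous_on_indefinite_integral:
  fixes f :: "real \<Rightarrow> 'a::{banach, second_countable_topology}"
  assumes "integrable (lebesgue_on {0..b}) f"
  shows "continuous_on {..b} (\<lambda>t. \<integral>s. f s \<partial>lebesgue_on {0..t})"
  by (rule continuous_on_integral_to_variable_bound[where w = "\<lambda>s. norm (f s)"]) (use assms in auto)

lemma integrable_continuous_Icc:
  fixes f :: "real \<Rightarrow> 'a::{banach, second_countable_topology}"
  assumes "continuous_on {a..b} f"
  shows "integrable (lebesgue_on {a..b}) f"
proof -
  interpret finite_measure "lebesgue_on {a..b}" by (rule finite_measure_lebesgue_on_Icc)
  have "compact (f ` {a..b})" using assms by (intro compact_continuous_image) auto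
  then obtain B where "\<And>x. x \<in> {a..b} \<Longrightarrow> norm (f x) \<le> B"
    by (meson bounded_iff compact_imp_bounded imageI)
  then show ?thesis
    by (intro integrable_const_bound[of _ B] AE_I2 continuous_imp_measurable_on_sets_lebesgue[OF assms]) auto
qed

text \<open>The difference quotient of the indefinite integral with step \<open>1 / Suc n\<close>.
  Looking backward never needs values beyond \<open>b\<close>; left of 0 the integral is over the
  empty set, which amounts to extending \<open>f\<close> by zero.\<close>

definition backward_quotient :: "(real \<Rightarrow> 'a::{banach, second_countable_topology}) \<Rightarrow> nat \<Rightarrow> real \<Rightarrow> 'a" where
  "backward_quotient f n t = real (Suc n) *\<^sub>R
     ((\<integral>s. f s \<partial>lebesgue_on {0..t}) - (\<integral>s. f s \<partial>lebesgue_on {0..t - 1 / real (Suc n)}))"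

lemma integrable_backward_quotient:
  fixes f :: "real \<Rightarrow> 'a::{banach, second_countable_topology}"
  assumes "integrable (lebesgue_on {0..b}) f"
  shows "integrable (lebesgue_on {0..b}) (backward_quotient f n)"
proof -
  note U = continuous_on_indefinite_integral[OF assms]
  have "t - 1 / real (Suc n) \<le> b" if "t \<le> b" for t
    using that by (rule order_trans[rotated]) simp
  then have "continuous_on {0..b} (\<lambda>t. \<integral>s. f s \<partial>lebesgue_on {0..t - 1 / real (Suc n)})"
    by (intro continuous_on_compose2[OF U, of _ "\<lambda>t. t - 1 / real (Suc n)"] continuous_intros) auto
  moreover have "continuous_on {0..b} (\<lambda>t. \<integral>s. f s \<partial>lebesgue_on {0..t})"
    by (rule continuous_on_subset[OF U]) auto
  ultimately have "continuous_on {0..b} (backward_quotient f n)"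
    unfolding backward_quotient_def[abs_def] by (intro continuous_on_scaleR continuous_on_diff continuous_on_const)
  then show ?thesis by (rule integrable_continuous_Icc)
qed

text \<open>The quotient is dominated by that of \<open>\<phi>\<close>, the indefinite integral of
  the norm. Integrating \<open>\<phi> t - \<phi> (t - h)\<close> and shifting leaves only two strips
  of width \<open>h\<close>: the left one is nonnegative and is dropped, the right one is at most
  \<open>h * \<phi> b\<close>.\<close>

lemma backward_quotient_L1_contraction:
  fixes f :: "real \<Rightarrow> 'a::{banach, second_countable_topology}"
  assumes f: "integrable (lebesgue_on {0..b}) f" and b: "0 < b"
  shows "(\<integral>t. norm (backward_quotient f n t) \<partial>lebesgue_on {0..b}) \<le> (\<integral>t. norm (f t) \<partial>lebesgue_on {0..b})"
proof -
  define h where "h = 1 / real (Suc n)"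
  have h: "h > 0" "real (Suc n) * h = 1" by (auto simp: h_def)
  define \<phi> where "\<phi> t = (\<integral>s. norm (f s) \<partial>lebesgue_on {0..t})" for t
  have fn: "integrable (lebesgue_on {0..b}) (\<lambda>t. norm (f t))" using f by simp
  have cont: "continuous_on {..b} \<phi>"
    unfolding \<phi>_def[abs_def] by (rule continuous_on_indefinite_integral) (use f in simp)
  have \<phi>0: "0 \<le> \<phi> t" for t unfolding \<phi>_def by simp
  have \<phi>b: "\<phi> t \<le> \<phi> b" if "t \<le> b" for t
    unfolding \<phi>_def using that by (intro integral_lebesgue_on_subset_mono[OF fn]) auto
  have hk: "\<phi> integrable_on {c..d}" if "d \<le> b" for c d
    using cont that by (intro integrable_continuous_real continuous_on_subset[OF cont]) auto
  have pt: "norm (backward_quotient f n t) \<le> real (Suc n) * (\<phi> t - \<phi> (t - h))" if "t \<in> {0..b}" for t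
  proof -
    have "norm ((\<integral>s. f s \<partial>lebesgue_on {0..t}) - (\<integral>s. f s \<partial>lebesgue_on {0..t - h})) \<le> \<phi> t - \<phi> (t - h)"
    proof (cases "0 \<le> t - h")
      case True
      have i: "integrable (lebesgue_on {0..t}) f" using that by (intro integrable_lebesgue_on_subset[OF f]) auto
      have "(\<integral>s. f s \<partial>lebesgue_on {0..t}) - (\<integral>s. f s \<partial>lebesgue_on {0..t - h}) = (\<integral>s. f s \<partial>lebesgue_on {t - h..t})"
        using integral_lebesgue_on_split[OF i True] h by simp
      moreover have "\<phi> t - \<phi> (t - h) = (\<integral>s. norm (f s) \<partial>lebesgue_on {t - h..t})"
        unfolding \<phi>_def using integral_lebesgue_on_split[OF integrable_norm[OF i] True] h by simp
      ultimately show ?thesis by (simp add: integral_norm_bound)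
    qed (simp add: \<phi>_def integral_norm_bound)
    then show ?thesis unfolding backward_quotient_def h_def[symmetric] by (simp add: mult_left_mono)
  qed
  have c2: "continuous_on {0..b} (\<lambda>t. real (Suc n) * (\<phi> t - \<phi> (t - h)))"
    using h by (intro continuous_intros continuous_on_compose2[OF cont, where f = "\<lambda>t. t - h"] continuous_on_subset[OF cont]) auto
  have "(\<integral>t. norm (backward_quotient f n t) \<partial>lebesgue_on {0..b}) \<le> (\<integral>t. real (Suc n) * (\<phi> t - \<phi> (t - h)) \<partial>lebesgue_on {0..b})"
    using pt integrable_backward_quotient[OF f, of n] integrable_continuous_Icc[OF c2]
    by (intro integral_mono) auto
  also have "\<dots> = integral {0..b} (\<lambda>t. real (Suc n) * (\<phi> t - \<phi> (t - h)))"
    by (rule lebesgue_integral_eq_integral[OF integrable_continuous_Icc[OF c2]]) auto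
  also have "\<dots> = real (Suc n) * (integral {0..b} \<phi> - integral {0..b} (\<lambda>t. \<phi> (t - h)))"
  proof -
    have "(\<lambda>t. \<phi> (t - h)) integrable_on {0..b}"
      using h by (intro integrable_continuous_real continuous_intros continuous_on_compose2[OF cont, where f = "\<lambda>t. t - h"]) auto
    then show ?thesis using hk[of b 0] by (simp add: Henstock_Kurzweil_Integration.integral_diff)
  qed
  also have "integral {0..b} (\<lambda>t. \<phi> (t - h)) = integral {- h..b - h} \<phi>"
    using integral_shift_Icc_real[of 0 b \<phi> "- h"] by (simp add: o_def)
  also have "integral {0..b} \<phi> - integral {- h..b - h} \<phi> \<le> h * \<phi> b"
  proof -
    have "integral {- h..b} \<phi> = integral {- h..0} \<phi> + integral {0..b} \<phi>"
      using h b by (intro Henstock_Kurzweil_Integration.integral_combine[symmetric] hk) auto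
    moreover have "integral {- h..b} \<phi> = integral {- h..b - h} \<phi> + integral {b - h..b} \<phi>"
      using h b by (intro Henstock_Kurzweil_Integration.integral_combine[symmetric] hk) auto
    moreover have "0 \<le> integral {- h..0} \<phi>" using b by (intro Henstock_Kurzweil_Integration.integral_nonneg hk \<phi>0) auto
    moreover have "integral {b - h..b} \<phi> \<le> integral {b - h..b} (\<lambda>_. \<phi> b)"
      using \<phi>b by (intro integral_le hk) auto
    moreover have "integral {b - h..b} (\<lambda>_. \<phi> b) = h * \<phi> b" using h by simp
    ultimately show ?thesis by linarith
  qed
  then have "real (Suc n) * (integral {0..b} \<phi> - integral {- h..b - h} \<phi>) \<le> real (Suc n) * (h * \<phi> b)"
    by (intro mult_left_mono) auto
  also have "\<dots> = \<phi> b" using h(2) by (metis mult.assoc mult.left_neutral)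
  finally show ?thesis by (simp add: \<phi>_def)
qed

lemma backward_quotient_add:
  fixes f g :: "real \<Rightarrow> 'a::{banach, second_countable_topology}"
  assumes "integrable (lebesgue_on {0..b}) f" "integrable (lebesgue_on {0..b}) g" "t \<le> b"
  shows "backward_quotient (\<lambda>x. f x + g x) n t = backward_quotient f n t + backward_quotient g n t"
proof -
  have "integrable (lebesgue_on {0..s}) f" "integrable (lebesgue_on {0..s}) g" if "s \<le> b" for s
    using that by (auto intro!: integrable_lebesgue_on_subset[OF assms(1)] integrable_lebesgue_on_subset[OF assms(2)])
  moreover have "t - 1 / real (Suc n) \<le> b" using assms(3) by (simp add: order_trans[of _ t])
  ultimately show ?thesis
    using assms(3) unfolding backward_quotient_def by (simp add: algebra_simps)
qed

text \<open>Convergence in mean, unlike almost everywhere convergence, passes to L1 limits by the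
  contraction alone, so a density argument works without a maximal inequality.\<close>

definition L1_differentiates :: "real \<Rightarrow> (real \<Rightarrow> 'a::{banach, second_countable_topology}) \<Rightarrow> bool" where
  "L1_differentiates b f \<longleftrightarrow>
     (\<lambda>n. \<integral>t. norm (backward_quotient f n t - f t) \<partial>lebesgue_on {0..b}) \<longlonglongrightarrow> 0"

text \<open>With \<open>g = f - s i\<close>, the error for \<open>f\<close> splits into the quotient
  of \<open>g\<close>, the error for \<open>s i\<close> and \<open>g\<close> itself. By the
  contraction the first costs no more than the third.\<close>

lemma L1_differentiates_limit:
  fixes f :: "real \<Rightarrow> 'a::{banach, second_countable_topology}"
  assumes b: "0 < b" and f: "integrable (lebesgue_on {0..b}) f"
    and s: "\<And>i. integrable (lebesgue_on {0..b}) (s i)" "\<And>i. L1_differentiates b (s i)"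
    and lim: "(\<lambda>i. \<integral>t. norm (f t - s i t) \<partial>lebesgue_on {0..b}) \<longlonglongrightarrow> 0"
  shows "L1_differentiates b f"
  unfolding L1_differentiates_def
proof (rule LIMSEQ_I)
  define M where "M = lebesgue_on {0..b}"
  fix e :: real assume e: "0 < e"
  obtain i where i: "(\<integral>t. norm (f t - s i t) \<partial>M) < e / 4"
    using order_tendstoD(2)[OF lim, of "e / 4"] e by (auto simp: M_def eventually_sequentially)
  have "\<forall>\<^sub>F n in sequentially. (\<integral>t. norm (backward_quotient (s i) n t - s i t) \<partial>M) < e / 4"
    using order_tendstoD(2)[OF s(2)[of i, unfolded L1_differentiates_def], of "e / 4"] e by (simp add: M_def)
  then obtain n0 where n0: "\<And>n. n0 \<le> n \<Longrightarrow> (\<integral>t. norm (backward_quotient (s i) n t - s i t) \<partial>M) < e / 4"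
    by (auto simp: eventually_sequentially)
  have "norm ((\<integral>t. norm (backward_quotient f n t - f t) \<partial>M) - 0) < e" if "n0 \<le> n" for n
  proof -
    define g where "g t = f t - s i t" for t
    have g: "integrable M g" unfolding g_def[abs_def] M_def using f s(1) by simp
    have bi: "integrable M (backward_quotient (s i) n)" "integrable M (backward_quotient g n)"
      "integrable M (backward_quotient f n)"
      unfolding M_def using g f s(1) by (auto intro!: integrable_backward_quotient simp: M_def)
    have si: "integrable M (s i)" "integrable M f" using s(1) f by (auto simp: M_def)
    have "backward_quotient f n t = backward_quotient g n t + backward_quotient (s i) n t" if "t \<le> b" for t
      using backward_quotient_add[OF g[unfolded M_def] s(1)[of i] that, of n] by (simp add: g_def)
    then have "norm (backward_quotient f n t - f t) \<le>
        norm (backward_quotient g n t) + norm (backward_quotient (s i) n t - s i t) + norm (g t)" if "t \<le> b" for t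
      using that norm_triangle_ineq4[of "backward_quotient g n t + (backward_quotient (s i) n t - s i t)" "g t"]
        norm_triangle_ineq[of "backward_quotient g n t" "backward_quotient (s i) n t - s i t"]
      by (simp add: g_def algebra_simps)
    then have "(\<integral>t. norm (backward_quotient f n t - f t) \<partial>M) \<le>
        (\<integral>t. norm (backward_quotient g n t) + norm (backward_quotient (s i) n t - s i t) + norm (g t) \<partial>M)"
      using bi si g by (intro integral_mono) (auto simp: M_def)
    also have "\<dots> = (\<integral>t. norm (backward_quotient g n t) \<partial>M) + (\<integral>t. norm (backward_quotient (s i) n t - s i t) \<partial>M)
        + (\<integral>t. norm (g t) \<partial>M)"
      using bi si g by simp
    also have "\<dots> < e / 4 + e / 4 + e / 4"
      using backward_quotient_L1_contraction[OF g[unfolded M_def] b, of n] n0[OF that] i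
      by (simp add: g_def M_def)
    finally show ?thesis using e by simp
  qed
  then show "\<exists>no. \<forall>n\<ge>no. norm ((\<integral>t. norm (backward_quotient f n t - f t) \<partial>lebesgue_on {0..b}) - 0) < e"
    unfolding M_def by blast
qed

text \<open>The fundamental theorem gives pointwise convergence on \<open>{0<..b}\<close>; at
  \<open>b\<close> a one-sided derivative suffices because the quotients look backward. The bound
  \<open>K\<close> of \<open>g\<close> also bounds the quotients and provides the majorant.\<close>

lemma L1_differentiates_continuous:
  fixes g :: "real \<Rightarrow> real"
  assumes b: "0 < b" and g: "continuous_on {0..b} g"
  shows "L1_differentiates b g"
proof -
  define M where "M = lebesgue_on {0..b}"
  interpret finite_measure M unfolding M_def by (rule finite_measure_lebesgue_on_Icc)
  have gi: "integrable (lebesgue_on {0..b}) g" using g by (rule integrable_continuous_Icc)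
  obtain K where K: "\<And>x. x \<in> {0..b} \<Longrightarrow> norm (g x) \<le> K"
    using compact_continuous_image[OF g] by (meson bounded_iff compact_Icc compact_imp_bounded imageI)
  define U where "U t = (\<integral>s. g s \<partial>lebesgue_on {0..t})" for t
  have gis: "integrable (lebesgue_on {c..d}) g" if "0 \<le> c" "d \<le> b" for c d
    using that by (intro integrable_lebesgue_on_subset[OF gi]) auto
  have lim: "(\<lambda>n. backward_quotient g n t) \<longlonglongrightarrow> g t" if t: "t \<in> {0<..b}" for t
  proof -
    define y where "y n = t - 1 / real (Suc n)" for n
    have "((\<lambda>x. integral {0..x} g) has_real_derivative g t) (at t within {0..b})"
      using t by (intro integral_has_real_derivative[OF g]) auto
    then have d: "((\<lambda>y. (integral {0..y} g - integral {0..t} g) / (y - t)) \<longlongrightarrow> g t) (at t within {0..b})"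
      by (simp add: has_field_derivative_iff)
    have ylim: "y \<longlonglongrightarrow> t"
      using tendsto_diff[OF tendsto_const LIMSEQ_Suc[OF lim_1_over_n], of t] by (simp add: y_def[abs_def])
    have y0: "\<forall>\<^sub>F n in sequentially. 0 < y n" using order_tendstoD(1)[OF ylim] t by auto
    then have "\<forall>\<^sub>F n in sequentially. y n \<in> {0..b} \<and> y n \<noteq> t"
      by eventually_elim (use t in \<open>auto simp: y_def intro: order_trans[of _ t]\<close>)
    then have "filterlim y (at t within {0..b}) sequentially"
      using ylim by (auto simp: filterlim_at elim: eventually_mono)
    from filterlim_compose[OF d this]
    have "(\<lambda>n. (integral {0..y n} g - integral {0..t} g) / (y n - t)) \<longlonglongrightarrow> g t" .
    moreover have "\<forall>\<^sub>F n in sequentially. (integral {0..y n} g - integral {0..t} g) / (y n - t) = backward_quotient g n t"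
      using y0
    proof eventually_elim
      case (elim n)
      have "y n \<le> t" by (simp add: y_def)
      then have "integral {0..y n} g = U (y n)" "integral {0..t} g = U t"
        unfolding U_def using t by (auto intro!: lebesgue_integral_eq_integral[symmetric] gis)
      then show ?case unfolding backward_quotient_def U_def y_def by (simp add: field_simps)
    qed
    ultimately show ?thesis by (rule Lim_transform_eventually)
  qed
  have bd: "norm (backward_quotient g n t) \<le> K" if t: "t \<in> {0..b}" for n t
  proof -
    define y where "y = t - 1 / real (Suc n)"
    have yt: "y \<le> t" by (simp add: y_def)
    have K0: "0 \<le> K" using K[OF t] norm_ge_zero order_trans by blast
    \<comment> \<open>Clamping merges the case of a left end below 0: both integrals vanish there,
      and the remaining interval still has length at most \<open>1 / Suc n\<close>.\<close>
    define z where "z = max 0 y"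
    have z: "0 \<le> z" "z \<le> t" "t - z \<le> 1 / real (Suc n)" using t yt by (auto simp: z_def y_def)
    have "(\<integral>s. g s \<partial>lebesgue_on {0..y}) = (\<integral>s. g s \<partial>lebesgue_on {0..z})"
    proof (cases "0 \<le> y")
      case False
      then have "(\<integral>s. g s \<partial>lebesgue_on {0..z}) = integral {0..z} g"
        using t by (intro lebesgue_integral_eq_integral gis) (auto simp: z_def)
      then show ?thesis using False by (simp add: z_def)
    qed (simp add: z_def)
    then have "U t - (\<integral>s. g s \<partial>lebesgue_on {0..y}) = (\<integral>s. g s \<partial>lebesgue_on {z..t})"
      unfolding U_def using integral_lebesgue_on_split[OF gis[of 0 t] z(1,2)] t by simp
    also have "norm \<dots> \<le> (\<integral>s. K \<partial>lebesgue_on {z..t})"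
    proof -
      interpret f: finite_measure "lebesgue_on {z..t}" by (rule finite_measure_lebesgue_on_Icc)
      show ?thesis using t z K by (intro integral_norm_le_AE gis) (auto intro!: AE_I2)
    qed
    also have "\<dots> = (t - z) * K" using z(2) by (simp add: measure_restrict_space)
    also have "\<dots> \<le> 1 / real (Suc n) * K" using z K0 by (intro mult_right_mono) auto
    finally have "real (Suc n) * norm (U t - (\<integral>s. g s \<partial>lebesgue_on {0..y})) \<le> real (Suc n) * (1 / real (Suc n) * K)"
      by (intro mult_left_mono) auto
    then show ?thesis unfolding backward_quotient_def U_def y_def by (simp add: abs_mult)
  qed
  have "(\<lambda>n. \<integral>t. norm (backward_quotient g n t - g t) \<partial>M) \<longlonglongrightarrow> (\<integral>t. 0 \<partial>M)"
  proof (rule integral_dominated_convergence[where w = "\<lambda>_. K + K"])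
    show "AE t in M. (\<lambda>n. norm (backward_quotient g n t - g t)) \<longlonglongrightarrow> 0"
    proof -
      have "AE t in M. t \<noteq> 0" "AE t in M. t \<in> {0..b}"
        unfolding M_def using AE_lebesgue_on_neq AE_space[of "lebesgue_on {0..b}"] by auto
      then show ?thesis
      proof eventually_elim
        case (elim t)
        then have "(\<lambda>n. backward_quotient g n t - g t) \<longlonglongrightarrow> g t - g t"
          using lim[of t] by (intro tendsto_intros) auto
        then show ?case by (simp only: diff_self tendsto_norm_zero_iff)
      qed
    qed
    show "AE t in M. norm (norm (backward_quotient g n t - g t)) \<le> K + K" for n
      
    proof (rule AE_I2)
      fix t assume "t \<in> space M"
      then have "t \<in> {0..b}" by (simp add: M_def)
      then show "norm (norm (backward_quotient g n t - g t)) \<le> K + K"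
        using bd[of t n] K[of t] norm_triangle_ineq4[of "backward_quotient g n t" "g t"]
        unfolding real_norm_def by linarith
    qed
    show "(\<lambda>t. norm (backward_quotient g n t - g t)) \<in> borel_measurable M" for n
      unfolding M_def using integrable_backward_quotient[OF gi, of n] gi by auto
  qed auto
  then show ?thesis by (simp add: L1_differentiates_def M_def)
qed

text \<open>A measurable function is an almost everywhere limit of continuous ones. Truncating these
  to values in the unit interval adds domination, so they converge in L1 and the limit lemma
  applies.\<close>

lemma L1_differentiates_indicator:
  assumes b: "0 < b" and A: "A \<in> sets (lebesgue_on {0..b})"
  shows "L1_differentiates b (indicator A :: real \<Rightarrow> real)"
proof -
  define M where "M = lebesgue_on {0..b}"
  interpret finite_measure M unfolding M_def by (rule finite_measure_lebesgue_on_Icc)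
  have A': "A \<in> sets lebesgue" using A by (auto simp: sets_restrict_space)
  then have "(indicator A :: real \<Rightarrow> real) measurable_on UNIV"
    by (simp add: measurable_on_iff_borel_measurable lebesgue_on_UNIV_eq)
  then obtain N g where N: "negligible N" and gc: "\<And>n. continuous_on UNIV (g n)"
    and gl: "\<And>x. x \<notin> N \<Longrightarrow> (\<lambda>n. g n x) \<longlonglongrightarrow> (indicator A x :: real)"
    unfolding measurable_on_def by auto
  define s where "s n x = max 0 (min 1 (g n x))" for n x
  have sc: "continuous_on {0..b} (s n)" for n
    unfolding s_def[abs_def] by (intro continuous_intros continuous_on_subset[OF gc]) auto
  have si: "integrable (lebesgue_on {0..b}) (s n)" for n using sc by (rule integrable_continuous_Icc)
  have iA: "integrable M (indicator A :: real \<Rightarrow> real)"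
    using A by (intro integrable_const_bound[of _ 1] borel_measurable_indicator) (auto simp: M_def indicator_def)
  have sl: "(\<lambda>n. s n x) \<longlonglongrightarrow> indicator A x" if "x \<notin> N" for x
  proof -
    have "(\<lambda>n. s n x) \<longlonglongrightarrow> max 0 (min 1 (indicator A x))"
      unfolding s_def by (intro tendsto_intros gl that)
    then show ?thesis by (simp add: indicator_def split: if_splits)
  qed
  have "(\<lambda>n. \<integral>x. norm (indicator A x - s n x) \<partial>M) \<longlonglongrightarrow> (\<integral>x. 0 \<partial>M)"
  proof (rule integral_dominated_convergence[where w = "\<lambda>_. 1"])
    have "AE x in lebesgue. x \<notin> N"
      using N by (auto simp: negligible_iff_null_sets intro: AE_not_in)
    then have "AE x in M. x \<notin> N" unfolding M_def by (subst AE_restrict_space_iff) auto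
    then show "AE x in M. (\<lambda>n. norm (indicator A x - s n x)) \<longlonglongrightarrow> 0"
    proof eventually_elim
      case (elim x)
      have "(\<lambda>n. indicator A x - s n x) \<longlonglongrightarrow> indicator A x - indicator A x"
        by (intro tendsto_intros sl elim)
      then show ?case by (simp only: diff_self tendsto_norm_zero_iff)
    qed
    show "AE x in M. norm (norm (indicator A x - s n x)) \<le> 1" for n
      by (auto simp: s_def indicator_def)
    show "(\<lambda>x. norm (indicator A x - s n x)) \<in> borel_measurable M" for n
      using si[of n] iA by (auto simp: M_def)
  qed auto
  then show ?thesis
    using iA by (intro L1_differentiates_limit[OF b _ si L1_differentiates_continuous[OF b sc]]) (auto simp: M_def)
qed

text \<open>Induction over integrable functions. The base case is a scalar indicator times a fixed
  vector, so vector values cause no extra work.\<close>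

lemma L1_differentiates_integrable:
  fixes f :: "real \<Rightarrow> 'a::{banach, second_countable_topology}"
  assumes b: "0 < b" and f: "integrable (lebesgue_on {0..b}) f"
  shows "L1_differentiates b f"
  using f
proof (induction rule: integrable_induct)
  case (base A c)
  interpret finite_measure "lebesgue_on {0..b}" by (rule finite_measure_lebesgue_on_Icc)
  have i: "integrable (lebesgue_on {0..b}) (indicator A :: real \<Rightarrow> real)"
    using base by (intro integrable_const_bound[of _ 1] borel_measurable_indicator) (auto simp: indicator_def)
  have "backward_quotient (\<lambda>x. indicator A x *\<^sub>R c) n t = backward_quotient (indicat_real A) n t *\<^sub>R c" if "t \<le> b" for n t
  proof -
    have "integrable (lebesgue_on {0..s}) (indicator A :: real \<Rightarrow> real)" if "s \<le> b" for s
      using that by (intro integrable_lebesgue_on_subset[OF i]) auto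
    then have "(\<integral>x. indicator A x *\<^sub>R c \<partial>lebesgue_on {0..s}) = (\<integral>x. indicator A x \<partial>lebesgue_on {0..s}) *\<^sub>R c" if "s \<le> b" for s
      using that by (intro integral_scaleR_left)
    moreover have "t - 1 / real (Suc n) \<le> b" using that by (simp add: order_trans[of _ t])
    ultimately show ?thesis 
      using that unfolding backward_quotient_def by (simp only: scaleR_diff_left[symmetric] real_scaleR_def scaleR_scaleR)
  qed
  then have "norm (backward_quotient (\<lambda>x. indicator A x *\<^sub>R c) n t - indicator A t *\<^sub>R c) =
      norm (backward_quotient (indicat_real A) n t - indicat_real A t) * norm c" if "t \<in> {0..b}" for n t
    using that by (simp flip: scaleR_diff_left)
  then have "(\<integral>t. norm (backward_quotient (\<lambda>x. indicator A x *\<^sub>R c) n t - indicator A t *\<^sub>R c) \<partial>lebesgue_on {0..b}) =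
      (\<integral>t. norm (backward_quotient (indicat_real A) n t - indicat_real A t) * norm c \<partial>lebesgue_on {0..b})" for n
    by (intro Bochner_Integration.integral_cong) auto
  also have "\<dots> n = (\<integral>t. norm (backward_quotient (indicat_real A) n t - indicat_real A t) \<partial>lebesgue_on {0..b}) * norm c" for n
    by simp
  finally show ?case
    using tendsto_mult_right[OF L1_differentiates_indicator[OF b base(1), unfolded L1_differentiates_def], of "norm c"]
    by (simp add: L1_differentiates_def)
next
  case (add f g)
  have "(\<lambda>n. (\<integral>t. norm (backward_quotient f n t - f t) \<partial>lebesgue_on {0..b}) + (\<integral>t. norm (backward_quotient g n t - g t) \<partial>lebesgue_on {0..b})) \<longlonglongrightarrow> 0 + 0"
    using add unfolding L1_differentiates_def by (intro tendsto_add)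
  then have lim: "(\<lambda>n. (\<integral>t. norm (backward_quotient f n t - f t) \<partial>lebesgue_on {0..b}) + (\<integral>t. norm (backward_quotient g n t - g t) \<partial>lebesgue_on {0..b})) \<longlonglongrightarrow> 0"
    by simp
  show ?case unfolding L1_differentiates_def
  proof (rule tendsto_sandwich[OF _ _ tendsto_const lim])
    show "\<forall>\<^sub>F n in sequentially. (\<integral>t. norm (backward_quotient (\<lambda>x. f x + g x) n t - (f t + g t)) \<partial>lebesgue_on {0..b})
      \<le> (\<integral>t. norm (backward_quotient f n t - f t) \<partial>lebesgue_on {0..b}) + (\<integral>t. norm (backward_quotient g n t - g t) \<partial>lebesgue_on {0..b})"
    proof (intro always_eventually allI)
      fix n
      note bi = integrable_backward_quotient[OF add(1), of n] integrable_backward_quotient[OF add(2), of n]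
        integrable_backward_quotient[OF Bochner_Integration.integrable_add[OF add(1,2)], of n]
      have "norm (backward_quotient (\<lambda>x. f x + g x) n t - (f t + g t)) \<le>
        norm (backward_quotient f n t - f t) + norm (backward_quotient g n t - g t)" if "t \<in> {0..b}" for t
        using backward_quotient_add[OF add(1,2), of t n] that
          norm_triangle_ineq[of "backward_quotient f n t - f t" "backward_quotient g n t - g t"]
        by (simp add: algebra_simps)
      then have "(\<integral>t. norm (backward_quotient (\<lambda>x. f x + g x) n t - (f t + g t)) \<partial>lebesgue_on {0..b}) \<le>
        (\<integral>t. norm (backward_quotient f n t - f t) + norm (backward_quotient g n t - g t) \<partial>lebesgue_on {0..b})"
        using bi add(1,2) by (intro integral_mono) auto
      then show "(\<integral>t. norm (backward_quotient (\<lambda>x. f x + g x) n t - (f t + g t)) \<partial>lebesgue_on {0..b})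
      \<le> (\<integral>t. norm (backward_quotient f n t - f t) \<partial>lebesgue_on {0..b}) + (\<integral>t. norm (backward_quotient g n t - g t) \<partial>lebesgue_on {0..b})"
        using bi add(1,2) by simp
    qed
  qed auto
next
  case (lim f s)
  have "(\<lambda>i. \<integral>t. norm (f t - s i t) \<partial>lebesgue_on {0..b}) \<longlonglongrightarrow> (\<integral>t. 0 \<partial>lebesgue_on {0..b})"
  \<comment> \<open>The induction principle provides approximations with norm at most
    \<open>2 * norm (f t)\<close>; adding \<open>f\<close> itself gives the factor 3.\<close>
  proof (rule integral_dominated_convergence[where w = "\<lambda>t. 3 * norm (f t)"])
    show "AE t in lebesgue_on {0..b}. (\<lambda>i. norm (f t - s i t)) \<longlonglongrightarrow> 0"
    proof (rule AE_I2)
      fix t assume "t \<in> space (lebesgue_on {0..b})"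
      from tendsto_diff[OF tendsto_const lim(2)[OF this], of "f t"]
      show "(\<lambda>i. norm (f t - s i t)) \<longlonglongrightarrow> 0" by (simp add: tendsto_norm_zero)
    qed
    show "AE t in lebesgue_on {0..b}. norm (norm (f t - s i t)) \<le> 3 * norm (f t)" for i
    proof (rule AE_I2)
      fix t assume "t \<in> space (lebesgue_on {0..b})"
      from lim(3)[OF this, of i] show "norm (norm (f t - s i t)) \<le> 3 * norm (f t)"
        using norm_triangle_ineq4[of "f t" "s i t"] by simp
    qed
  qed (use lim(1,4) in auto)
  then show ?case using lim by (intro L1_differentiates_limit[OF b lim(4) lim(1)]) auto
qed

text \<open>Some sequence of steps tending to 0 is all that the derivative bound requires.\<close>

lemma AE_backward_quotient_subseq:
  fixes f :: "real \<Rightarrow> 'a::{banach, second_countable_topology}"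
  assumes b: "0 < b" and f: "integrable (lebesgue_on {0..b}) f"
  obtains r :: "nat \<Rightarrow> nat" where "strict_mono r"
    "AE t in lebesgue_on {0..b}. (\<lambda>n. backward_quotient f (r n) t) \<longlonglongrightarrow> f t"
proof -
  from tendsto_L1_AE_subseq[OF _ L1_differentiates_integrable[OF b f, unfolded L1_differentiates_def]]
  obtain r :: "nat \<Rightarrow> nat" where r: "strict_mono r"
    "AE t in lebesgue_on {0..b}. (\<lambda>n. backward_quotient f (r n) t - f t) \<longlonglongrightarrow> 0"
    using integrable_backward_quotient[OF f] f by auto
  then show ?thesis using that[of r] by (simp add: LIM_zero_iff)
qed

section \<open>Strongly continuous semigroups\<close>

text \<open>The weighted supremum of \<open>exp (- 2 * K * t) * p t\<close> absorbs the integral term.\<close>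

lemma Gronwall_sup_bound:
  fixes p :: "real \<Rightarrow> real"
  assumes b: "0 \<le> b" and p: "continuous_on {0..b} p" and K: "0 < K" and a: "0 \<le> a"
    and le: "\<And>t. t \<in> {0..b} \<Longrightarrow> p t \<le> a + K * (\<integral>s. p s \<partial>lebesgue_on {0..t})"
    and t: "t \<in> {0..b}"
  shows "p t \<le> 2 * a * exp (2 * K * b)"
proof -
  define q where "q t = exp (- (2 * K * t)) * p t" for t
  have "continuous_on {0..b} q" unfolding q_def[abs_def] using p by (intro continuous_intros)
  then obtain t0 where t0: "t0 \<in> {0..b}" "\<And>s. s \<in> {0..b} \<Longrightarrow> q s \<le> q t0"
    using continuous_attains_sup[of "{0..b}" q] b by auto
  define m where "m = max 0 (q t0)"
  have m0: "0 \<le> m" by (simp add: m_def)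
  have pq: "p s = exp (2 * K * s) * q s" for s
    by (simp add: q_def exp_minus field_simps)
  have pm: "p s \<le> m * exp (2 * K * s)" if "s \<in> {0..b}" for s
    using t0(2)[OF that] by (simp add: pq m_def mult.commute)
  \<comment> \<open>At the maximizer \<open>t0\<close>, the integral of
    \<open>m * exp (2 * K * s)\<close>, multiplied by \<open>K\<close>, is at most half of
    \<open>m * exp (2 * K * t0)\<close>. The hypothesis thus yields
    \<open>m \<le> a + m / 2\<close>; the factor 2 in the exponent is chosen for this half.\<close>
  have "m \<le> 2 * a"
  proof (cases "q t0 \<le> 0")
    case False
    then have mq: "m = q t0" by (simp add: m_def)
    have ce: "continuous_on {0..t0} (\<lambda>s. m * exp (2 * K * s))" by (intro continuous_intros)
    have "(\<integral>s. p s \<partial>lebesgue_on {0..t0}) \<le> (\<integral>s. m * exp (2 * K * s) \<partial>lebesgue_on {0..t0})"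
      using t0(1) pm
      by (intro integral_mono integrable_continuous_Icc continuous_on_subset[OF p] ce) auto
    also have "\<dots> = integral {0..t0} (\<lambda>s. m * exp (2 * K * s))"
      by (rule lebesgue_integral_eq_integral[OF integrable_continuous_Icc[OF ce]]) simp
    also have "\<dots> = m * exp (2 * K * t0) / (2 * K) - m * exp (2 * K * 0) / (2 * K)"
    proof (rule integral_unique, rule fundamental_theorem_of_calculus)
      show "0 \<le> t0" using t0 by simp
      fix x assume "x \<in> {0..t0}"
      show "((\<lambda>x. m * exp (2 * K * x) / (2 * K)) has_vector_derivative m * exp (2 * K * x)) (at x within {0..t0})"
        using K unfolding has_real_derivative_iff_has_vector_derivative[symmetric]
        by (auto intro!: derivative_eq_intros)
    qed
    also have "\<dots> \<le> m * exp (2 * K * t0) / (2 * K)" using m0 K by simp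
    finally have "p t0 \<le> a + K * (m * exp (2 * K * t0) / (2 * K))"
      using le[OF t0(1)] K mult_left_mono[of _ _ K] by (smt (verit))
    also have "\<dots> = a + m * exp (2 * K * t0) / 2" using K by simp
    finally have "exp (- (2 * K * t0)) * p t0 \<le> exp (- (2 * K * t0)) * (a + m * exp (2 * K * t0) / 2)"
      by (intro mult_left_mono) auto
    also have "\<dots> = exp (- (2 * K * t0)) * a + m / 2" by (simp add: exp_minus field_simps)
    also have "\<dots> \<le> 1 * a + m / 2" using a K t0 by (intro add_right_mono mult_right_mono) auto
    finally show ?thesis by (simp add: mq q_def)
  qed (use a in \<open>auto simp: m_def\<close>)
  have "p t \<le> m * exp (2 * K * t)" by (rule pm[OF t])
  also have "\<dots> \<le> 2 * a * exp (2 * K * b)"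
    using \<open>m \<le> 2 * a\<close> m0 K t by (intro mult_mono) auto
  finally show ?thesis .
qed

text \<open>Factoring out the operator at the earlier time reduces continuity from either side to
  the right limit at 0.\<close>

lemma C0_semigroup_norm_diff_le:
  assumes T: "C0_semigroup T" "\<And>t. t \<in> {0..b} \<Longrightarrow> norm (T t) \<le> M" and "0 \<le> s" "s \<le> t" "t \<le> b"
  shows "norm (blinfun_apply (T t) x - blinfun_apply (T s) x) \<le> M * norm (blinfun_apply (T (t - s)) x - x)"
proof -
  have "T t = T s o\<^sub>L T (t - s)"
    using T(1) assms(3,4) unfolding C0_semigroup_def by (metis add_diff_cancel_left' diff_ge_0_iff_ge le_add_diff_inverse)
  then have "blinfun_apply (T t) x - blinfun_apply (T s) x = blinfun_apply (T s) (blinfun_apply (T (t - s)) x - x)"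
    by (simp add: blinfun.diff_right)
  also have "norm \<dots> \<le> norm (T s) * norm (blinfun_apply (T (t - s)) x - x)" by (rule norm_blinfun)
  also have "\<dots> \<le> M * norm (blinfun_apply (T (t - s)) x - x)"
    using assms by (intro mult_right_mono) auto
  finally show ?thesis .
qed

lemma C0_semigroup_continuous_on:
  assumes T: "C0_semigroup T" "\<And>t. t \<in> {0..b} \<Longrightarrow> norm (T t) \<le> M"
  shows "continuous_on {0..b} (\<lambda>t. blinfun_apply (T t) x)"
  unfolding continuous_on_iff
proof (intro ballI allI impI)
  fix s e :: real assume s: "s \<in> {0..b}" and e: "0 < e"
  have M0: "0 \<le> M" using T(2)[OF s] norm_ge_zero order_trans by blast
  have "((\<lambda>t. blinfun_apply (T t) x) \<longlongrightarrow> x) (at_right 0)" using T(1) unfolding C0_semigroup_def by blast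
  from tendstoD[OF this, of "e / (M + 1)"]
  obtain d where d: "0 < d" "\<And>\<tau>. 0 < \<tau> \<Longrightarrow> \<tau> < d \<Longrightarrow> norm (blinfun_apply (T \<tau>) x - x) < e / (M + 1)"
    using e M0 by (auto simp: eventually_at_right dist_norm)
  have T0: "T 0 = id_blinfun" using T(1) unfolding C0_semigroup_def by blast
  have key: "norm (blinfun_apply (T t') x - blinfun_apply (T s') x) < e"
    if "0 \<le> s'" "s' \<le> t'" "t' \<le> b" "t' - s' < d" for s' t'
  proof -
    have "norm (blinfun_apply (T (t' - s')) x - x) \<le> e / (M + 1)"
      using d(2)[of "t' - s'"] that e M0 T0 by (cases "t' = s'") auto
    then have "M * norm (blinfun_apply (T (t' - s')) x - x) \<le> M * (e / (M + 1))"
      using M0 by (rule mult_left_mono)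
    also have "\<dots> < e" using e M0 by (simp add: field_simps)
    finally show ?thesis using C0_semigroup_norm_diff_le[OF T that(1-3), of x] by linarith
  qed
  have "dist (blinfun_apply (T t) x) (blinfun_apply (T s) x) < e" if "t \<in> {0..b}" "dist t s < d" for t
  proof (cases "s \<le> t")
    case True
    then show ?thesis using key[of s t] that s by (auto simp: dist_norm)
  next
    case False
    then show ?thesis using key[of t s] that s by (auto simp: dist_norm norm_minus_commute)
  qed
  then show "\<exists>d>0. \<forall>t\<in>{0..b}. dist t s < d \<longrightarrow> dist (blinfun_apply (T t) x) (blinfun_apply (T s) x) < e"
    using d(1) by blast
qed

lemma C0_semigroup_tendsto:
  assumes T: "C0_semigroup T" "\<And>t. t \<in> {0..b} \<Longrightarrow> norm (T t) \<le> M"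
    and s: "s \<in> {0..b}" and f: "(f \<longlongrightarrow> s) F" "\<And>y. f y \<in> {0..b}" and g: "(g \<longlongrightarrow> x) F"
  shows "((\<lambda>y. blinfun_apply (T (f y)) (g y)) \<longlongrightarrow> blinfun_apply (T s) x) F"
proof -
  have "((\<lambda>y. blinfun_apply (T (f y)) x) \<longlongrightarrow> blinfun_apply (T s) x) F"
    using s f by (intro continuous_on_tendsto_compose[OF C0_semigroup_continuous_on[OF T]]) auto
  moreover have "((\<lambda>y. blinfun_apply (T (f y)) (g y - x)) \<longlongrightarrow> 0) F"
  proof (rule Lim_null_comparison)
    show "\<forall>\<^sub>F y in F. norm (blinfun_apply (T (f y)) (g y - x)) \<le> M * norm (g y - x)"
      using f(2) T(2) by (intro always_eventually allI order_trans[OF norm_blinfun] mult_right_mono) auto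
    have "((\<lambda>y. M * norm (g y - x)) \<longlongrightarrow> M * norm (x - x)) F" using g by (intro tendsto_intros)
    then show "((\<lambda>y. M * norm (g y - x)) \<longlongrightarrow> 0) F" by simp
  qed
  ultimately have "((\<lambda>y. blinfun_apply (T (f y)) (g y - x) + blinfun_apply (T (f y)) x) \<longlongrightarrow> 0 + blinfun_apply (T s) x) F"
    by (intro tendsto_add)
  then show ?thesis by (simp add: blinfun.diff_right)
qed

text \<open>Strong continuity and the uniform bound make \<open>T \<tau> y\<close> jointly
  continuous in time and vector, which replaces measurability in operator norm. Clamping the time to
  \<open>{0..b}\<close> extends this map continuously to the whole product space.\<close>

lemma C0_semigroup_apply_measurable:
  fixes T :: "real \<Rightarrow> 'e::{banach, second_countable_topology} \<Rightarrow>\<^sub>L 'e"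
  assumes T: "C0_semigroup T" "\<And>t. t \<in> {0..b} \<Longrightarrow> norm (T t) \<le> M" and b: "0 \<le> b"
    and [measurable]: "h \<in> borel_measurable N" "\<tau> \<in> borel_measurable N" and \<tau>: "\<And>s. s \<in> space N \<Longrightarrow> \<tau> s \<in> {0..b}"
  shows "(\<lambda>s. blinfun_apply (T (\<tau> s)) (h s)) \<in> borel_measurable N"
proof -
  define cl where "cl r = max 0 (min b r)" for r :: real
  have cl: "cl r \<in> {0..b}" "continuous_on UNIV cl" for r
    using b unfolding cl_def[abs_def] by (auto intro!: continuous_intros simp: cl_def)
  have "continuous_on UNIV (\<lambda>p. blinfun_apply (T (cl (fst p))) (snd p))"
    unfolding continuous_on_def using cl
    by (intro ballI C0_semigroup_tendsto[OF T]) (auto intro!: tendsto_intros simp: cl_def)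
  then have "(\<lambda>s. (\<lambda>p. blinfun_apply (T (cl (fst p))) (snd p)) (\<tau> s, h s)) \<in> borel_measurable N"
    by (rule borel_measurable_continuous_on) measurable
  also have "?this \<longleftrightarrow> ?thesis" using \<tau> by (intro measurable_cong) (auto simp: cl_def)
  finally show ?thesis .
qed

lemma mild_integrand_integrable:
  fixes T :: "real \<Rightarrow> 'e::{banach, second_countable_topology} \<Rightarrow>\<^sub>L 'e"
  assumes T: "C0_semigroup T" "\<And>t. t \<in> {0..b} \<Longrightarrow> norm (T t) \<le> M"
    and h: "integrable (lebesgue_on {0..b}) h" and "0 \<le> s" "t \<le> b"
  shows "integrable (lebesgue_on {s..t}) (\<lambda>r. blinfun_apply (T (t - r)) (h r))"
proof (cases "s \<le> t")
  case True
  have hi: "integrable (lebesgue_on {s..t}) h"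
    using assms by (intro integrable_lebesgue_on_subset[OF h]) auto
  show ?thesis
  proof (rule Bochner_Integration.integrable_bound)
    show "integrable (lebesgue_on {s..t}) (\<lambda>r. M * norm (h r))" using hi by simp
    have "(\<lambda>r. r) \<in> borel_measurable (lebesgue_on {s..t})"
      using id_borel_measurable_lebesgue_on by (simp add: id_def)
    then show "(\<lambda>r. blinfun_apply (T (t - r)) (h r)) \<in> borel_measurable (lebesgue_on {s..t})"
      using hi assms True by (intro C0_semigroup_apply_measurable[where b = b, OF T]) auto
    show "AE r in lebesgue_on {s..t}. norm (blinfun_apply (T (t - r)) (h r)) \<le> norm (M * norm (h r))"
    proof (rule AE_I2)
      fix r assume "r \<in> space (lebesgue_on {s..t})"
      then have "norm (T (t - r)) \<le> M" using assms by (intro T(2)) auto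
      then have "norm (blinfun_apply (T (t - r)) (h r)) \<le> M * norm (h r)"
        by (intro order_trans[OF norm_blinfun] mult_right_mono) auto
      then show "norm (blinfun_apply (T (t - r)) (h r)) \<le> norm (M * norm (h r))" by simp
    qed
  qed
qed simp

lemma mild_integral_bound:
  fixes T :: "real \<Rightarrow> 'e::{banach, second_countable_topology} \<Rightarrow>\<^sub>L 'e"
  assumes T: "C0_semigroup T" "\<And>t. t \<in> {0..b} \<Longrightarrow> norm (T t) \<le> M"
    and h: "integrable (lebesgue_on {0..b}) h" and st: "0 \<le> s" "t \<le> b"
    and \<psi>: "integrable (lebesgue_on {0..b}) \<psi>" "AE r in lebesgue_on {0..b}. norm (h r) \<le> \<psi> r"
  shows "norm (\<integral>r. blinfun_apply (T (t - r)) (h r) \<partial>lebesgue_on {s..t}) \<le> M * (\<integral>r. \<psi> r \<partial>lebesgue_on {s..t})"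
proof (cases "s \<le> t")
  case True
  have "M \<ge> 0" using T(2)[of s] True st norm_ge_zero order_trans by (metis atLeastAtMost_iff)
  have i: "integrable (lebesgue_on {s..t}) \<psi>" using st by (intro integrable_lebesgue_on_subset[OF \<psi>(1)]) auto
  have "norm (\<integral>r. blinfun_apply (T (t - r)) (h r) \<partial>lebesgue_on {s..t}) \<le> (\<integral>r. M * \<psi> r \<partial>lebesgue_on {s..t})"
  proof (rule integral_norm_le_AE)
    have "AE r in lebesgue_on {s..t}. norm (h r) \<le> \<psi> r"
      using st by (intro AE_lebesgue_on_subset[OF \<psi>(2)]) auto
    then show "AE r in lebesgue_on {s..t}. norm (blinfun_apply (T (t - r)) (h r)) \<le> M * \<psi> r"
      using AE_space
    proof eventually_elim
      case (elim r)
      then have "norm (T (t - r)) \<le> M" using st by (intro T(2)) auto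
      then show ?case using elim(1) \<open>M \<ge> 0\<close> by (intro order_trans[OF norm_blinfun] mult_mono) auto
    qed
  qed (use i mild_integrand_integrable[OF T h st] in auto)
  then show ?thesis by simp
qed simp

text \<open>The operator for the elapsed time is pulled inside the integral and merged by the
  semigroup law. The purpose is to express \<open>x t\<close> by a compact operator applied to
  \<open>x s\<close>, up to an integral over a short interval.\<close>

lemma mild_restart:
  fixes T :: "real \<Rightarrow> 'e::{banach, second_countable_topology} \<Rightarrow>\<^sub>L 'e"
  assumes T: "C0_semigroup T" "\<And>t. t \<in> {0..b} \<Longrightarrow> norm (T t) \<le> M"
    and h: "integrable (lebesgue_on {0..b}) h" and st: "0 \<le> s" "s \<le> t" "t \<le> b"
    and x: "\<And>t. t \<in> {0..b} \<Longrightarrow> x t = blinfun_apply (T t) x0 + (\<integral>r. blinfun_apply (T (t - r)) (h r) \<partial>lebesgue_on {0..t})"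
  shows "x t = blinfun_apply (T (t - s)) (x s) + (\<integral>r. blinfun_apply (T (t - r)) (h r) \<partial>lebesgue_on {s..t})"
proof -
  have sg: "T (p + q) = T p o\<^sub>L T q" if "0 \<le> p" "0 \<le> q" for p q
    using T(1) that unfolding C0_semigroup_def by blast
  have "blinfun_apply (T (t - s)) (\<integral>r. blinfun_apply (T (s - r)) (h r) \<partial>lebesgue_on {0..s}) =
      (\<integral>r. blinfun_apply (T (t - s)) (blinfun_apply (T (s - r)) (h r)) \<partial>lebesgue_on {0..s})"
    using st by (intro integral_bounded_linear[symmetric] blinfun.bounded_linear_right
        mild_integrand_integrable[OF T h]) auto
  also have "\<dots> = (\<integral>r. blinfun_apply (T (t - r)) (h r) \<partial>lebesgue_on {0..s})"
  proof (rule Bochner_Integration.integral_cong)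
    fix r assume "r \<in> space (lebesgue_on {0..s})"
    then have "T (t - r) = T (t - s) o\<^sub>L T (s - r)" using sg[of "t - s" "s - r"] st by simp
    then show "blinfun_apply (T (t - s)) (blinfun_apply (T (s - r)) (h r)) = blinfun_apply (T (t - r)) (h r)" by simp
  qed simp
  finally have "blinfun_apply (T (t - s)) (x s) = blinfun_apply (T (t - s)) (blinfun_apply (T s) x0)
      + (\<integral>r. blinfun_apply (T (t - r)) (h r) \<partial>lebesgue_on {0..s})"
    using st by (subst x) (auto simp: blinfun.add_right)
  moreover have "blinfun_apply (T (t - s)) (blinfun_apply (T s) x0) = blinfun_apply (T t) x0"
    using sg[of "t - s" s] st by simp
  moreover have "(\<integral>r. blinfun_apply (T (t - r)) (h r) \<partial>lebesgue_on {0..t}) =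
      (\<integral>r. blinfun_apply (T (t - r)) (h r) \<partial>lebesgue_on {0..s}) + (\<integral>r. blinfun_apply (T (t - r)) (h r) \<partial>lebesgue_on {s..t})"
    using st by (intro integral_lebesgue_on_split mild_integrand_integrable[OF T h]) auto
  ultimately show ?thesis using st by (subst x) auto
qed

lemma mild_integral_continuous:
  fixes T :: "real \<Rightarrow> 'e::{banach, second_countable_topology} \<Rightarrow>\<^sub>L 'e"
  assumes T: "C0_semigroup T" "\<And>t. t \<in> {0..b} \<Longrightarrow> norm (T t) \<le> M" and b: "0 \<le> b"
    and h: "integrable (lebesgue_on {0..b}) h"
  shows "continuous_on {0..b} (\<lambda>t. \<integral>r. blinfun_apply (T (t - r)) (h r) \<partial>lebesgue_on {0..t})"
proof -
  \<comment> \<open>The maximum keeps the time in \<open>{0..b}\<close> for all \<open>r\<close>,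
    also beyond the upper bound \<open>t\<close>, and changes nothing on the range of
    integration.\<close>
  have "continuous_on {..b} (\<lambda>t. \<integral>r. blinfun_apply (T (max 0 (t - r))) (h r) \<partial>lebesgue_on {0..t})"
  proof (rule continuous_on_integral_to_variable_bound[where w = "\<lambda>r. M * norm (h r)"])
    fix t assume t: "t \<le> b"
    have [measurable]: "(\<lambda>r. r) \<in> borel_measurable (lebesgue_on {0..b})"
      using id_borel_measurable_lebesgue_on by (simp add: id_def)
    show "(\<lambda>r. blinfun_apply (T (max 0 (t - r))) (h r)) \<in> borel_measurable (lebesgue_on {0..b})"
      using h t b by (intro C0_semigroup_apply_measurable[where b = b, OF T]) auto
    show "AE r in lebesgue_on {0..b}. norm (blinfun_apply (T (max 0 (t - r))) (h r)) \<le> M * norm (h r)"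
      using t b by (intro AE_I2 order_trans[OF norm_blinfun] mult_right_mono T(2)) auto
  next
    fix r assume r: "r \<in> {0..b}"
    have "continuous_on {r..b} (\<lambda>t. max 0 (t - r))" by (intro continuous_intros)
    moreover have "(\<lambda>t. max 0 (t - r)) ` {r..b} \<subseteq> {0..b}" using r by auto
    ultimately show "continuous_on {r..b} (\<lambda>t. blinfun_apply (T (max 0 (t - r))) (h r))"
      using continuous_on_compose2[of "{0..b}" "\<lambda>t. blinfun_apply (T t) (h r)"] C0_semigroup_continuous_on[of T b M] T
      by blast
  qed (use h in auto)
  then have "continuous_on {0..b} (\<lambda>t. \<integral>r. blinfun_apply (T (max 0 (t - r))) (h r) \<partial>lebesgue_on {0..t})"
    by (rule continuous_on_subset) auto
  then show ?thesis
    by (rule continuous_on_eq) (auto intro!: Bochner_Integration.integral_cong)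
qed

section \<open>Pointwise bound of the derivative\<close>

text \<open>Translates of null sets are null; applied to countably many steps, this makes the
  inclusion available at all times \<open>t - h n\<close> for almost every \<open>t\<close>.\<close>

lemma AE_lebesgue_on_translate:
  fixes c :: real
  assumes "AE s in lebesgue_on {0..b}. Q s"
  shows "AE t in lebesgue_on {0..b}. t - c \<in> {0..b} \<longrightarrow> Q (t - c)"
proof -
  have "AE s in lebesgue. s \<in> {0..b} \<longrightarrow> Q s" using assms by (simp add: AE_restrict_space_iff)
  then obtain N where N: "negligible N" "{s. \<not> (s \<in> {0..b} \<longrightarrow> Q s)} \<subseteq> N"
    unfolding eventually_ae_filter_negligible by blast
  have "negligible ((+) c ` N)" using N(1) by (rule negligible_translation)
  moreover have "{t. \<not> (t - c \<in> {0..b} \<longrightarrow> Q (t - c))} \<subseteq> (+) c ` N"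
  proof
    fix t assume "t \<in> {t. \<not> (t - c \<in> {0..b} \<longrightarrow> Q (t - c))}"
    then have "t - c \<in> N" using N(2) by blast
    then show "t \<in> (+) c ` N" by (intro image_eqI[of _ _ "t - c"]) auto
  qed
  ultimately have "AE t in lebesgue. t - c \<in> {0..b} \<longrightarrow> Q (t - c)"
    unfolding eventually_ae_filter_negligible by blast
  then show ?thesis by (subst AE_restrict_space_iff) auto
qed

lemma L2_space_imp_integrable:
  "f \<in> L2_space b \<Longrightarrow> integrable (lebesgue_on {0..b}) f"
  unfolding L2_space_def by (auto intro: integrable_square_imp_integrable)

lemma has_W12_derivative_continuous_on:
  assumes "has_W12_derivative b u u'"
  shows "continuous_on {0..b} u"
proof -
  have "integrable (lebesgue_on {0..b}) u'"
    using assms unfolding has_W12_derivative_def by (auto intro: L2_space_imp_integrable)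
  from continuous_on_subset[OF continuous_on_indefinite_integral[OF this], of "{0..b}"]
  have "continuous_on {0..b} (\<lambda>t. u 0 + (\<integral>s. u' s \<partial>lebesgue_on {0..t}))"
    by (intro continuous_on_add continuous_on_const) auto
  then show ?thesis
  proof (rule continuous_on_eq)
    fix t assume "t \<in> {0..b}"
    then show "u 0 + (\<integral>s. u' s \<partial>lebesgue_on {0..t}) = u t"
      using assms unfolding has_W12_derivative_def by metis
  qed
qed

lemma has_W12_derivative_diff:
  assumes "has_W12_derivative b u u'" "0 \<le> s" "s \<le> t" "t \<le> b"
  shows "u t - u s = (\<integral>r. u' r \<partial>lebesgue_on {s..t})"
proof -
  have i: "integrable (lebesgue_on {0..b}) u'" and eq: "\<And>t. t \<in> {0..b} \<Longrightarrow> u t = u 0 + (\<integral>r. u' r \<partial>lebesgue_on {0..t})"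
    using assms unfolding has_W12_derivative_def by (blast intro: L2_space_imp_integrable)+
  have "integrable (lebesgue_on {0..t}) u'" using assms by (intro integrable_lebesgue_on_subset[OF i]) auto
  from integral_lebesgue_on_split[OF this assms(2,3)] show ?thesis
    using eq[of s] eq[of t] assms by (simp add: algebra_simps)
qed

text \<open>If \<open>p \<le> a\<close> the claim is immediate, as \<open>2 / (1 - c)\<close> is at
  least 1. Otherwise \<open>q * a\<close> is at most \<open>q * p\<close>, the term
  \<open>c * p\<^sup>2\<close> is absorbed on the left because \<open>c < 1\<close>, and one factor
  \<open>p\<close> cancels.\<close>

lemma quadratic_inequality_bound:
  fixes p a q c :: real
  assumes "0 \<le> p" "1 \<le> a" "0 \<le> q" "0 \<le> c" "c < 1"
    and le: "p\<^sup>2 \<le> (a - 1) * p + (q + c * p) * (a + p)"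
  shows "p \<le> 2 / (1 - c) * (a + q)"
proof (cases "p \<le> a")
  case True
  have "a + q \<le> 2 / (1 - c) * (a + q)"
  proof -
    have "1 \<le> 2 / (1 - c)" using assms by (simp add: field_simps)
    then show ?thesis using mult_right_mono[of 1 "2 / (1 - c)" "a + q"] assms by simp
  qed
  then show ?thesis using True assms by linarith
next
  case False
  then have p: "a < p" "0 < p" using assms by auto
  have "c * (a * p) \<le> a * p" using assms by (simp add: mult_left_le_one_le)
  moreover have "q * a \<le> q * p" using p assms by (intro mult_left_mono) auto
  ultimately have "(1 - c) * p\<^sup>2 \<le> 2 * (a + q) * p"
    using le p by (simp add: algebra_simps power2_eq_square)
  then have "((1 - c) * p) * p \<le> (2 * (a + q)) * p" by (simp add: power2_eq_square mult.assoc)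
  then have "(1 - c) * p \<le> 2 * (a + q)" using p(2) by (rule mult_right_le_imp_le)
  then show ?thesis using assms by (simp add: field_simps)
qed

text \<open>
  Comparing the inclusion at \<open>t\<close> with the minimal section at \<open>t - h\<close> and letting \<open>h\<close> tend to \<open>0\<close>
  bounds the derivative pointwise; only \<open>c < 1\<close> and the linear growth of the minimal section enter.
\<close>

lemma derivative_bound:
  fixes B :: "real \<Rightarrow> 'h::{real_inner, banach, second_countable_topology} \<Rightarrow> 'h \<Rightarrow> 'h set"
    and u u' g :: "real \<Rightarrow> 'h" and \<theta> \<theta>' :: "real \<Rightarrow> real"
  assumes b: "0 < b" and mm: "\<And>t u. t \<in> {0..b} \<Longrightarrow> maximal_monotone (B t u)"
    and \<theta>: "has_W12_derivative b \<theta> \<theta>'" and c: "0 \<le> c" "c < 1"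
    and dis: "\<And>t s u v. t \<in> {0..b} \<Longrightarrow> s \<in> {0..b} \<Longrightarrow>
      op_dis (B t u) (B s v) \<le> ereal (\<bar>\<theta> t - \<theta> s\<bar> + c * norm (u - v))"
    and M: "0 < M" "\<And>t u v. t \<in> {0..b} \<Longrightarrow> v \<in> op_dom (B t u) \<Longrightarrow>
      norm (minimal_section (B t u) v) \<le> M * (1 + norm u + norm v)"
    and u: "has_W12_derivative b u u'"
    and incl: "AE t in lebesgue_on {0..b}. - u' t + g t \<in> B t (u t) (u t)"
  shows "AE t in lebesgue_on {0..b}.
    norm (u' t) \<le> 2 / (1 - c) * (1 + 2 * M) * (1 + norm (g t) + norm (u t) + \<bar>\<theta>' t\<bar>)"
proof -
  \<comment> \<open>Differentiating the pair yields one sequence of steps that works for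
    \<open>u\<close> and \<open>\<theta>\<close> simultaneously.\<close>
  define v where "v t = (u' t, \<theta>' t)" for t
  have ui: "integrable (lebesgue_on {0..b}) u'" and \<theta>i: "integrable (lebesgue_on {0..b}) \<theta>'"
    using u \<theta> unfolding has_W12_derivative_def by (auto intro: L2_space_imp_integrable)
  have vi: "integrable (lebesgue_on {0..b}) v" unfolding v_def[abs_def]
  proof (rule Bochner_Integration.integrable_bound)
    show "integrable (lebesgue_on {0..b}) (\<lambda>t. norm (u' t) + norm (\<theta>' t))" using ui \<theta>i by simp
    show "(\<lambda>t. (u' t, \<theta>' t)) \<in> borel_measurable (lebesgue_on {0..b})" using ui \<theta>i by simp
    show "AE t in lebesgue_on {0..b}. norm (u' t, \<theta>' t) \<le> norm (norm (u' t) + norm (\<theta>' t))"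
      by (auto intro!: AE_I2 order_trans[OF norm_Pair_le])
  qed
  obtain r :: "nat \<Rightarrow> nat" where r: "strict_mono r"
    "AE t in lebesgue_on {0..b}. (\<lambda>n. backward_quotient v (r n) t) \<longlonglongrightarrow> v t"
    using AE_backward_quotient_subseq[OF b vi] by blast
  define h where "h n = 1 / real (Suc (r n))" for n
  have h0: "h n > 0" for n by (simp add: h_def)
  have "(\<lambda>n. 1 / real (Suc n)) \<longlonglongrightarrow> 0" by (rule LIMSEQ_Suc[OF lim_1_over_n])
  from LIMSEQ_subseq_LIMSEQ[OF this r(1)] have hlim: "h \<longlonglongrightarrow> 0" by (simp add: o_def h_def[abs_def])
  have ae: "AE t in lebesgue_on {0..b}. \<forall>n. t - h n \<in> {0..b} \<longrightarrow> - u' (t - h n) + g (t - h n) \<in> B (t - h n) (u (t - h n)) (u (t - h n))"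
    unfolding AE_all_countable using AE_lebesgue_on_translate[OF incl] by blast
  have uc: "continuous_on {0..b} u" by (rule has_W12_derivative_continuous_on[OF u])
  have sp: "AE t in lebesgue_on {0..b}. t \<noteq> 0" "AE t in lebesgue_on {0..b}. t \<in> {0..b}"
    using AE_lebesgue_on_neq AE_space[of "lebesgue_on {0..b}"] by auto
  show ?thesis using r(2) ae incl sp
  proof eventually_elim
    case (elim t)
    then have t: "0 < t" "t \<le> b" by auto
    define s where "s n = t - h n" for n
    have slim: "s \<longlonglongrightarrow> t" using tendsto_diff[OF tendsto_const hlim, of t] by (simp add: s_def[abs_def])
    have sb: "\<forall>\<^sub>F n in sequentially. s n \<in> {0..b}"
      using order_tendstoD(1)[OF slim t(1)] 
    proof eventually_elim
      case (elim n)
      then show ?case using t h0[of n] by (simp add: s_def)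
    qed
    define D where "D n = fst (backward_quotient v (r n) t)" for n
    define E where "E n = snd (backward_quotient v (r n) t)" for n
    have Dl: "D \<longlonglongrightarrow> u' t" and El: "E \<longlonglongrightarrow> \<theta>' t"
      using tendsto_fst[OF elim(1)] tendsto_snd[OF elim(1)] by (auto simp: D_def[abs_def] E_def[abs_def] v_def)
    have iv: "(\<integral>x. v x \<partial>lebesgue_on {0..d}) = (\<integral>x. u' x \<partial>lebesgue_on {0..d}, \<integral>x. \<theta>' x \<partial>lebesgue_on {0..d})" if "d \<le> b" for d
    proof -
      have "integrable (lebesgue_on {0..d}) v" using that by (intro integrable_lebesgue_on_subset[OF vi]) auto
      from integral_bounded_linear[OF bounded_linear_fst this] integral_bounded_linear[OF bounded_linear_snd this]
      moreover have "fst (v x) = u' x" "snd (v x) = \<theta>' x" for x by (simp_all add: v_def)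
      ultimately show ?thesis by (simp add: prod_eq_iff)
    qed
    have DE: "D n = real (Suc (r n)) *\<^sub>R (u t - u (s n))" "E n = real (Suc (r n)) * (\<theta> t - \<theta> (s n))"
      if "s n \<in> {0..b}" for n
    proof -
      have *: "t - 1 / real (Suc (r n)) = s n" by (simp add: s_def h_def)
      have "u t - u (s n) = (\<integral>x. u' x \<partial>lebesgue_on {0..t}) - (\<integral>x. u' x \<partial>lebesgue_on {0..s n})"
        using u that t unfolding has_W12_derivative_def by (metis add_diff_cancel_left atLeastAtMost_iff less_imp_le)
      moreover have "\<theta> t - \<theta> (s n) = (\<integral>x. \<theta>' x \<partial>lebesgue_on {0..t}) - (\<integral>x. \<theta>' x \<partial>lebesgue_on {0..s n})"
        using \<theta> that t unfolding has_W12_derivative_def by (metis add_diff_cancel_left atLeastAtMost_iff less_imp_le)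
      ultimately show "D n = real (Suc (r n)) *\<^sub>R (u t - u (s n))" "E n = real (Suc (r n)) * (\<theta> t - \<theta> (s n))"
        unfolding D_def E_def backward_quotient_def * using iv[of t] iv[of "s n"] that t by auto
    qed
    define y where "y = - u' t + g t"
    \<comment> \<open>Bounds the minimal section at the earlier time. The actual value
      \<open>- u' + g\<close> there has no bound as the step shrinks, whereas \<open>K n\<close>
      converges with \<open>u (s n)\<close>; the inclusion at \<open>s n\<close> serves only to
      place \<open>u (s n)\<close> in the domain.\<close>
    define K where "K n = M * (1 + 2 * norm (u (s n)))" for n
    have ineq: "- (y \<bullet> D n) - K n * norm (D n) \<le> (\<bar>E n\<bar> + c * norm (D n)) * (1 + norm y + K n)" if sn: "s n \<in> {0..b}" for n
    proof -
      define y0 where "y0 = minimal_section (B (s n) (u (s n))) (u (s n))"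
      have dom: "u (s n) \<in> op_dom (B (s n) (u (s n)))" using elim(2) sn by (auto simp: op_dom_def s_def)
      have y0: "y0 \<in> B (s n) (u (s n)) (u (s n))"
        unfolding y0_def by (rule minimal_section_mem[OF mm[OF sn] dom])
      have y0K: "norm y0 \<le> K n" using M(2)[OF sn dom] by (simp add: y0_def K_def add.commute)
      define N where "N = real (Suc (r n))"
      have N0: "0 < N" by (simp add: N_def)
      have "(y - y0) \<bullet> (u (s n) - u t) \<le> (\<bar>\<theta> t - \<theta> (s n)\<bar> + c * norm (u t - u (s n))) * (1 + norm y + norm y0)"
        using t sn elim(3) y0 by (intro op_dis_le_imp_inner_le[OF dis]) (auto simp: y_def)
      then have "N * ((y - y0) \<bullet> (u (s n) - u t)) \<le> N * ((\<bar>\<theta> t - \<theta> (s n)\<bar> + c * norm (u t - u (s n))) * (1 + norm y + norm y0))"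
        using N0 by (intro mult_left_mono) auto
      moreover have "N * ((y - y0) \<bullet> (u (s n) - u t)) = - ((y - y0) \<bullet> D n)"
      proof -
        have "D n = N *\<^sub>R (u t - u (s n))" using DE[OF sn] by (simp add: N_def)
        then show ?thesis by (simp only: inner_scaleR_right inner_diff_right) (simp add: algebra_simps)
      qed
      moreover have "N * \<bar>\<theta> t - \<theta> (s n)\<bar> = \<bar>E n\<bar>" "N * norm (u t - u (s n)) = norm (D n)"
        using DE[OF sn] by (simp_all add: N_def abs_mult)
      then have "N * ((\<bar>\<theta> t - \<theta> (s n)\<bar> + c * norm (u t - u (s n))) * (1 + norm y + norm y0)) = (\<bar>E n\<bar> + c * norm (D n)) * (1 + norm y + norm y0)"
        by (metis distrib_left mult.assoc mult.left_commute)
      ultimately have "- ((y - y0) \<bullet> D n) \<le> (\<bar>E n\<bar> + c * norm (D n)) * (1 + norm y + norm y0)" by simp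
      also have "\<dots> \<le> (\<bar>E n\<bar> + c * norm (D n)) * (1 + norm y + K n)"
        using y0K c by (intro mult_left_mono) auto
      finally have "- (y \<bullet> D n) + y0 \<bullet> D n \<le> (\<bar>E n\<bar> + c * norm (D n)) * (1 + norm y + K n)"
        by (simp add: inner_diff_left)
      moreover have "- (y0 \<bullet> D n) \<le> K n * norm (D n)"
        using norm_cauchy_schwarz[of "- y0" "D n"] mult_right_mono[OF y0K, of "norm (D n)"] by simp
      ultimately show ?thesis by linarith
    qed
    have ul: "(\<lambda>n. u (s n)) \<longlonglongrightarrow> u t"
      using t slim sb by (intro continuous_on_tendsto_compose[OF uc]) auto
    define k where "k = M * (1 + 2 * norm (u t))"
    have Kl: "K \<longlonglongrightarrow> k" unfolding K_def[abs_def] k_def by (intro tendsto_intros ul)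
    have "- (y \<bullet> u' t) - k * norm (u' t) \<le> (\<bar>\<theta>' t\<bar> + c * norm (u' t)) * (1 + norm y + k)"
    proof (rule tendsto_le[OF sequentially_bot])
      show "(\<lambda>n. (\<bar>E n\<bar> + c * norm (D n)) * (1 + norm y + K n)) \<longlonglongrightarrow> (\<bar>\<theta>' t\<bar> + c * norm (u' t)) * (1 + norm y + k)"
        by (intro tendsto_intros Dl El Kl)
      show "(\<lambda>n. - (y \<bullet> D n) - K n * norm (D n)) \<longlonglongrightarrow> - (y \<bullet> u' t) - k * norm (u' t)"
        by (intro tendsto_intros Dl El Kl)
      show "\<forall>\<^sub>F n in sequentially. - (y \<bullet> D n) - K n * norm (D n) \<le> (\<bar>E n\<bar> + c * norm (D n)) * (1 + norm y + K n)"
        using sb by eventually_elim (rule ineq)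
    qed
    moreover have "(norm (u' t))\<^sup>2 - norm (g t) * norm (u' t) \<le> - (y \<bullet> u' t)"
      using norm_cauchy_schwarz[of "g t" "u' t"] by (simp add: y_def inner_add_left inner_diff_left power2_norm_eq_inner)
    moreover have "(\<bar>\<theta>' t\<bar> + c * norm (u' t)) * (1 + norm y + k) \<le> (\<bar>\<theta>' t\<bar> + c * norm (u' t)) * (1 + norm (g t) + k + norm (u' t))"
      using norm_triangle_ineq4[of "g t" "u' t"] c by (intro mult_left_mono) (auto simp: y_def)
    \<comment> \<open>The square comes from \<open>y = - u' t + g t\<close>. This is the quadratic
      inequality with \<open>p = norm (u' t)\<close>, \<open>a = 1 + norm (g t) + k\<close> and
      \<open>q = \<bar>\<theta>' t\<bar>\<close>.\<close>
    ultimately have le: "(norm (u' t))\<^sup>2 \<le> ((1 + norm (g t) + k) - 1) * norm (u' t)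
        + (\<bar>\<theta>' t\<bar> + c * norm (u' t)) * ((1 + norm (g t) + k) + norm (u' t))"
      by (simp add: algebra_simps)
    have k0: "0 \<le> k" using M(1) by (simp add: k_def)
    have "norm (u' t) \<le> 2 / (1 - c) * ((1 + norm (g t) + k) + \<bar>\<theta>' t\<bar>)"
      using le c k0 by (intro quadratic_inequality_bound) auto
    also have "(1 + norm (g t) + k) + \<bar>\<theta>' t\<bar> \<le> (1 + 2 * M) * (1 + norm (g t) + norm (u t) + \<bar>\<theta>' t\<bar>)"
      using M(1) by (simp add: k_def algebra_simps)
    then have "2 / (1 - c) * ((1 + norm (g t) + k) + \<bar>\<theta>' t\<bar>) \<le> 2 / (1 - c) * ((1 + 2 * M) * (1 + norm (g t) + norm (u t) + \<bar>\<theta>' t\<bar>))"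
      using c by (intro mult_left_mono) auto
    finally show ?case by (simp only: mult.assoc)
  qed
qed

section \<open>The control system\<close>

lemma L2_space_add:
  assumes "f \<in> L2_space b" "g \<in> L2_space b"
  shows "(\<lambda>t. f t + g t) \<in> L2_space b"
proof -
  have [measurable]: "f \<in> borel_measurable (lebesgue_on {0..b})" "g \<in> borel_measurable (lebesgue_on {0..b})"
    using assms by (auto simp: L2_space_def)
  have "integrable (lebesgue_on {0..b}) (\<lambda>t. (norm (f t + g t))\<^sup>2)"
  proof (rule Bochner_Integration.integrable_bound)
    show "integrable (lebesgue_on {0..b}) (\<lambda>t. 2 * (norm (f t))\<^sup>2 + 2 * (norm (g t))\<^sup>2)"
      using assms by (simp add: L2_space_def)
    have "(norm (x + y))\<^sup>2 \<le> 2 * (norm x)\<^sup>2 + 2 * (norm y)\<^sup>2" for x y :: 'a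
      using zero_le_power2[of "norm (x - y)"] unfolding power2_norm_eq_inner
      by (simp add: inner_simps inner_commute)
    then show "AE t in lebesgue_on {0..b}. norm ((norm (f t + g t))\<^sup>2) \<le> norm (2 * (norm (f t))\<^sup>2 + 2 * (norm (g t))\<^sup>2)"
      by auto
  qed simp
  then show ?thesis by (simp add: L2_space_def)
qed

lemma L2_space_mult:
  fixes f :: "real \<Rightarrow> real"
  assumes "f \<in> L2_space b"
  shows "(\<lambda>t. c * f t) \<in> L2_space b"
  using assms by (auto simp: L2_space_def power_mult_distrib intro!: borel_measurable_times borel_measurable_const)

lemma L2_space_const: "(\<lambda>t. c) \<in> L2_space b"
proof -
  interpret finite_measure "lebesgue_on {0..b}" by (rule finite_measure_lebesgue_on_Icc)
  show ?thesis by (simp add: L2_space_def)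
qed

locale control_system =
  fixes b :: real
    and domA :: "'l::metric_space \<Rightarrow> 'e::{real_inner, banach, second_countable_topology} set"
    and A :: "'l \<Rightarrow> 'e \<Rightarrow> 'e"
    and T :: "'l \<Rightarrow> real \<Rightarrow> 'e \<Rightarrow>\<^sub>L 'e"
    and B :: "real \<Rightarrow> 'h::{real_inner, banach, second_countable_topology} \<Rightarrow> 'x::metric_space \<Rightarrow> 'h \<Rightarrow> 'h set"
    and F :: "real \<Rightarrow> 'e \<Rightarrow> 'h \<Rightarrow> 'l \<Rightarrow> 'e set"
    and G :: "real \<Rightarrow> 'e \<Rightarrow> 'h \<Rightarrow> 'x \<Rightarrow> 'h set"
    and W :: "real \<Rightarrow> 'y::{real_inner, banach, second_countable_topology} set"
    and \<B> :: "'y \<Rightarrow>\<^sub>L 'e"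
    and x\<^sub>0 :: "'l \<Rightarrow> 'e"
    and u\<^sub>0 :: "'x \<Rightarrow> 'h"
    and P :: "('l \<times> 'x) set"
  assumes b_pos: "0 < b"
    and B_maximal: "\<And>t u \<eta>. t \<in> {0..b} \<Longrightarrow> maximal_monotone (B t u \<eta>)"
    and hyp_A: "hyp_A b domA A T"
    and hyp_B: "hyp_B b B"
    and hyp_F: "hyp_F b F"
    and hyp_G: "hyp_G b G"
    and hyp_0: "hyp_0 x\<^sub>0 u\<^sub>0"
    and hyp_W: "hyp_W b W"
    and P_compact: "compact P"
begin

abbreviation I_meas :: "real measure" where "I_meas \<equiv> lebesgue_on {0..b}"

text \<open>A mild solution with its witnesses \<open>u'\<close>, \<open>f\<close>, \<open>g\<close>
  exposed, since the compactness argument works on sequences of these.\<close>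

definition trajectory where
  "trajectory \<zeta> \<eta> w x u u' f g \<longleftrightarrow>
     continuous_on {0..b} x \<and> u 0 = u\<^sub>0 \<eta> \<and> has_W12_derivative b u u' \<and>
     integrable I_meas f \<and> integrable I_meas g \<and>
     (AE t in I_meas. f t \<in> F t (x t) (u t) \<zeta> \<and> g t \<in> G t (x t) (u t) \<eta> \<and> - u' t + g t \<in> B t (u t) \<eta> (u t)) \<and>
     (\<forall>t\<in>{0..b}. x t = blinfun_apply (T \<zeta> t) (x\<^sub>0 \<zeta>) +
        (\<integral>s. blinfun_apply (T \<zeta> (t - s)) (f s + blinfun_apply \<B> (w s)) \<partial>lebesgue_on {0..t}))"

lemma mem_mild_solutions_iff:
  "(x, u) \<in> mild_solutions b T B F G \<B> x\<^sub>0 u\<^sub>0 \<zeta> \<eta> w \<longleftrightarrow> (\<exists>u' f g. trajectory \<zeta> \<eta> w x u u' f g)"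
  unfolding mild_solutions_def trajectory_def by blast

lemma bounded_params: "bounded P" "bounded (fst ` P)" "bounded (snd ` P)"
proof -
  show "bounded P" by (rule compact_imp_bounded[OF P_compact])
  then show "bounded (fst ` P)" "bounded (snd ` P)" by (simp_all add: bounded_fst bounded_snd)
qed

lemma semigroup: "C0_semigroup (T \<zeta>)"
proof -
  have "generates (domA \<zeta>) (A \<zeta>) (T \<zeta>)" using hyp_A unfolding hyp_A_def by (elim conjE allE)
  then show ?thesis unfolding generates_def by (elim conjE)
qed

lemma semigroup_bound:
  obtains M where "M > 0" "\<And>\<zeta> t. \<zeta> \<in> fst ` P \<Longrightarrow> t \<in> {0..b} \<Longrightarrow> norm (T \<zeta> t) \<le> M"
proof -
  have "\<forall>D. bounded D \<longrightarrow> (\<exists>M>0. \<forall>\<zeta>\<in>D. \<forall>t\<in>{0..b}. norm (T \<zeta> t) \<le> M)"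
    using hyp_A unfolding hyp_A_def by (elim conjE)
  from mp[OF spec[OF this] bounded_params(2)] obtain M
    where "0 < M" "\<forall>\<zeta>\<in>fst ` P. \<forall>t\<in>{0..b}. norm (T \<zeta> t) \<le> M" by (elim exE conjE)
  then show ?thesis by (intro that[of M]) auto
qed

lemma control_bound:
  obtains \<phi> where "\<phi> \<in> L2_space b" "\<And>t. t \<in> {0..b} \<Longrightarrow> 0 \<le> \<phi> t"
    "\<And>w. w \<in> admissible_controls b W \<Longrightarrow> AE t in I_meas. norm (w t) \<le> \<phi> t"
proof -
  obtain \<phi> where \<phi>: "\<phi> \<in> L2_space b" "\<forall>t\<in>{0..b}. 0 \<le> \<phi> t" "AE t in I_meas. set_norm (W t) \<le> ereal (\<phi> t)"
    using hyp_W unfolding hyp_W_def by blast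
  have "AE t in I_meas. norm (w t) \<le> \<phi> t" if "w \<in> admissible_controls b W" for w
  proof -
    have "AE t in I_meas. w t \<in> W t" using that by (simp add: admissible_controls_def)
    then show ?thesis using \<phi>(3) by eventually_elim (rule norm_le_set_norm)
  qed
  then show ?thesis using that \<phi> by blast
qed

lemma control_integrable:
  assumes "w \<in> admissible_controls b W"
  shows "integrable I_meas (\<lambda>s. blinfun_apply \<B> (w s))"
proof -
  have "integrable I_meas w" using assms by (auto simp: admissible_controls_def intro: L2_space_imp_integrable)
  then show ?thesis by (rule integrable_bounded_linear[OF blinfun.bounded_linear_right])
qed

lemma F_growth:
  obtains M where "M > 0" "AE t in I_meas. \<forall>x u. \<forall>\<zeta>\<in>fst ` P. set_norm (F t x u \<zeta>) \<le> ereal (M * (1 + norm x + norm u))"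
proof -
  have "\<forall>D. bounded D \<longrightarrow> (\<exists>M>0. AE t in I_meas. \<forall>x u. \<forall>\<zeta>\<in>D.
        set_norm (F t x u \<zeta>) \<le> ereal (M * (1 + norm x + norm u)))"
    using hyp_F unfolding hyp_F_def by (elim conjE)
  from mp[OF spec[OF this] bounded_params(2)] show ?thesis using that by (elim exE conjE)
qed

lemma G_growth:
  obtains M where "M > 0" "AE t in I_meas. \<forall>x u. \<forall>\<eta>\<in>snd ` P. set_norm (G t x u \<eta>) \<le> ereal (M * (1 + norm x + norm u))"
proof -
  have "\<forall>D. bounded D \<longrightarrow> (\<exists>M>0. AE t in I_meas. \<forall>x u. \<forall>\<eta>\<in>D.
        set_norm (G t x u \<eta>) \<le> ereal (M * (1 + norm x + norm u)))"
    using hyp_G unfolding hyp_G_def by (elim conjE)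
  from mp[OF spec[OF this] bounded_params(3)] show ?thesis using that by (elim exE conjE)
qed

text \<open>The pointwise bound with constants independent of \<eta>: both operators compared carry
  the same \<eta>, so the parameter term in the distance estimate vanishes.\<close>

lemma derivative_growth:
  obtains C \<theta>' where "0 < C" "\<theta>' \<in> L2_space b"
    "\<And>\<eta> u u' g. has_W12_derivative b u u' \<Longrightarrow> AE t in I_meas. - u' t + g t \<in> B t (u t) \<eta> (u t) \<Longrightarrow>
       AE t in I_meas. norm (u' t) \<le> C * (1 + norm (g t) + norm (u t) + \<bar>\<theta>' t :: real\<bar>)"
proof -
  obtain \<theta> c c' where \<theta>: "\<theta> \<in> W12_space b" and c: "0 \<le> c" "c < 1" "0 < c'"
    and dis: "\<And>t s u v \<eta>\<^sub>1 \<eta>\<^sub>2. t \<in> {0..b} \<Longrightarrow> s \<in> {0..b} \<Longrightarrow> op_dis (B t u \<eta>\<^sub>1) (B s v \<eta>\<^sub>2)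
             \<le> ereal (\<bar>\<theta> t - \<theta> s :: real\<bar> + c * norm (u - v) + c' * dist \<eta>\<^sub>1 \<eta>\<^sub>2)"
    using conjunct1[OF hyp_B[unfolded hyp_B_def]] by blast
  obtain \<theta>' where \<theta>': "has_W12_derivative b \<theta> \<theta>'" using \<theta> by (auto simp: W12_space_def)
  obtain M where M: "M > 0" "\<And>t u \<eta> v. t \<in> {0..b} \<Longrightarrow> v \<in> op_dom (B t u \<eta>) \<Longrightarrow>
        norm (minimal_section (B t u \<eta>) v) \<le> M * (1 + norm u + norm v)"
    using conjunct1[OF conjunct2[OF hyp_B[unfolded hyp_B_def]]] by blast
  show ?thesis
  proof (rule that[of "2 / (1 - c) * (1 + 2 * M)" \<theta>'])
    show "0 < 2 / (1 - c) * (1 + 2 * M)" using c M by simp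
    show "\<theta>' \<in> L2_space b" using \<theta>' by (simp add: has_W12_derivative_def)
    fix \<eta> u u' g assume u: "has_W12_derivative b u u'" "AE t in I_meas. - u' t + g t \<in> B t (u t) \<eta> (u t)"
    have "op_dis (B t u \<eta>) (B s v \<eta>) \<le> ereal (\<bar>\<theta> t - \<theta> s\<bar> + c * norm (u - v))"
      if "t \<in> {0..b}" "s \<in> {0..b}" for t s u v using dis[OF that, of u \<eta> v \<eta>] by simp
    then show "AE t in I_meas. norm (u' t) \<le> 2 / (1 - c) * (1 + 2 * M) * (1 + norm (g t) + norm (u t) + \<bar>\<theta>' t\<bar>)"
      by (intro derivative_bound[where B = "\<lambda>t u. B t u \<eta>" and \<theta> = \<theta>] b_pos B_maximal \<theta>' c M u)
  qed
qed

text \<open>The derivative estimate makes the growth of \<open>u\<close> linear in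
  \<open>y = norm x + norm u\<close>, as the mild formula does for \<open>x\<close>, so Gronwall's
  inequality applies to the sum. The resulting \<open>R\<close> turns all pointwise estimates into
  one square integrable majorant \<open>\<psi>\<close>.\<close>

lemma uniform_bounds:
  obtains R \<psi> where "0 < R" "\<psi> \<in> L2_space b" "\<And>t. t \<in> {0..b} \<Longrightarrow> 0 \<le> \<psi> t"
    "\<And>\<zeta> \<eta> w x u u' f g. (\<zeta>, \<eta>) \<in> P \<Longrightarrow> w \<in> admissible_controls b W \<Longrightarrow> trajectory \<zeta> \<eta> w x u u' f g \<Longrightarrow>
       (\<forall>t\<in>{0..b}. norm (x t) \<le> R \<and> norm (u t) \<le> R) \<and>
       (AE t in I_meas. norm (w t) \<le> \<psi> t \<and> norm (f t) \<le> \<psi> t \<and> norm (g t) \<le> \<psi> t \<and> norm (u' t) \<le> \<psi> t \<and>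
          norm (f t + blinfun_apply \<B> (w t)) \<le> \<psi> t)"
proof -
  obtain MT where MT: "MT > 0" "\<And>\<zeta> t. \<zeta> \<in> fst ` P \<Longrightarrow> t \<in> {0..b} \<Longrightarrow> norm (T \<zeta> t) \<le> MT"
    using semigroup_bound by blast
  obtain \<phi> where \<phi>: "\<phi> \<in> L2_space b" "\<And>t. t \<in> {0..b} \<Longrightarrow> 0 \<le> \<phi> t"
    "\<And>w. w \<in> admissible_controls b W \<Longrightarrow> AE t in I_meas. norm (w t) \<le> \<phi> t" using control_bound by blast
  obtain MF where MF: "MF > 0" "AE t in I_meas. \<forall>x u. \<forall>\<zeta>\<in>fst ` P. set_norm (F t x u \<zeta>) \<le> ereal (MF * (1 + norm x + norm u))"
    by (rule F_growth)
  obtain MG where MG: "MG > 0" "AE t in I_meas. \<forall>x u. \<forall>\<eta>\<in>snd ` P. set_norm (G t x u \<eta>) \<le> ereal (MG * (1 + norm x + norm u))"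
    by (rule G_growth)
  obtain C \<theta>' where C: "0 < C" "\<theta>' \<in> L2_space b"
    "\<And>\<eta> u u' g. has_W12_derivative b u u' \<Longrightarrow> AE t in I_meas. - u' t + g t \<in> B t (u t) \<eta> (u t) \<Longrightarrow>
       AE t in I_meas. norm (u' t) \<le> C * (1 + norm (g t) + norm (u t) + \<bar>\<theta>' t :: real\<bar>)"
    using derivative_growth by blast
  obtain M0 where M0: "M0 > 0" "\<forall>(\<zeta>, \<eta>)\<in>P. max (norm (x\<^sub>0 \<zeta>)) (norm (u\<^sub>0 \<eta>)) \<le> M0"
    using hyp_0 bounded_params(1) unfolding hyp_0_def by meson
  define nB where "nB = norm \<B>"
  have nB: "0 \<le> nB" by (simp add: nB_def)
  \<comment> \<open>Inserting \<open>norm (g t) \<le> MG * (1 + y t)\<close> into the derivative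
    bound costs the factor \<open>1 + MG\<close>.\<close>
  define C' where "C' = C * (1 + MG)"
  have C': "0 < C'" using C MG by (simp add: C'_def)
  define K where "K = MT * MF + C'"
  have K: "0 < K" using MT MF C' by (simp add: K_def add_pos_pos)
  define q where "q t = \<bar>\<theta>' t\<bar>" for t
  have qL2: "q \<in> L2_space b" using C(2) by (auto simp: L2_space_def q_def[abs_def])
  \<comment> \<open>Collects the part of the two integrands that is free of \<open>y\<close>; what
    remains is \<open>K * y\<close>.\<close>
  define a where "a t = MT * (MF + nB * \<phi> t) + C' * (1 + q t)" for t
  interpret finite_measure I_meas by (rule finite_measure_lebesgue_on_Icc)
  have qi: "integrable I_meas q" and \<phi>i: "integrable I_meas \<phi>"
    using qL2 \<phi>(1) by (auto intro: L2_space_imp_integrable)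
  have ai: "integrable I_meas a" unfolding a_def[abs_def] using qi \<phi>i by simp
  have a0: "0 \<le> a t" if "t \<in> {0..b}" for t
    unfolding a_def using MT MF nB C' \<phi>(2)[OF that] by (simp add: q_def)
  define a' where "a' = MT * M0 + M0 + (\<integral>t. a t \<partial>I_meas)"
  have int0: "0 \<le> (\<integral>t. a t \<partial>I_meas)" by (rule Bochner_Integration.integral_nonneg) (use a0 in auto)
  have a'0: "0 \<le> a'" unfolding a'_def using int0 MT M0 by simp
  define R where "R = 2 * a' * exp (2 * K * b) + 1"
  have R0: "0 < R" unfolding R_def using a'0 by (simp add: add_nonneg_pos)
  define \<psi> where "\<psi> t = (MF + MG + C') * (1 + R) + (1 + nB) * \<phi> t + C' * q t" for t
  show ?thesis
  proof (rule that[of R \<psi>])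
    show "0 < R" by (rule R0)
    show "\<psi> \<in> L2_space b" unfolding \<psi>_def[abs_def]
      by (intro L2_space_add L2_space_mult L2_space_const \<phi>(1) qL2)
    show "0 \<le> \<psi> t" if "t \<in> {0..b}" for t
      unfolding \<psi>_def using MF MG C' R0 nB \<phi>(2)[OF that] by (simp add: q_def)
    fix \<zeta> \<eta> w x u u' f g
    assume p: "(\<zeta>, \<eta>) \<in> P" and w: "w \<in> admissible_controls b W" and tr: "trajectory \<zeta> \<eta> w x u u' f g"
    have \<zeta>: "\<zeta> \<in> fst ` P" and \<eta>: "\<eta> \<in> snd ` P" using p by force+
    have x0: "norm (x\<^sub>0 \<zeta>) \<le> M0" "norm (u\<^sub>0 \<eta>) \<le> M0" using M0 p by auto
    have xc: "continuous_on {0..b} x" and u0: "u 0 = u\<^sub>0 \<eta>" and u: "has_W12_derivative b u u'"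
      and fi: "integrable I_meas f" and gi: "integrable I_meas g"
      and ae: "AE t in I_meas. f t \<in> F t (x t) (u t) \<zeta> \<and> g t \<in> G t (x t) (u t) \<eta> \<and> - u' t + g t \<in> B t (u t) \<eta> (u t)"
      and xe: "\<And>t. t \<in> {0..b} \<Longrightarrow> x t = blinfun_apply (T \<zeta> t) (x\<^sub>0 \<zeta>) +
        (\<integral>s. blinfun_apply (T \<zeta> (t - s)) (f s + blinfun_apply \<B> (w s)) \<partial>lebesgue_on {0..t})"
      using tr unfolding trajectory_def by blast+
    have ui: "integrable I_meas u'" using u by (auto simp: has_W12_derivative_def intro: L2_space_imp_integrable)
    have uc: "continuous_on {0..b} u" by (rule has_W12_derivative_continuous_on[OF u])
    define y where "y t = norm (x t) + norm (u t)" for t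
    have yc: "continuous_on {0..b} y" unfolding y_def[abs_def] using xc uc by (intro continuous_intros)
    have yi: "integrable I_meas y" using yc by (rule integrable_continuous_Icc)
    have y0: "0 \<le> y t" for t by (simp add: y_def)
    have "AE t in I_meas. - u' t + g t \<in> B t (u t) \<eta> (u t)" using ae by eventually_elim blast
    from C(3)[OF u this] have u'ae: "AE t in I_meas. norm (u' t) \<le> C * (1 + norm (g t) + norm (u t) + q t)"
      by (simp add: q_def)
    have all: "AE t in I_meas. norm (w t) \<le> \<phi> t \<and> norm (f t) \<le> MF * (1 + y t) \<and> norm (g t) \<le> MG * (1 + y t)
        \<and> norm (u' t) \<le> C' * (1 + y t + q t) \<and> norm (f t + blinfun_apply \<B> (w t)) \<le> MF * (1 + y t) + nB * \<phi> t"
      using \<phi>(3)[OF w] MF(2) MG(2) ae u'ae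
    proof eventually_elim
      case (elim t)
      have f: "norm (f t) \<le> MF * (1 + y t)" and g: "norm (g t) \<le> MG * (1 + y t)"
        using elim \<zeta> \<eta> norm_le_set_norm unfolding y_def by (metis add.assoc)+
      have "norm (u' t) \<le> C * (1 + norm (g t) + norm (u t) + q t)" by (rule elim)
      also have "\<dots> \<le> C * ((1 + MG) * (1 + y t + q t))"
      proof (rule mult_left_mono)
        have "norm (u t) \<le> y t" by (simp add: y_def)
        moreover have "0 \<le> MG * q t" using MG by (simp add: q_def)
        ultimately show "1 + norm (g t) + norm (u t) + q t \<le> (1 + MG) * (1 + y t + q t)"
          using g by (simp add: algebra_simps)
      qed (use C in simp)
      finally have u': "norm (u' t) \<le> C' * (1 + y t + q t)" by (simp add: C'_def mult.assoc)
      have "norm (blinfun_apply \<B> (w t)) \<le> nB * norm (w t)" unfolding nB_def by (rule norm_blinfun)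
      also have "\<dots> \<le> nB * \<phi> t" using elim(1) nB by (rule mult_left_mono)
      finally have "norm (f t + blinfun_apply \<B> (w t)) \<le> MF * (1 + y t) + nB * \<phi> t"
        using f norm_triangle_ineq[of "f t" "blinfun_apply \<B> (w t)"] by linarith
      then show ?case using elim(1) f g u' by blast
    qed
    have hi: "integrable I_meas (\<lambda>s. f s + blinfun_apply \<B> (w s))" using fi control_integrable[OF w] by simp
    have yR: "y t \<le> R" if t: "t \<in> {0..b}" for t
    proof -
      have "y t \<le> a' + K * (\<integral>s. y s \<partial>lebesgue_on {0..t})" if t: "t \<in> {0..b}" for t
      proof -
        have sub: "integrable (lebesgue_on {0..t}) z" if "integrable I_meas z" for z :: "real \<Rightarrow> real"
          using t by (intro integrable_lebesgue_on_subset[OF that]) auto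
        note subs = sub[OF yi] sub[OF qi] sub[OF \<phi>i] sub[OF ai]
        interpret ft: finite_measure "lebesgue_on {0..t}" by (rule finite_measure_lebesgue_on_Icc)
        have "norm (\<integral>s. blinfun_apply (T \<zeta> (t - s)) (f s + blinfun_apply \<B> (w s)) \<partial>lebesgue_on {0..t})
            \<le> MT * (\<integral>s. MF * (1 + y s) + nB * \<phi> s \<partial>lebesgue_on {0..t})"
        proof (rule mild_integral_bound[where b = b])
          show "C0_semigroup (T \<zeta>)" by (rule semigroup)
          show "norm (T \<zeta> t) \<le> MT" if "t \<in> {0..b}" for t using MT(2)[OF \<zeta> that] .
          show "integrable I_meas (\<lambda>s. MF * (1 + y s) + nB * \<phi> s)" using yi \<phi>i by simp
          show "AE r in I_meas. norm (f r + blinfun_apply \<B> (w r)) \<le> MF * (1 + y r) + nB * \<phi> r"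
            using all by eventually_elim blast
        qed (use hi t in auto)
        moreover have "norm (blinfun_apply (T \<zeta> t) (x\<^sub>0 \<zeta>)) \<le> MT * M0"
          using MT(2)[OF \<zeta> t] x0 MT(1) by (intro order_trans[OF norm_blinfun] mult_mono) auto
        ultimately have xb: "norm (x t) \<le> MT * M0 + MT * (\<integral>s. MF * (1 + y s) + nB * \<phi> s \<partial>lebesgue_on {0..t})"
          using xe[OF t] norm_triangle_ineq[of "blinfun_apply (T \<zeta> t) (x\<^sub>0 \<zeta>)"] by (smt (verit))
        have "norm (\<integral>s. u' s \<partial>lebesgue_on {0..t}) \<le> (\<integral>s. C' * (1 + y s + q s) \<partial>lebesgue_on {0..t})"
        proof (rule integral_norm_le_AE)
          show "integrable (lebesgue_on {0..t}) u'" using t by (intro integrable_lebesgue_on_subset[OF ui]) auto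
          show "integrable (lebesgue_on {0..t}) (\<lambda>s. C' * (1 + y s + q s))" using subs by simp
          have "AE s in I_meas. norm (u' s) \<le> C' * (1 + y s + q s)" using all by eventually_elim blast
          then show "AE s in lebesgue_on {0..t}. norm (u' s) \<le> C' * (1 + y s + q s)"
            by (rule AE_lebesgue_on_subset) (use t in auto)
        qed
        moreover have "u t = u\<^sub>0 \<eta> + (\<integral>s. u' s \<partial>lebesgue_on {0..t})"
          using u t u0 unfolding has_W12_derivative_def by metis
        ultimately have ub: "norm (u t) \<le> M0 + (\<integral>s. C' * (1 + y s + q s) \<partial>lebesgue_on {0..t})"
          using x0(2) norm_triangle_ineq[of "u\<^sub>0 \<eta>" "\<integral>s. u' s \<partial>lebesgue_on {0..t}"] by simp
        have "MT * (\<integral>s. MF * (1 + y s) + nB * \<phi> s \<partial>lebesgue_on {0..t}) + (\<integral>s. C' * (1 + y s + q s) \<partial>lebesgue_on {0..t})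
           = (\<integral>s. MT * (MF * (1 + y s) + nB * \<phi> s) + C' * (1 + y s + q s) \<partial>lebesgue_on {0..t})"
          using subs by simp
        also have "\<dots> = (\<integral>s. a s + K * y s \<partial>lebesgue_on {0..t})"
          by (rule arg_cong[where f = "integral\<^sup>L _"]) (auto simp: a_def K_def algebra_simps)
        also have "\<dots> = (\<integral>s. a s \<partial>lebesgue_on {0..t}) + K * (\<integral>s. y s \<partial>lebesgue_on {0..t})"
          using subs by simp
        finally have "y t \<le> MT * M0 + M0 + (\<integral>s. a s \<partial>lebesgue_on {0..t}) + K * (\<integral>s. y s \<partial>lebesgue_on {0..t})"
          using xb ub unfolding y_def[of t] by linarith
        moreover have "(\<integral>s. a s \<partial>lebesgue_on {0..t}) \<le> (\<integral>s. a s \<partial>I_meas)"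
          using t a0 by (intro integral_lebesgue_on_subset_mono ai) auto
        ultimately show ?thesis by (simp add: a'_def)
      qed
      then have "y t \<le> 2 * a' * exp (2 * K * b)"
        using b_pos K a'0 yc t by (intro Gronwall_sup_bound) auto
      then show ?thesis by (simp add: R_def)
    qed
    have "AE t in I_meas. norm (w t) \<le> \<psi> t \<and> norm (f t) \<le> \<psi> t \<and> norm (g t) \<le> \<psi> t \<and> norm (u' t) \<le> \<psi> t \<and>
          norm (f t + blinfun_apply \<B> (w t)) \<le> \<psi> t"
      using all AE_space
    proof eventually_elim
      case (elim t)
      then have t: "t \<in> {0..b}" by simp
      have pos: "0 \<le> MF * (1 + R)" "0 \<le> MG * (1 + R)" "0 \<le> C' * (1 + R)" "0 \<le> \<phi> t" "0 \<le> nB * \<phi> t" "0 \<le> C' * q t"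
        using MF MG C' R0 \<phi>(2)[OF t] nB by (auto simp: q_def)
      have "MF * (1 + y t) \<le> MF * (1 + R)" "MG * (1 + y t) \<le> MG * (1 + R)" "C' * (1 + y t + q t) \<le> C' * (1 + R) + C' * q t"
        using MF MG C' yR[OF t] by (auto simp: algebra_simps)
      moreover have "\<psi> t = MF * (1 + R) + MG * (1 + R) + C' * (1 + R) + \<phi> t + nB * \<phi> t + C' * q t"
        by (simp add: \<psi>_def algebra_simps)
      ultimately show ?case using elim(1) pos by (smt (verit))
    qed
    moreover have "norm (x t) \<le> R \<and> norm (u t) \<le> R" if "t \<in> {0..b}" for t
      using yR[OF that] norm_ge_zero[of "x t"] norm_ge_zero[of "u t"] unfolding y_def by linarith
    ultimately show "(\<forall>t\<in>{0..b}. norm (x t) \<le> R \<and> norm (u t) \<le> R) \<and>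
       (AE t in I_meas. norm (w t) \<le> \<psi> t \<and> norm (f t) \<le> \<psi> t \<and> norm (g t) \<le> \<psi> t \<and> norm (u' t) \<le> \<psi> t \<and>
          norm (f t + blinfun_apply \<B> (w t)) \<le> \<psi> t)" by blast
  qed
qed

end

section \<open>Pointwise convergent subsequences\<close>

lemma diagonal_convergent_subseq:
  fixes y :: "'q \<Rightarrow> nat \<Rightarrow> 'a::metric_space"
  assumes "countable Q" and K: "\<And>q. q \<in> Q \<Longrightarrow> compact (K q)" "\<And>q n. q \<in> Q \<Longrightarrow> y q n \<in> K q"
  obtains r :: "nat \<Rightarrow> nat" where "strict_mono r" "\<And>q. q \<in> Q \<Longrightarrow> convergent (\<lambda>n. y q (r n))"
proof (cases "Q = {}")
  case True
  then show ?thesis using that[of id] by (auto simp: strict_mono_def)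
next
  case False
  define e where "e = from_nat_into Q"
  have eQ: "e k \<in> Q" for k using False by (simp add: e_def from_nat_into)
  interpret subseqs "\<lambda>k s. convergent (\<lambda>n. y (e k) (s n))"
  proof
    fix k and s :: "nat \<Rightarrow> nat" assume "strict_mono s"
    have "seq_compact (K (e k))" using K(1)[OF eQ] by (rule compact_imp_seq_compact)
    moreover have "\<forall>n. y (e k) (s n) \<in> K (e k)" using K(2)[OF eQ] by blast
    ultimately obtain l r where "strict_mono r" "((\<lambda>n. y (e k) (s n)) \<circ> r) \<longlonglongrightarrow> l"
      by (elim seq_compactE) auto
    then show "\<exists>r'. strict_mono r' \<and> convergent (\<lambda>n. y (e k) ((s \<circ> r') n))"
      by (auto simp: convergent_def o_def)
  qed
  have "convergent (\<lambda>n. y (e k) (diagseq n))" for k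
  proof -
    have "convergent (\<lambda>n. y (e k) ((diagseq \<circ> ((+) (Suc k))) n))"
    proof (rule diagseq_holds)
      fix r s :: "nat \<Rightarrow> nat" and k assume "strict_mono r" "convergent (\<lambda>n. y (e k) (s n))"
      then show "convergent (\<lambda>n. y (e k) ((s \<circ> r) n))"
        using convergent_subseq_convergent[of "\<lambda>n. y (e k) (s n)" r] by (simp add: o_def)
    qed
    then have "convergent (\<lambda>n. y (e k) (diagseq (n + Suc k)))" by (simp add: add.commute)
    then show ?thesis using convergent_ignore_initial_segment[of "\<lambda>n. y (e k) (diagseq n)" "Suc k"] by blast
  qed
  moreover have "\<exists>k. q = e k" if "q \<in> Q" for q
    using from_nat_into_surj[OF assms(1) that] unfolding e_def by metis
  ultimately show ?thesis using that[of diagseq] subseq_diagseq by metis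
qed

text \<open>Carries convergence from rational times to all times: the comparison sequence may depend
  on the tolerance, but the error must be uniform in \<open>n\<close>.\<close>

lemma Cauchy_if_approximable:
  fixes y :: "nat \<Rightarrow> 'a::real_normed_vector"
  assumes "\<And>e. 0 < e \<Longrightarrow> \<exists>c. Cauchy c \<and> (\<forall>n. norm (y n - c n) \<le> e)"
  shows "Cauchy y"
proof (rule CauchyI)
  fix e :: real assume "0 < e"
  then obtain c where c: "Cauchy c" "\<And>n. norm (y n - c n) \<le> e / 4" using assms[of "e / 4"] by auto
  obtain N where N: "\<And>m n. N \<le> m \<Longrightarrow> N \<le> n \<Longrightarrow> norm (c m - c n) < e / 4"
    using CauchyD[OF c(1), of "e / 4"] \<open>0 < e\<close> by auto
  have "norm (y m - y n) < e" if "N \<le> m" "N \<le> n" for m n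
  proof -
    have "y m - y n = (y m - c m) + (c m - c n) - (y n - c n)" by simp
    also have "norm \<dots> \<le> norm ((y m - c m) + (c m - c n)) + norm (y n - c n)" by (rule norm_triangle_ineq4)
    finally show ?thesis
      using norm_triangle_ineq[of "y m - c m" "c m - c n"] c(2)[of m] c(2)[of n] N[OF that] \<open>0 < e\<close> by linarith
  qed
  then show "\<exists>M. \<forall>m\<ge>M. \<forall>n\<ge>M. norm (y m - y n) < e" by blast
qed

text \<open>Continuity of the indefinite integral at \<open>t\<close>; the restart time is taken
  rational so that it belongs to the countable set of the diagonal argument.\<close>

lemma small_integral_near_endpoint:
  fixes \<psi> :: "real \<Rightarrow> real"
  assumes \<psi>: "integrable (lebesgue_on {0..b}) \<psi>" and t: "0 < t" "t \<le> b" and e: "0 < e"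
  obtains s where "s \<in> \<rat>" "0 < s" "s < t" "\<bar>\<integral>r. \<psi> r \<partial>lebesgue_on {s..t}\<bar> < e"
proof -
  define \<Psi> where "\<Psi> s = (\<integral>r. \<psi> r \<partial>lebesgue_on {0..s})" for s
  have "continuous_on {..b} \<Psi>" unfolding \<Psi>_def[abs_def] by (rule continuous_on_indefinite_integral[OF \<psi>])
  then obtain d where d: "0 < d" "\<And>s. s \<in> {..b} \<Longrightarrow> dist s t < d \<Longrightarrow> dist (\<Psi> s) (\<Psi> t) < e"
    using t e unfolding continuous_on_iff by (metis atMost_iff)
  obtain s where s: "s \<in> \<rat>" "max 0 (t - d) < s" "s < t"
    using Rats_dense_in_real[of "max 0 (t - d)" t] t d by auto
  have "integrable (lebesgue_on {0..t}) \<psi>" using t by (intro integrable_lebesgue_on_subset[OF \<psi>]) auto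
  from integral_lebesgue_on_split[OF this, of s] have "(\<integral>r. \<psi> r \<partial>lebesgue_on {s..t}) = \<Psi> t - \<Psi> s"
    using s by (simp add: \<Psi>_def)
  moreover have "dist (\<Psi> s) (\<Psi> t) < e" using s t by (intro d) (auto simp: dist_real_def)
  ultimately show ?thesis using that[of s] s by (simp add: dist_real_def abs_minus_commute)
qed

text \<open>By continuity, leaving a closed set at one time means leaving it on a nondegenerate
  interval, which is not null.\<close>

lemma AE_mem_closed_imp_mem:
  fixes u :: "real \<Rightarrow> 'a::metric_space"
  assumes "continuous_on {0..b} u" "0 < b" "closed K" "AE t in lebesgue_on {0..b}. u t \<in> K" "t \<in> {0..b}"
  shows "u t \<in> K"
proof (rule ccontr)
  assume "u t \<notin> K"
  have "AE t in lebesgue. t \<in> {0..b} \<longrightarrow> u t \<in> K" using assms(4) by (simp add: AE_restrict_space_iff)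
  then obtain N where N: "negligible N" "{t. \<not> (t \<in> {0..b} \<longrightarrow> u t \<in> K)} \<subseteq> N"
    unfolding eventually_ae_filter_negligible by blast
  obtain e where e: "0 < e" "ball (u t) e \<subseteq> - K"
    using assms(3) \<open>u t \<notin> K\<close> by (metis ComplI closed_def open_contains_ball)
  obtain d where d: "0 < d" "\<And>s. s \<in> {0..b} \<Longrightarrow> dist s t < d \<Longrightarrow> dist (u s) (u t) < e"
    using assms(1,5) e(1) unfolding continuous_on_iff by metis
  have "box (max 0 (t - d)) (min b (t + d)) \<subseteq> N"
  proof
    fix s assume "s \<in> box (max 0 (t - d)) (min b (t + d))"
    then have s: "s \<in> {0..b}" "dist s t < d" by (auto simp: dist_real_def)
    then have "u s \<in> ball (u t) e" using d(2)[OF s] by (simp add: dist_commute)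
    then have "u s \<notin> K" using e(2) by blast
    then show "s \<in> N" using s N(2) by blast
  qed
  then have "negligible (box (max 0 (t - d)) (min b (t + d)))" using N(1) negligible_subset by blast
  then have "box (max 0 (t - d)) (min b (t + d)) = {}" by (simp only: negligible_interval)
  moreover have "max 0 (t - d) < min b (t + d)" using assms(2,5) d(1) by auto
  ultimately show False by simp
qed

context control_system
begin

lemma semigroup_strong_convergence:
  assumes "\<zeta> \<longlonglongrightarrow> \<zeta>l" "range \<zeta> \<subseteq> fst ` P" "t \<in> {0..b}" "y \<longlonglongrightarrow> yl"
  shows "(\<lambda>n. blinfun_apply (T (\<zeta> n) t) (y n)) \<longlonglongrightarrow> blinfun_apply (T \<zeta>l t) yl"
proof -
  obtain M where M: "M > 0" "\<And>\<zeta> t. \<zeta> \<in> fst ` P \<Longrightarrow> t \<in> {0..b} \<Longrightarrow> norm (T \<zeta> t) \<le> M"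
    using semigroup_bound by blast
  have "uniform_limit {0..b} (\<lambda>n t. blinfun_apply (T (\<zeta> n) t) yl) (\<lambda>t. blinfun_apply (T \<zeta>l t) yl) sequentially"
    using hyp_A assms(1) unfolding hyp_A_def by (elim conjE) simp
  then have 1: "(\<lambda>n. blinfun_apply (T (\<zeta> n) t) yl) \<longlonglongrightarrow> blinfun_apply (T \<zeta>l t) yl"
    using assms(3) by (rule tendsto_uniform_limitI)
  have 2: "(\<lambda>n. blinfun_apply (T (\<zeta> n) t) (y n - yl)) \<longlonglongrightarrow> 0"
  proof (rule Lim_null_comparison)
    show "\<forall>\<^sub>F n in sequentially. norm (blinfun_apply (T (\<zeta> n) t) (y n - yl)) \<le> M * norm (y n - yl)"
      using assms(2,3) M(2)
      by (intro always_eventually allI order_trans[OF norm_blinfun] mult_right_mono) auto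
    have "(\<lambda>n. M * norm (y n - yl)) \<longlonglongrightarrow> M * norm (yl - yl)" using assms(4) by (intro tendsto_intros)
    then show "(\<lambda>n. M * norm (y n - yl)) \<longlonglongrightarrow> 0" by simp
  qed
  show ?thesis using tendsto_add[OF 2 1] by (simp add: blinfun.diff_right)
qed

lemma semigroup_norm_convergence:
  assumes "\<zeta> \<longlonglongrightarrow> \<zeta>l" "0 < \<delta>" "\<delta> < b" "0 < e"
  shows "\<forall>\<^sub>F n in sequentially. \<forall>t\<in>{\<delta>..b}. norm (T (\<zeta> n) t - T \<zeta>l t) < e"
proof -
  have "uniform_limit {\<delta>..b} (\<lambda>n t. T (\<zeta> n) t) (\<lambda>t. T \<zeta>l t) sequentially"
    using hyp_A assms(1-3) unfolding hyp_A_def by (elim conjE) simp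
  from uniform_limitD[OF this assms(4)] show ?thesis by (simp add: dist_norm)
qed

lemma trajectoryD:
  assumes "trajectory \<zeta> \<eta> w x u u' f g"
  shows "continuous_on {0..b} x" "u 0 = u\<^sub>0 \<eta>" "has_W12_derivative b u u'" "integrable I_meas f" "integrable I_meas g"
    "AE t in I_meas. f t \<in> F t (x t) (u t) \<zeta>" "AE t in I_meas. g t \<in> G t (x t) (u t) \<eta>"
    "AE t in I_meas. - u' t + g t \<in> B t (u t) \<eta> (u t)"
    "\<And>t. t \<in> {0..b} \<Longrightarrow> x t = blinfun_apply (T \<zeta> t) (x\<^sub>0 \<zeta>) +
        (\<integral>s. blinfun_apply (T \<zeta> (t - s)) (f s + blinfun_apply \<B> (w s)) \<partial>lebesgue_on {0..t})"
    "integrable I_meas u'"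
  using assms unfolding trajectory_def
  by (auto simp: has_W12_derivative_def intro: L2_space_imp_integrable elim: eventually_mono)

text \<open>Almost everywhere \<open>u t\<close> lies in the domain of
  \<open>B t (u t) \<eta>\<close>, and these domains are ball-relatively compact. Continuity and the
  closure extend this to every \<open>t\<close>. The radius \<open>max 0 R\<close> is used because
  \<open>R\<close> may be negative here.\<close>

lemma trajectory_state_compact:
  obtains K where "compact K"
    "\<And>\<zeta> \<eta> w x u u' f g t. trajectory \<zeta> \<eta> w x u u' f g \<Longrightarrow> (\<zeta>, \<eta>) \<in> P \<Longrightarrow>
       (\<forall>t\<in>{0..b}. norm (u t) \<le> R) \<Longrightarrow> t \<in> {0..b} \<Longrightarrow> u t \<in> K"
proof -
  define D where "D = (\<Union>t\<in>{0..b}. \<Union>(u, \<eta>)\<in>cball 0 R \<times> snd ` P. op_dom (B t u \<eta>))"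
  have "bounded (cball (0::'h) R \<times> snd ` P)" using bounded_params(3) by (intro bounded_Times bounded_cball)
  then have "ball_relatively_compact D"
    using conjunct1[OF conjunct2[OF conjunct2[OF hyp_B[unfolded hyp_B_def]]]] unfolding D_def by blast
  then have "compact (closure (D \<inter> cball 0 (max 0 R)))" unfolding ball_relatively_compact_def by simp
  moreover have "u t \<in> closure (D \<inter> cball 0 (max 0 R))"
    if tr: "trajectory \<zeta> \<eta> w x u u' f g" and p: "(\<zeta>, \<eta>) \<in> P" and R: "\<forall>t\<in>{0..b}. norm (u t) \<le> R" and t: "t \<in> {0..b}"
    for \<zeta> \<eta> w x u u' f g t
  proof (rule AE_mem_closed_imp_mem[OF _ b_pos closed_closure _ t])
    show "continuous_on {0..b} u" by (rule has_W12_derivative_continuous_on[OF trajectoryD(3)[OF tr]])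
    show "AE t in I_meas. u t \<in> closure (D \<inter> cball 0 (max 0 R))"
      using trajectoryD(8)[OF tr] AE_space
    proof eventually_elim
      case (elim t)
      then have "t \<in> {0..b}" by simp
      moreover have "u t \<in> op_dom (B t (u t) \<eta>)" using elim(1) by (auto simp: op_dom_def)
      moreover have "(u t, \<eta>) \<in> cball 0 R \<times> snd ` P" using R p \<open>t \<in> {0..b}\<close> by force
      ultimately have "u t \<in> D" unfolding D_def by blast
      moreover have "norm (u t) \<le> max 0 R" using R \<open>t \<in> {0..b}\<close> by (simp add: le_max_iff_disj)
      ultimately show ?case using closure_subset by fastforce
    qed
  qed
  ultimately show ?thesis by (rule that)
qed

lemma trajectory_restart:
  assumes tr: "trajectory \<zeta> \<eta> w x u u' f g" and w: "w \<in> admissible_controls b W" and st: "0 \<le> s" "s \<le> t" "t \<le> b"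
    and M: "\<And>t. t \<in> {0..b} \<Longrightarrow> norm (T \<zeta> t) \<le> M"
    and \<psi>: "integrable I_meas \<psi>" "AE t in I_meas. norm (f t + blinfun_apply \<B> (w t)) \<le> \<psi> t"
  shows "norm (x t - blinfun_apply (T \<zeta> (t - s)) (x s)) \<le> M * (\<integral>r. \<psi> r \<partial>lebesgue_on {s..t})"
proof -
  have h: "integrable I_meas (\<lambda>s. f s + blinfun_apply \<B> (w s))"
    using trajectoryD(4)[OF tr] control_integrable[OF w] by simp
  have "x t - blinfun_apply (T \<zeta> (t - s)) (x s) =
      (\<integral>r. blinfun_apply (T \<zeta> (t - r)) (f r + blinfun_apply \<B> (w r)) \<partial>lebesgue_on {s..t})"
    using mild_restart[OF semigroup M h st trajectoryD(9)[OF tr]] by simp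
  then show ?thesis using mild_integral_bound[OF semigroup M h st(1,3) \<psi>] by simp
qed

text \<open>The values of \<open>u\<close> lie in one compact set, and \<open>\<psi>\<close>
  controls their variation, so rational times suffice. For \<open>x\<close>, two replacements
  precede compactness: \<open>x n t\<close> by the restarted
  \<open>T (\<zeta> n) (t - s) (x n s)\<close>, with a small integral as error, then
  \<open>\<zeta> n\<close> by its limit, by norm convergence at the positive time
  \<open>t - s\<close>. At \<open>t = 0\<close> the initial data decide.\<close>

lemma pointwise_convergent_subseq:
  assumes P: "\<And>n. (\<zeta> n, \<eta> n) \<in> P" and \<zeta>l: "\<zeta> \<longlonglongrightarrow> \<zeta>l" and \<eta>l: "\<eta> \<longlonglongrightarrow> \<eta>l"
    and w: "\<And>n. w n \<in> admissible_controls b W"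
    and tr: "\<And>n. trajectory (\<zeta> n) (\<eta> n) (w n) (x n) (u n) (u' n) (f n) (g n)"
  obtains r xl ul where "strict_mono (r :: nat \<Rightarrow> nat)"
    "\<And>t. t \<in> {0..b} \<Longrightarrow> (\<lambda>n. x (r n) t) \<longlonglongrightarrow> xl t" "\<And>t. t \<in> {0..b} \<Longrightarrow> (\<lambda>n. u (r n) t) \<longlonglongrightarrow> ul t"
proof -
  obtain R \<psi> where R: "0 < R" and \<psi>L: "\<psi> \<in> L2_space b" and \<psi>0: "\<And>t. t \<in> {0..b} \<Longrightarrow> 0 \<le> \<psi> t"
    and bd: "\<And>\<zeta> \<eta> w x u u' f g. (\<zeta>, \<eta>) \<in> P \<Longrightarrow> w \<in> admissible_controls b W \<Longrightarrow> trajectory \<zeta> \<eta> w x u u' f g \<Longrightarrow>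
       (\<forall>t\<in>{0..b}. norm (x t) \<le> R \<and> norm (u t) \<le> R) \<and>
       (AE t in I_meas. norm (w t) \<le> \<psi> t \<and> norm (f t) \<le> \<psi> t \<and> norm (g t) \<le> \<psi> t \<and> norm (u' t) \<le> \<psi> t \<and>
          norm (f t + blinfun_apply \<B> (w t)) \<le> \<psi> t)"
    by (rule uniform_bounds) (blast intro: that)
  have bx: "norm (x n t) \<le> R" and bu: "norm (u n t) \<le> R" if "t \<in> {0..b}" for n t
    using bd[OF P w tr] that by blast+
  have ah: "AE t in I_meas. norm (f n t + blinfun_apply \<B> (w n t)) \<le> \<psi> t"
    and au: "AE t in I_meas. norm (u' n t) \<le> \<psi> t" for n
    using conjunct2[OF bd[OF P w tr, of n]] by (eventually_elim, blast)+
  have \<psi>: "integrable I_meas \<psi>" using \<psi>L by (rule L2_space_imp_integrable)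
  obtain M where M: "M > 0" "\<And>\<zeta> t. \<zeta> \<in> fst ` P \<Longrightarrow> t \<in> {0..b} \<Longrightarrow> norm (T \<zeta> t) \<le> M"
    using semigroup_bound by blast
  have \<zeta>P: "\<zeta> n \<in> fst ` P" for n using P[of n] by force
  have Ml: "norm (T \<zeta>l t) \<le> M" if "t \<in> {0..b}" for t
  proof -
    have "closed (fst ` P)" using P_compact by (intro compact_imp_closed compact_continuous_image continuous_intros)
    then have "\<zeta>l \<in> fst ` P" using \<zeta>P \<zeta>l closed_sequentially by blast
    then show ?thesis using M that by blast
  qed
  obtain K where K: "compact K"
    "\<And>\<zeta> \<eta> w x u u' f g t. trajectory \<zeta> \<eta> w x u u' f g \<Longrightarrow> (\<zeta>, \<eta>) \<in> P \<Longrightarrow>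
       (\<forall>t\<in>{0..b}. norm (u t) \<le> R) \<Longrightarrow> t \<in> {0..b} \<Longrightarrow> u t \<in> K"
    by (rule trajectory_state_compact[of R]) (blast intro: that)
  \<comment> \<open>Second components are smoothing times: \<open>T \<zeta>l \<delta>\<close> is one
    compact operator for all \<open>n\<close>, so its values at the bounded \<open>x n s\<close>
    have convergent subsequences although the \<open>x n s\<close> themselves may not.\<close>
  define Q where "Q = {(s, \<delta>::real). s \<in> \<rat> \<and> \<delta> \<in> \<rat> \<and> s \<in> {0..b} \<and> 0 < \<delta>}"
  have "countable Q" by (rule countable_subset[of _ "\<rat> \<times> \<rat>"]) (auto simp: Q_def countable_rat)
  then obtain r :: "nat \<Rightarrow> nat" where r: "strict_mono r"
    "\<And>q. q \<in> Q \<Longrightarrow> convergent (\<lambda>n. (\<lambda>(s, \<delta>) n. (blinfun_apply (T \<zeta>l \<delta>) (x n s), u n s)) q (r n))"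
  proof (rule diagonal_convergent_subseq[where K = "\<lambda>(s, \<delta>). closure (blinfun_apply (T \<zeta>l \<delta>) ` cball 0 R) \<times> K"
        and y = "\<lambda>(s, \<delta>) n. (blinfun_apply (T \<zeta>l \<delta>) (x n s), u n s)"])
    fix q assume q: "q \<in> Q"
    obtain s \<delta> where sd: "q = (s, \<delta>)" "s \<in> {0..b}" "0 < \<delta>" using q by (auto simp: Q_def)
    have "compact_operator (T \<zeta>l \<delta>)" using hyp_A sd unfolding hyp_A_def by (elim conjE) simp
    then have "compact (closure (blinfun_apply (T \<zeta>l \<delta>) ` cball 0 R))"
      unfolding compact_operator_def by (simp add: bounded_cball)
    then show "compact (case q of (s, \<delta>) \<Rightarrow> closure (blinfun_apply (T \<zeta>l \<delta>) ` cball 0 R) \<times> K)"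
      using K(1) by (simp add: sd compact_Times)
    fix n
    have "blinfun_apply (T \<zeta>l \<delta>) (x n s) \<in> closure (blinfun_apply (T \<zeta>l \<delta>) ` cball 0 R)"
      using bx[OF sd(2), of n] by (intro subsetD[OF closure_subset]) auto
    moreover have "u n s \<in> K" using K(2)[OF tr P _ sd(2), of n] bu by blast
    ultimately show "(case q of (s, \<delta>) \<Rightarrow> \<lambda>n. (blinfun_apply (T \<zeta>l \<delta>) (x n s), u n s)) n
        \<in> (case q of (s, \<delta>) \<Rightarrow> closure (blinfun_apply (T \<zeta>l \<delta>) ` cball 0 R) \<times> K)" by (simp add: sd)
  qed (use that in blast)
  have cx: "convergent (\<lambda>n. blinfun_apply (T \<zeta>l \<delta>) (x (r n) s))" and cu: "convergent (\<lambda>n. u (r n) s)"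
    if "s \<in> \<rat>" "s \<in> {0..b}" "\<delta> \<in> \<rat>" "0 < \<delta>" for s \<delta>
  proof -
    have "(s, \<delta>) \<in> Q" using that by (simp add: Q_def)
    from r(2)[OF this] obtain l where l: "(\<lambda>n. (blinfun_apply (T \<zeta>l \<delta>) (x (r n) s), u (r n) s)) \<longlonglongrightarrow> l"
      by (auto simp: convergent_def)
    show "convergent (\<lambda>n. blinfun_apply (T \<zeta>l \<delta>) (x (r n) s))" "convergent (\<lambda>n. u (r n) s)"
      using tendsto_fst[OF l] tendsto_snd[OF l] unfolding convergent_def by auto
  qed
  have \<zeta>r: "(\<lambda>n. \<zeta> (r n)) \<longlonglongrightarrow> \<zeta>l" using LIMSEQ_subseq_LIMSEQ[OF \<zeta>l r(1)] by (simp add: o_def)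
  have \<eta>r: "(\<lambda>n. \<eta> (r n)) \<longlonglongrightarrow> \<eta>l" using LIMSEQ_subseq_LIMSEQ[OF \<eta>l r(1)] by (simp add: o_def)
  have conv_u: "convergent (\<lambda>n. u (r n) t)" if t: "t \<in> {0..b}" for t
  proof (cases "t = 0")
    case True
    have "isCont u\<^sub>0 \<eta>l" using hyp_0 by (auto simp: hyp_0_def continuous_on_eq_continuous_at)
    from isCont_tendsto_compose[OF this \<eta>r] show ?thesis
      using True trajectoryD(2)[OF tr] by (auto simp: convergent_def)
  next
    case False
    with t have t: "0 < t" "t \<le> b" by auto
    have "Cauchy (\<lambda>n. u (r n) t)"
    proof (rule Cauchy_if_approximable)
      fix e :: real assume "0 < e"
      then obtain s where s: "s \<in> \<rat>" "0 < s" "s < t" "\<bar>\<integral>r. \<psi> r \<partial>lebesgue_on {s..t}\<bar> < e"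
        using small_integral_near_endpoint[OF \<psi> t] by blast
      \<comment> \<open>The smoothing time 1 is a placeholder; only the component for
        \<open>u\<close> is read off.\<close>
      have "Cauchy (\<lambda>n. u (r n) s)" using cu[of s 1] s t by (intro convergent_Cauchy) auto
      moreover have "norm (u (r n) t - u (r n) s) \<le> e" for n
      proof -
        have "u (r n) t - u (r n) s = (\<integral>q. u' (r n) q \<partial>lebesgue_on {s..t})"
          using s t by (intro has_W12_derivative_diff[OF trajectoryD(3)[OF tr]]) auto
        also have "norm \<dots> \<le> (\<integral>q. \<psi> q \<partial>lebesgue_on {s..t})"
          using s t by (intro integral_norm_le_AE integrable_lebesgue_on_subset[OF trajectoryD(10)[OF tr]]
              integrable_lebesgue_on_subset[OF \<psi>] AE_lebesgue_on_subset[OF au]) auto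
        finally show ?thesis using s by linarith
      qed
      ultimately show "\<exists>c. Cauchy c \<and> (\<forall>n. norm (u (r n) t - c n) \<le> e)" by blast
    qed
    then show ?thesis by (rule Cauchy_convergent)
  qed
  have conv_x: "convergent (\<lambda>n. x (r n) t)" if t: "t \<in> {0..b}" for t
  proof (cases "t = 0")
    case True
    have "isCont x\<^sub>0 \<zeta>l" using hyp_0 by (auto simp: hyp_0_def continuous_on_eq_continuous_at)
    then have x0: "(\<lambda>n. x\<^sub>0 (\<zeta> (r n))) \<longlonglongrightarrow> x\<^sub>0 \<zeta>l" using \<zeta>r by (rule isCont_tendsto_compose)
    have "x n 0 = x\<^sub>0 (\<zeta> n)" for n
    proof -
      have "(\<integral>r. \<psi> r \<partial>lebesgue_on {0..0}) = 0"
        using integral_lebesgue_on_split[of 0 0 \<psi> 0] integrable_lebesgue_on_subset[OF \<psi>, of "{0..0}"] b_pos by simp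
      then have "norm (\<integral>s. blinfun_apply (T (\<zeta> n) (0 - s)) (f n s + blinfun_apply \<B> (w n s)) \<partial>lebesgue_on {0..0}) \<le> 0"
        using mild_integral_bound[OF semigroup M(2)[OF \<zeta>P] _ order_refl _ \<psi> ah, of n 0 n] b_pos
          trajectoryD(4)[OF tr, of n] control_integrable[OF w, of n] by simp
      moreover have "T (\<zeta> n) 0 = id_blinfun" using semigroup unfolding C0_semigroup_def by blast
      ultimately show ?thesis using trajectoryD(9)[OF tr, of 0 n] b_pos by simp
    qed
    then show ?thesis using x0 True by (auto simp: convergent_def)
  next
    case False
    with t have t: "0 < t" "t \<le> b" by auto
    have "Cauchy (\<lambda>n. x (r n) t)"
    proof (rule Cauchy_if_approximable)
      fix e :: real assume "0 < e"
      then have "0 < e / M" using M by simp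
      then obtain s where s: "s \<in> \<rat>" "0 < s" "s < t" "\<bar>\<integral>r. \<psi> r \<partial>lebesgue_on {s..t}\<bar> < e / M"
        using small_integral_near_endpoint[OF \<psi> t] by blast
      obtain \<delta> where \<delta>: "\<delta> \<in> \<rat>" "0 < \<delta>" "\<delta> < t - s" using Rats_dense_in_real[of 0 "t - s"] s by auto
      \<comment> \<open>\<open>t - s\<close> need not be rational. Splitting off a rational
        \<open>\<delta>\<close> leaves a bounded operator, which preserves the convergence of the
        smoothed values.\<close>
      have "T \<zeta>l (t - s) = T \<zeta>l (t - s - \<delta>) o\<^sub>L T \<zeta>l \<delta>"
      proof -
        have "T \<zeta>l ((t - s - \<delta>) + \<delta>) = T \<zeta>l (t - s - \<delta>) o\<^sub>L T \<zeta>l \<delta>"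
          using semigroup[of \<zeta>l] \<delta> unfolding C0_semigroup_def by (metis diff_gt_0_iff_gt less_imp_le)
        then show ?thesis by simp
      qed
      moreover obtain l where "(\<lambda>n. blinfun_apply (T \<zeta>l \<delta>) (x (r n) s)) \<longlonglongrightarrow> l"
        using cx[of s \<delta>] s \<delta> t by (auto simp: convergent_def)
      then have "(\<lambda>n. blinfun_apply (T \<zeta>l (t - s - \<delta>)) (blinfun_apply (T \<zeta>l \<delta>) (x (r n) s)))
          \<longlonglongrightarrow> blinfun_apply (T \<zeta>l (t - s - \<delta>)) l" by (intro tendsto_intros)
      ultimately have 1: "(\<lambda>n. blinfun_apply (T \<zeta>l (t - s)) (x (r n) s)) \<longlonglongrightarrow> blinfun_apply (T \<zeta>l (t - s - \<delta>)) l"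
        by simp
      have 2: "(\<lambda>n. blinfun_apply (T (\<zeta> (r n)) (t - s) - T \<zeta>l (t - s)) (x (r n) s)) \<longlonglongrightarrow> 0"
      proof (rule Lim_null_comparison)
        show "\<forall>\<^sub>F n in sequentially. norm (blinfun_apply (T (\<zeta> (r n)) (t - s) - T \<zeta>l (t - s)) (x (r n) s))
            \<le> norm (T (\<zeta> (r n)) (t - s) - T \<zeta>l (t - s)) * R"
          using bx[of s] s t by (intro always_eventually allI order_trans[OF norm_blinfun] mult_left_mono) auto
        have "(\<lambda>n. T (\<zeta> (r n)) (t - s) - T \<zeta>l (t - s)) \<longlonglongrightarrow> 0"
        proof (rule tendstoI)
          fix e :: real assume "0 < e"
          from semigroup_norm_convergence[OF \<zeta>r, of "t - s" e] s t this
          show "\<forall>\<^sub>F n in sequentially. dist (T (\<zeta> (r n)) (t - s) - T \<zeta>l (t - s)) 0 < e"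
            by (auto elim!: eventually_mono)
        qed
        from tendsto_mult_left_zero[OF tendsto_norm_zero[OF this]]
        show "(\<lambda>n. norm (T (\<zeta> (r n)) (t - s) - T \<zeta>l (t - s)) * R) \<longlonglongrightarrow> 0" .
      qed
      have "Cauchy (\<lambda>n. blinfun_apply (T (\<zeta> (r n)) (t - s)) (x (r n) s))"
        using tendsto_add[OF 1 2] by (intro LIMSEQ_imp_Cauchy) (simp add: blinfun.diff_left)
      moreover have "norm (x (r n) t - blinfun_apply (T (\<zeta> (r n)) (t - s)) (x (r n) s)) \<le> e" for n
      proof -
        have "norm (x (r n) t - blinfun_apply (T (\<zeta> (r n)) (t - s)) (x (r n) s)) \<le> M * (\<integral>r. \<psi> r \<partial>lebesgue_on {s..t})"
          using s t by (intro trajectory_restart[OF tr w _ _ _ M(2)[OF \<zeta>P] \<psi> ah]) auto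
        also have "\<dots> \<le> M * (e / M)" using s(4) M(1) by (intro mult_left_mono) auto
        finally show ?thesis using M(1) by simp
      qed
      ultimately show "\<exists>c. Cauchy c \<and> (\<forall>n. norm (x (r n) t - c n) \<le> e)" by blast
    qed
    then show ?thesis by (rule Cauchy_convergent)
  qed
  show ?thesis
    by (rule that[of r "\<lambda>t. lim (\<lambda>n. x (r n) t)" "\<lambda>t. lim (\<lambda>n. u (r n) t)"])
       (use r(1) conv_x conv_u in \<open>auto simp: convergent_LIMSEQ_iff\<close>)
qed

end

section \<open>Limits of inclusions\<close>

lemma integral_lebesgue_on_singleton:
  fixes f :: "real \<Rightarrow> 'b::{banach, second_countable_topology}"
  shows "(\<integral>x. f x \<partial>lebesgue_on {a..a}) = 0"
proof (rule integral_eq_zero_AE)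
  have "AE x in lebesgue_on {a..a}. x \<noteq> a" by (rule AE_lebesgue_on_neq) simp
  then show "AE x in lebesgue_on {a..a}. f x = 0" using AE_space by eventually_elim simp
qed

text \<open>Distances to \<open>K\<close> are averaged along with the points, and averages of a null
  sequence over its tails again tend to 0.\<close>

lemma convex_combination_limit_mem:
  fixes y :: "nat \<Rightarrow> 'a::real_normed_vector"
  assumes K: "closed K" "convex K" "K \<noteq> {}" and c: "\<And>n. tail_weights n (c n) (N n)"
    and y: "\<And>k. infdist (y k) K \<le> e k" "e \<longlonglongrightarrow> 0" and l: "(\<lambda>n. \<Sum>k\<le>N n. c n k *\<^sub>R y k) \<longlonglongrightarrow> l"
  shows "l \<in> K"
proof -
  have "infdist l K \<le> 0"
  proof (rule LIMSEQ_le)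
    show "(\<lambda>n. infdist (\<Sum>k\<le>N n. c n k *\<^sub>R y k) K) \<longlonglongrightarrow> infdist l K" by (rule tendsto_infdist[OF l])
    show "(\<lambda>n. \<Sum>k\<le>N n. c n k *\<^sub>R e k) \<longlonglongrightarrow> 0" by (rule tail_weights_tendsto[OF c y(2)])
    have "infdist (\<Sum>k\<le>N n. c n k *\<^sub>R y k) K \<le> (\<Sum>k\<le>N n. c n k * e k)" for n
      using c[of n] y(1) by (intro infdist_convex_comb_le K(2,3)) (auto simp: tail_weights_def)
    then show "\<exists>m. \<forall>n\<ge>m. infdist (\<Sum>k\<le>N n. c n k *\<^sub>R y k) K \<le> (\<Sum>k\<le>N n. c n k *\<^sub>R e k)" by auto
  qed
  then have "infdist l K = 0" using infdist_nonneg[of l K] by linarith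
  then show ?thesis using K in_closed_iff_infdist_zero by blast
qed

text \<open>\<open>\<gamma> 0\<close> is arbitrary, so the modulus may only be used where the parameters differ.\<close>

lemma modulus_tendsto:
  fixes \<gamma> :: "real \<Rightarrow> real"
  assumes "(\<gamma> \<longlongrightarrow> 0) (at_right 0)" "p \<longlonglongrightarrow> pl"
  shows "(\<lambda>n. if p n = pl then 0 else \<gamma> (dist (p n) pl)) \<longlonglongrightarrow> 0"
proof (rule LIMSEQ_I)
  fix e :: real assume "0 < e"
  then obtain d where d: "0 < d" "\<And>r. 0 < r \<Longrightarrow> r < d \<Longrightarrow> \<bar>\<gamma> r\<bar> < e"
    using tendstoD[OF assms(1), of e] by (auto simp: eventually_at_right dist_real_def)
  obtain N where "\<And>n. N \<le> n \<Longrightarrow> dist (p n) pl < d" using metric_LIMSEQ_D[OF assms(2) d(1)] by blast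
  then have "norm ((if p n = pl then 0 else \<gamma> (dist (p n) pl)) - 0) < e" if "N \<le> n" for n
    using d(2)[of "dist (p n) pl"] that \<open>0 < e\<close> by auto
  then show "\<exists>N. \<forall>n\<ge>N. norm ((if p n = pl then 0 else \<gamma> (dist (p n) pl)) - 0) < e" by blast
qed

text \<open>At fixed \<open>t\<close> the distance of \<open>f n t\<close> to the limit set has a
  state error and a parameter error. The state is exchanged first, at parameter \<open>p n\<close>,
  so that the parameter is exchanged at the fixed limit state and the factor \<open>\<rho>\<close>
  does not vary with \<open>n\<close>. Stated for a general \<Phi> to serve both \<open>F\<close>
  and \<open>G\<close>.\<close>

lemma inclusion_limit:
  fixes \<Phi> :: "real \<Rightarrow> 'e::real_normed_vector \<Rightarrow> 'h::real_normed_vector \<Rightarrow> 'p::metric_space \<Rightarrow> 'a::real_inner set"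
  assumes vals: "\<And>t x u p. t \<in> {0..b} \<Longrightarrow> \<Phi> t x u p \<noteq> {} \<and> weakly_compact (\<Phi> t x u p) \<and> convex (\<Phi> t x u p)"
    and lip: "\<And>p. p \<in> D \<Longrightarrow> AE t in lebesgue_on {0..b}. \<forall>x u y v.
        Haus (\<Phi> t x u p) (\<Phi> t y v p) \<le> ereal (k t * (norm (x - y) + norm (u - v)))"
    and \<gamma>: "(\<gamma> \<longlongrightarrow> 0) (at_right 0)"
    and par: "\<And>p q. AE t in lebesgue_on {0..b}. \<forall>x u.
        Haus (\<Phi> t x u p) (\<Phi> t x u q) \<le> ereal (\<gamma> (dist p q) * \<rho> t (norm x) (norm u))"
    and p: "\<And>n. p n \<in> D" "p \<longlonglongrightarrow> pl"
    and x: "\<And>t. t \<in> {0..b} \<Longrightarrow> (\<lambda>n. x n t) \<longlonglongrightarrow> xl t" and u: "\<And>t. t \<in> {0..b} \<Longrightarrow> (\<lambda>n. u n t) \<longlonglongrightarrow> ul t"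
    and incl: "\<And>n. AE t in lebesgue_on {0..b}. f n t \<in> \<Phi> t (x n t) (u n t) (p n)"
    and c: "\<And>n. tail_weights n (c n) (N n)"
    and fl: "AE t in lebesgue_on {0..b}. (\<lambda>n. \<Sum>k\<le>N n. c n k *\<^sub>R f k t) \<longlonglongrightarrow> fl t"
  shows "AE t in lebesgue_on {0..b}. fl t \<in> \<Phi> t (xl t) (ul t) pl"
proof -
  have "AE t in lebesgue_on {0..b}. \<forall>n. \<forall>x u y v. Haus (\<Phi> t x u (p n)) (\<Phi> t y v (p n)) \<le> ereal (k t * (norm (x - y) + norm (u - v)))"
    using lip[OF p(1)] by (subst AE_all_countable) blast
  moreover have "AE t in lebesgue_on {0..b}. \<forall>n. \<forall>x u. Haus (\<Phi> t x u (p n)) (\<Phi> t x u pl) \<le> ereal (\<gamma> (dist (p n) pl) * \<rho> t (norm x) (norm u))"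
    using par by (subst AE_all_countable) blast
  moreover have "AE t in lebesgue_on {0..b}. \<forall>n. f n t \<in> \<Phi> t (x n t) (u n t) (p n)"
    using incl by (subst AE_all_countable) blast
  ultimately show ?thesis using fl AE_space
  proof eventually_elim
    case (elim t)
    then have t: "t \<in> {0..b}" by simp
    define \<gamma>' where "\<gamma>' n = (if p n = pl then 0 else \<gamma> (dist (p n) pl))" for n
    have \<gamma>': "\<gamma>' \<longlonglongrightarrow> 0" unfolding \<gamma>'_def[abs_def] by (rule modulus_tendsto[OF \<gamma> p(2)])
    define e where "e n = k t * (norm (x n t - xl t) + norm (u n t - ul t)) + \<gamma>' n * \<rho> t (norm (xl t)) (norm (ul t))" for n
    show ?case
    proof (rule convex_combination_limit_mem[OF _ _ _ c _ _ elim(4)])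
      show "closed (\<Phi> t (xl t) (ul t) pl)" "convex (\<Phi> t (xl t) (ul t) pl)" "\<Phi> t (xl t) (ul t) pl \<noteq> {}"
        using vals[OF t] weakly_compact_imp_closed by blast+
      show "infdist (f n t) (\<Phi> t (xl t) (ul t) pl) \<le> e n" for n
      proof (cases "p n = pl")
        case True
        have "infdist (f n t) (\<Phi> t (xl t) (ul t) (p n)) \<le> k t * (norm (x n t - xl t) + norm (u n t - ul t))"
          using elim(1,3) by (intro infdist_le_Haus) blast+
        then show ?thesis using True by (simp add: e_def \<gamma>'_def)
      next
        case False
        have "infdist (f n t) (\<Phi> t (xl t) (ul t) pl) \<le> k t * (norm (x n t - xl t) + norm (u n t - ul t))
            + \<gamma> (dist (p n) pl) * \<rho> t (norm (xl t)) (norm (ul t))"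
          using elim(1,2,3) vals[OF t] by (intro infdist_le_Haus_trans) blast+
        then show ?thesis using False by (simp add: e_def \<gamma>'_def)
      qed
      have "e \<longlonglongrightarrow> k t * (norm (xl t - xl t) + norm (ul t - ul t)) + 0 * \<rho> t (norm (xl t)) (norm (ul t))"
        unfolding e_def[abs_def] by (intro tendsto_intros x u t \<gamma>')
      then show "e \<longlonglongrightarrow> 0" by simp
    qed
  qed
qed

lemma convex_comb_AE_bound:
  fixes z :: "nat \<Rightarrow> 'a \<Rightarrow> 'b::real_normed_vector"
  assumes "\<And>n. tail_weights n (c n) (N n)" "\<And>k. AE t in M. norm (z k t) \<le> \<psi> t"
    "AE t in M. (\<lambda>n. \<Sum>k\<le>N n. c n k *\<^sub>R z k t) \<longlonglongrightarrow> zl t"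
  shows "AE t in M. norm (\<Sum>k\<le>N n. c n k *\<^sub>R z k t) \<le> \<psi> t" "AE t in M. norm (zl t) \<le> \<psi> t"
proof -
  have "AE t in M. \<forall>k. norm (z k t) \<le> \<psi> t" using assms(2) by (simp add: AE_all_countable)
  then have 1: "AE t in M. \<forall>n. norm (\<Sum>k\<le>N n. c n k *\<^sub>R z k t) \<le> \<psi> t"
    by eventually_elim (auto intro!: tail_weights_norm_le[OF assms(1)])
  then show "AE t in M. norm (\<Sum>k\<le>N n. c n k *\<^sub>R z k t) \<le> \<psi> t" by eventually_elim blast
  from 1 assms(3) show "AE t in M. norm (zl t) \<le> \<psi> t"
    by eventually_elim (auto intro: LIMSEQ_le_const2[OF tendsto_norm])
qed

context control_system
begin

text \<open>Against a fixed point of the limit graph, the distance between operators makes each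
  \<open>y k\<close> monotonically related up to an error that vanishes. For a fixed direction the
  inequality is affine in \<open>y k\<close> and survives tail averages; maximality turns the
  limiting inequalities into membership.\<close>

lemma monotone_inclusion_limit:
  assumes \<eta>: "\<eta> \<longlonglongrightarrow> \<eta>l" and u: "\<And>t. t \<in> {0..b} \<Longrightarrow> (\<lambda>n. u n t) \<longlonglongrightarrow> ul t"
    and incl: "\<And>n. AE t in I_meas. y n t \<in> B t (u n t) (\<eta> n) (u n t)"
    and \<psi>: "\<And>n. AE t in I_meas. norm (y n t) \<le> \<psi> t"
    and c: "\<And>n. tail_weights n (c n) (N n)"
    and yl: "AE t in I_meas. (\<lambda>n. \<Sum>k\<le>N n. c n k *\<^sub>R y k t) \<longlonglongrightarrow> yl t"
  shows "AE t in I_meas. yl t \<in> B t (ul t) \<eta>l (ul t)"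
proof -
  obtain \<theta> :: "real \<Rightarrow> real" and d d' where d: "0 \<le> d" "0 < d'"
    and dis: "\<And>t s u v \<eta>\<^sub>1 \<eta>\<^sub>2. t \<in> {0..b} \<Longrightarrow> s \<in> {0..b} \<Longrightarrow> op_dis (B t u \<eta>\<^sub>1) (B s v \<eta>\<^sub>2)
             \<le> ereal (\<bar>\<theta> t - \<theta> s\<bar> + d * norm (u - v) + d' * dist \<eta>\<^sub>1 \<eta>\<^sub>2)"
    using conjunct1[OF hyp_B[unfolded hyp_B_def]] by blast
  have "AE t in I_meas. \<forall>n. y n t \<in> B t (u n t) (\<eta> n) (u n t)" "AE t in I_meas. \<forall>n. norm (y n t) \<le> \<psi> t"
    using incl \<psi> by (simp_all add: AE_all_countable)
  then show ?thesis using yl AE_space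
  proof eventually_elim
    case (elim t)
    then have t: "t \<in> {0..b}" by simp
    show ?case
    proof (subst maximal_monotone_iff_mem[OF B_maximal[OF t]], intro allI ballI)
      fix v y' assume y': "y' \<in> B t (ul t) \<eta>l v"
      define q where "q k = d * norm (u k t - ul t) + d' * dist (\<eta> k) \<eta>l" for k
      \<comment> \<open>First term: defect of monotonicity between the two operators. Second term:
        cost of replacing \<open>u k t\<close> by \<open>ul t\<close>, with \<open>y k t\<close>
        bounded by \<open>\<psi> t\<close>.\<close>
      define e where "e k = q k * (1 + \<psi> t + norm y') + (\<psi> t + norm y') * norm (u k t - ul t)" for k
      have "q \<longlonglongrightarrow> d * norm (ul t - ul t) + d' * dist \<eta>l \<eta>l"
        unfolding q_def[abs_def] by (intro tendsto_intros u t \<eta>)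
      then have q: "q \<longlonglongrightarrow> 0" by simp
      have "e \<longlonglongrightarrow> 0 * (1 + \<psi> t + norm y') + (\<psi> t + norm y') * norm (ul t - ul t)"
        unfolding e_def[abs_def] by (intro tendsto_intros u t q)
      then have e: "e \<longlonglongrightarrow> 0" by simp
      \<comment> \<open>The direction \<open>v - ul t\<close> is the same for every
        \<open>k\<close>; without this the inequalities could not be averaged.\<close>
      have le: "(y k t - y') \<bullet> (v - ul t) \<le> e k" for k
      proof -
        have "op_dis (B t (u k t) (\<eta> k)) (B t (ul t) \<eta>l) \<le> ereal (q k)"
          using dis[OF t t, of "u k t" "\<eta> k" "ul t" \<eta>l] by (simp add: q_def)
        from op_dis_le_imp_inner_le[OF this _ y', of "y k t" "u k t"]
        have "(y k t - y') \<bullet> (v - u k t) \<le> q k * (1 + norm (y k t) + norm y')" using elim(1) by blast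
        also have "\<dots> \<le> q k * (1 + \<psi> t + norm y')"
          using elim(2) d by (intro mult_left_mono) (auto simp: q_def)
        finally have 1: "(y k t - y') \<bullet> (v - u k t) \<le> q k * (1 + \<psi> t + norm y')" .
        have "(y k t - y') \<bullet> (u k t - ul t) \<le> norm (y k t - y') * norm (u k t - ul t)" by (rule norm_cauchy_schwarz)
        also have "\<dots> \<le> (\<psi> t + norm y') * norm (u k t - ul t)"
          using elim(2) norm_triangle_ineq4[of "y k t" y'] by (intro mult_right_mono) (auto intro: order_trans)
        finally have 2: "(y k t - y') \<bullet> (u k t - ul t) \<le> (\<psi> t + norm y') * norm (u k t - ul t)" .
        have "(y k t - y') \<bullet> (v - ul t) = (y k t - y') \<bullet> (v - u k t) + (y k t - y') \<bullet> (u k t - ul t)"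
          by (simp flip: inner_add_right)
        then show ?thesis using 1 2 by (simp add: e_def)
      qed
      have "(yl t - y') \<bullet> (v - ul t) \<le> 0"
      proof (rule LIMSEQ_le)
        show "(\<lambda>n. ((\<Sum>k\<le>N n. c n k *\<^sub>R y k t) - y') \<bullet> (v - ul t)) \<longlonglongrightarrow> (yl t - y') \<bullet> (v - ul t)"
          by (intro tendsto_intros elim)
        show "(\<lambda>n. \<Sum>k\<le>N n. c n k *\<^sub>R e k) \<longlonglongrightarrow> 0" by (rule tail_weights_tendsto[OF c e])
        have "((\<Sum>k\<le>N n. c n k *\<^sub>R y k t) - y') \<bullet> (v - ul t) \<le> (\<Sum>k\<le>N n. c n k *\<^sub>R e k)" for n
        proof -
          have cn: "sum (c n) {..N n} = 1" "\<And>k. 0 \<le> c n k" using c[of n] by (auto simp: tail_weights_def)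
          have "((\<Sum>k\<le>N n. c n k *\<^sub>R y k t) - y') = (\<Sum>k\<le>N n. c n k *\<^sub>R (y k t - y'))"
            using cn(1) by (simp add: scaleR_diff_right sum_subtractf flip: scaleR_left.sum)
          then have "((\<Sum>k\<le>N n. c n k *\<^sub>R y k t) - y') \<bullet> (v - ul t) = (\<Sum>k\<le>N n. c n k * ((y k t - y') \<bullet> (v - ul t)))"
            by (simp add: inner_sum_left)
          also have "\<dots> \<le> (\<Sum>k\<le>N n. c n k * e k)" using le cn(2) by (intro sum_mono mult_left_mono) auto
          finally show ?thesis by simp
        qed
        then show "\<exists>m. \<forall>n\<ge>m. ((\<Sum>k\<le>N n. c n k *\<^sub>R y k t) - y') \<bullet> (v - ul t) \<le> (\<Sum>k\<le>N n. c n k *\<^sub>R e k)" by blast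
      qed
      moreover have "(yl t - y') \<bullet> (ul t - v) = - ((yl t - y') \<bullet> (v - ul t))"
        by (metis inner_minus_right minus_diff_eq)
      ultimately show "0 \<le> (yl t - y') \<bullet> (ul t - v)" by simp
    qed
  qed
qed

text \<open>The \<open>h k\<close> need not converge, so strong convergence of the semigroups would
  not suffice. Up to some \<open>s < t\<close> the elapsed time is at least \<open>t - s\<close> and
  norm convergence applies; from \<open>s\<close> to \<open>t\<close> the majorant makes both
  integrals small.\<close>

lemma mild_integral_parameter_limit:
  assumes \<zeta>: "\<zeta> \<longlonglongrightarrow> \<zeta>l" "range \<zeta> \<subseteq> fst ` P" "\<zeta>l \<in> fst ` P" and t: "t \<in> {0..b}"
    and h: "\<And>k. integrable I_meas (h k)" "\<And>k. AE r in I_meas. norm (h k r) \<le> \<psi> r"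
    and \<psi>: "integrable I_meas \<psi>" "\<And>t. t \<in> {0..b} \<Longrightarrow> 0 \<le> \<psi> t"
  shows "(\<lambda>k. (\<integral>r. blinfun_apply (T (\<zeta> k) (t - r)) (h k r) \<partial>lebesgue_on {0..t})
      - (\<integral>r. blinfun_apply (T \<zeta>l (t - r)) (h k r) \<partial>lebesgue_on {0..t})) \<longlonglongrightarrow> 0"
proof (cases "t = 0")
  case True
  then show ?thesis by (simp only: integral_lebesgue_on_singleton) simp
next
  case False
  with t have t: "0 < t" "t \<le> b" by auto
  obtain M where M: "M > 0" "\<And>\<zeta> t. \<zeta> \<in> fst ` P \<Longrightarrow> t \<in> {0..b} \<Longrightarrow> norm (T \<zeta> t) \<le> M"
    using semigroup_bound by blast
  have \<zeta>P: "\<zeta> k \<in> fst ` P" for k using \<zeta>(2) by blast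
  \<comment> \<open>The summand 1 makes \<open>J\<close> positive, so that
    \<open>e / (4 * J)\<close> is a legitimate tolerance even when \<open>\<psi>\<close>
    vanishes.\<close>
  define J where "J = (\<integral>r. \<psi> r \<partial>I_meas) + 1"
  have J: "0 < J" unfolding J_def using \<psi>(2) by (intro add_nonneg_pos Bochner_Integration.integral_nonneg) auto
  define I where "I \<xi> k p q = (\<integral>r. blinfun_apply (T \<xi> (t - r)) (h k r) \<partial>lebesgue_on {p..q})" for \<xi> k p q
  show ?thesis
  proof (rule LIMSEQ_I)
    fix e :: real assume e: "0 < e"
    then have "0 < e / (4 * M)" using M by simp
    then obtain s where s: "s \<in> \<rat>" "0 < s" "s < t" "\<bar>\<integral>r. \<psi> r \<partial>lebesgue_on {s..t}\<bar> < e / (4 * M)"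
      using small_integral_near_endpoint[OF \<psi>(1) t] by blast
    have "\<forall>\<^sub>F k in sequentially. \<forall>\<tau>\<in>{t - s..b}. norm (T (\<zeta> k) \<tau> - T \<zeta>l \<tau>) < e / (4 * J)"
      using s t e J by (intro semigroup_norm_convergence[OF \<zeta>(1)]) auto
    then obtain k0 where k0: "\<And>k \<tau>. k0 \<le> k \<Longrightarrow> \<tau> \<in> {t - s..b} \<Longrightarrow> norm (T (\<zeta> k) \<tau> - T \<zeta>l \<tau>) < e / (4 * J)"
      unfolding eventually_sequentially by blast
    have "norm (I (\<zeta> k) k 0 t - I \<zeta>l k 0 t - 0) < e" if k: "k0 \<le> k" for k
    proof -
      have int: "integrable (lebesgue_on {p..t}) (\<lambda>r. blinfun_apply (T \<xi> (t - r)) (h k r))" if "\<xi> \<in> fst ` P" "0 \<le> p" for \<xi> p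
        using mild_integrand_integrable[OF semigroup M(2)[OF that(1)] h(1) that(2) t(2)] by blast
      have int': "integrable (lebesgue_on {0..s}) (\<lambda>r. blinfun_apply (T \<xi> (t - r)) (h k r))" if "\<xi> \<in> fst ` P" for \<xi>
        using s by (intro integrable_lebesgue_on_subset[OF int[OF that order_refl]]) auto
      have split: "I \<xi> k 0 t = I \<xi> k 0 s + I \<xi> k s t" if "\<xi> \<in> fst ` P" for \<xi>
        unfolding I_def using s int[OF that order_refl] by (intro integral_lebesgue_on_split) auto
      have tail: "norm (I \<xi> k s t) \<le> e / 4" if "\<xi> \<in> fst ` P" for \<xi>
      proof -
        have "norm (I \<xi> k s t) \<le> M * (\<integral>r. \<psi> r \<partial>lebesgue_on {s..t})"
          unfolding I_def using s by (intro mild_integral_bound[OF semigroup M(2)[OF that] h(1) _ t(2) \<psi>(1) h(2)]) auto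
        also have "\<dots> \<le> M * (e / (4 * M))" using s M(1) by (intro mult_left_mono) auto
        finally show ?thesis using M(1) by simp
      qed
      have head: "norm (I (\<zeta> k) k 0 s - I \<zeta>l k 0 s) \<le> e / 4"
      proof -
        have "I (\<zeta> k) k 0 s - I \<zeta>l k 0 s = (\<integral>r. blinfun_apply (T (\<zeta> k) (t - r)) (h k r) - blinfun_apply (T \<zeta>l (t - r)) (h k r) \<partial>lebesgue_on {0..s})"
          unfolding I_def using int'[OF \<zeta>P] int'[OF \<zeta>(3)] by simp
        also have "norm \<dots> \<le> (\<integral>r. e / (4 * J) * \<psi> r \<partial>lebesgue_on {0..s})"
        proof (rule integral_norm_le_AE)
          show "integrable (lebesgue_on {0..s}) (\<lambda>r. e / (4 * J) * \<psi> r)"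
            using s t integrable_lebesgue_on_subset[OF \<psi>(1), of "{0..s}"] by simp
          have "AE r in lebesgue_on {0..s}. norm (h k r) \<le> \<psi> r"
            by (rule AE_lebesgue_on_subset[OF h(2)]) (use s t in auto)
          then show "AE r in lebesgue_on {0..s}. norm (blinfun_apply (T (\<zeta> k) (t - r)) (h k r) - blinfun_apply (T \<zeta>l (t - r)) (h k r)) \<le> e / (4 * J) * \<psi> r"
            using AE_space
          proof eventually_elim
            case (elim r)
            then have "norm (T (\<zeta> k) (t - r) - T \<zeta>l (t - r)) \<le> e / (4 * J)"
              using k0[OF k, of "t - r"] s t by auto
            then have "norm (blinfun_apply (T (\<zeta> k) (t - r) - T \<zeta>l (t - r)) (h k r)) \<le> e / (4 * J) * \<psi> r"
              using elim(1) e J by (intro order_trans[OF norm_blinfun] mult_mono) auto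
            then show ?case by (simp add: blinfun.diff_left)
          qed
        qed (use int'[OF \<zeta>P] int'[OF \<zeta>(3)] in simp)
        also have "\<dots> = e / (4 * J) * (\<integral>r. \<psi> r \<partial>lebesgue_on {0..s})" by simp
        also have "(\<integral>r. \<psi> r \<partial>lebesgue_on {0..s}) \<le> J"
        proof -
          have "(\<integral>r. \<psi> r \<partial>lebesgue_on {0..s}) \<le> (\<integral>r. \<psi> r \<partial>I_meas)"
            using s t \<psi>(2) by (intro integral_lebesgue_on_subset_mono[OF \<psi>(1)] AE_I2) auto
          then show ?thesis by (simp add: J_def)
        qed
        then have "e / (4 * J) * (\<integral>r. \<psi> r \<partial>lebesgue_on {0..s}) \<le> e / (4 * J) * J"
          using e J by (intro mult_left_mono) auto
        finally show ?thesis using J by simp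
      qed
      have "I (\<zeta> k) k 0 t - I \<zeta>l k 0 t - 0 = (I (\<zeta> k) k 0 s - I \<zeta>l k 0 s) + I (\<zeta> k) k s t - I \<zeta>l k s t"
        unfolding split[OF \<zeta>P] split[OF \<zeta>(3)] by simp
      also have "norm \<dots> \<le> norm ((I (\<zeta> k) k 0 s - I \<zeta>l k 0 s) + I (\<zeta> k) k s t) + norm (I \<zeta>l k s t)"
        by (rule norm_triangle_ineq4)
      also have "\<dots> \<le> norm (I (\<zeta> k) k 0 s - I \<zeta>l k 0 s) + norm (I (\<zeta> k) k s t) + norm (I \<zeta>l k s t)"
        by (intro add_right_mono norm_triangle_ineq)
      also have "\<dots> \<le> e / 4 + e / 4 + e / 4" by (intro add_mono head tail \<zeta>P \<zeta>(3))
      finally show ?thesis using e by simp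
    qed
    then show "\<exists>no. \<forall>k\<ge>no. norm ((\<integral>r. blinfun_apply (T (\<zeta> k) (t - r)) (h k r) \<partial>lebesgue_on {0..t})
      - (\<integral>r. blinfun_apply (T \<zeta>l (t - r)) (h k r) \<partial>lebesgue_on {0..t}) - 0) < e"
      unfolding I_def by blast
  qed
qed

end

section \<open>Limits of trajectories\<close>

text \<open>The way integrals of merely bounded sequences reach their limit: the combination is
  moved inside, where it converges almost everywhere under the majorant
  \<open>\<psi>\<close>.\<close>

lemma convex_comb_integral_tendsto:
  fixes q :: "nat \<Rightarrow> 'a \<Rightarrow> 'b::{banach, second_countable_topology}"
  assumes c: "\<And>n. tail_weights n (c n) (N n)" and q: "\<And>k. integrable M (q k)" "\<And>k. AE t in M. norm (q k t) \<le> \<psi> t"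
    and \<psi>: "integrable M \<psi>" and ql: "ql \<in> borel_measurable M" "AE t in M. (\<lambda>n. \<Sum>k\<le>N n. c n k *\<^sub>R q k t) \<longlonglongrightarrow> ql t"
  shows "(\<lambda>n. \<Sum>k\<le>N n. c n k *\<^sub>R (\<integral>t. q k t \<partial>M)) \<longlonglongrightarrow> (\<integral>t. ql t \<partial>M)"
proof -
  have "(\<lambda>n. \<integral>t. (\<Sum>k\<le>N n. c n k *\<^sub>R q k t) \<partial>M) \<longlonglongrightarrow> (\<integral>t. ql t \<partial>M)"
    using q(1) by (intro integral_dominated_convergence[OF ql(1) _ \<psi> ql(2)] convex_comb_AE_bound(1)[OF c q(2) ql(2)]
        borel_measurable_sum borel_measurable_scaleR) auto
  also have "(\<lambda>n. \<integral>t. (\<Sum>k\<le>N n. c n k *\<^sub>R q k t) \<partial>M) = (\<lambda>n. \<Sum>k\<le>N n. c n k *\<^sub>R (\<integral>t. q k t \<partial>M))"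
    using q(1) by (subst Bochner_Integration.integral_sum) auto
  finally show ?thesis .
qed

context control_system
begin

text \<open>The states converge by themselves, while controls, selections and derivatives converge
  only after averaging. The integral equations of the limit follow because averaging leaves the
  limit of the states unchanged and the equations are linear in the averaged quantities.\<close>

lemma limit_trajectory:
  assumes P: "\<And>n. (\<zeta> n, \<eta> n) \<in> P" and Pl: "(\<zeta>l, \<eta>l) \<in> P" and \<zeta>l: "\<zeta> \<longlonglongrightarrow> \<zeta>l" and \<eta>l: "\<eta> \<longlonglongrightarrow> \<eta>l"
    and w: "\<And>n. w n \<in> admissible_controls b W"
    and tr: "\<And>n. trajectory (\<zeta> n) (\<eta> n) (w n) (x n) (u n) (u' n) (f n) (g n)"
    and xl: "\<And>t. t \<in> {0..b} \<Longrightarrow> (\<lambda>n. x n t) \<longlonglongrightarrow> xl t" and ul: "\<And>t. t \<in> {0..b} \<Longrightarrow> (\<lambda>n. u n t) \<longlonglongrightarrow> ul t"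
  obtains c N wl where "\<And>n. tail_weights n (c n) (N n)" "wl \<in> admissible_controls b W"
    "AE t in I_meas. (\<lambda>n. \<Sum>k\<le>N n. c n k *\<^sub>R w k t) \<longlonglongrightarrow> wl t"
    "(xl, ul) \<in> mild_solutions b T B F G \<B> x\<^sub>0 u\<^sub>0 \<zeta>l \<eta>l wl"
proof -
  obtain R \<psi> where \<psi>L: "\<psi> \<in> L2_space b" and \<psi>0: "\<And>t. t \<in> {0..b} \<Longrightarrow> 0 \<le> \<psi> t"
    and bd: "\<And>\<zeta> \<eta> w x u u' f g. (\<zeta>, \<eta>) \<in> P \<Longrightarrow> w \<in> admissible_controls b W \<Longrightarrow> trajectory \<zeta> \<eta> w x u u' f g \<Longrightarrow>
       (\<forall>t\<in>{0..b}. norm (x t) \<le> R \<and> norm (u t) \<le> R) \<and>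
       (AE t in I_meas. norm (w t) \<le> \<psi> t \<and> norm (f t) \<le> \<psi> t \<and> norm (g t) \<le> \<psi> t \<and> norm (u' t) \<le> \<psi> t \<and>
          norm (f t + blinfun_apply \<B> (w t)) \<le> \<psi> t)"
    by (rule uniform_bounds) (blast intro: that)
  have aw: "AE t in I_meas. norm (w n t) \<le> \<psi> t" and af: "AE t in I_meas. norm (f n t) \<le> \<psi> t"
    and ag: "AE t in I_meas. norm (g n t) \<le> \<psi> t" and au: "AE t in I_meas. norm (u' n t) \<le> \<psi> t"
    and ah: "AE t in I_meas. norm (f n t + blinfun_apply \<B> (w n t)) \<le> \<psi> t" for n
    using conjunct2[OF bd[OF P w tr, of n]] by (eventually_elim, blast)+
  have \<psi>: "integrable I_meas \<psi>" using \<psi>L by (rule L2_space_imp_integrable)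
  have \<psi>2: "integrable I_meas (\<lambda>t. (\<psi> t)\<^sup>2)" using \<psi>L by (simp add: L2_space_def)
  obtain M where M: "M > 0" "\<And>\<zeta> t. \<zeta> \<in> fst ` P \<Longrightarrow> t \<in> {0..b} \<Longrightarrow> norm (T \<zeta> t) \<le> M"
    using semigroup_bound by blast
  have \<zeta>P: "\<zeta> n \<in> fst ` P" "\<zeta>l \<in> fst ` P" and \<eta>P: "\<eta> n \<in> snd ` P" for n using P[of n] Pl by force+
  define h where "h n t = f n t + blinfun_apply \<B> (w n t)" for n t
  have hi: "integrable I_meas (h n)" for n
    unfolding h_def[abs_def] using trajectoryD(4)[OF tr] control_integrable[OF w] by simp
  have ahh: "AE t in I_meas. norm (h n t) \<le> \<psi> t" for n unfolding h_def by (rule ah)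
  \<comment> \<open>Extracting weights for the quadruple at once gives all four components the same
    combinations; with separate weights the couplings between them would be lost.\<close>
  define z where "z n t = (w n t, f n t, g n t, u' n t)" for n t
  have [measurable]: "w n \<in> borel_measurable I_meas" "f n \<in> borel_measurable I_meas"
    "g n \<in> borel_measurable I_meas" "u' n \<in> borel_measurable I_meas" for n
    using w[of n] trajectoryD(4,5,10)[OF tr, of n] by (auto simp: admissible_controls_def L2_space_def)
  have zm: "z n \<in> borel_measurable I_meas" for n unfolding z_def[abs_def] by measurable
  have zb: "AE t in I_meas. norm (z n t) \<le> 4 * \<psi> t" for n
    using aw[of n] af[of n] ag[of n] au[of n]
  proof eventually_elim
    case (elim t)
    have "norm (z n t) \<le> norm (w n t) + (norm (f n t) + (norm (g n t) + norm (u' n t)))"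
      unfolding z_def by (intro order_trans[OF norm_Pair_le] add_left_mono order_refl)
    then show ?case using elim by linarith
  qed
  have \<psi>4: "integrable I_meas (\<lambda>t. (4 * \<psi> t)\<^sup>2)" using \<psi>2 by (simp add: power_mult_distrib)
  obtain c N zl where c: "\<And>n. tail_weights n (c n) (N n)" and zlm: "zl \<in> borel_measurable I_meas"
    and zl: "AE t in I_meas. (\<lambda>n. \<Sum>k\<le>N n. c n k *\<^sub>R z k t) \<longlonglongrightarrow> zl t"
    by (rule AE_convergent_convex_combinations[where z = z, OF finite_measure_lebesgue_on_Icc zm zb \<psi>4]) (blast intro: that)
  define wl where "wl t = fst (zl t)" for t
  define fl where "fl t = fst (snd (zl t))" for t
  define gl where "gl t = fst (snd (snd (zl t)))" for t
  define u'l where "u'l t = snd (snd (snd (zl t)))" for t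
  define hl where "hl t = fl t + blinfun_apply \<B> (wl t)" for t
  have m: "wl \<in> borel_measurable I_meas" "fl \<in> borel_measurable I_meas" "gl \<in> borel_measurable I_meas" "u'l \<in> borel_measurable I_meas"
    using zlm unfolding wl_def[abs_def] fl_def[abs_def] gl_def[abs_def] u'l_def[abs_def]
    by (auto intro!: measurable_compose[OF zlm] borel_measurable_continuous_onI continuous_intros)
  have Aw: "AE t in I_meas. (\<lambda>n. \<Sum>k\<le>N n. c n k *\<^sub>R w k t) \<longlonglongrightarrow> wl t"
    and Af: "AE t in I_meas. (\<lambda>n. \<Sum>k\<le>N n. c n k *\<^sub>R f k t) \<longlonglongrightarrow> fl t"
    and Ag: "AE t in I_meas. (\<lambda>n. \<Sum>k\<le>N n. c n k *\<^sub>R g k t) \<longlonglongrightarrow> gl t"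
    and Au: "AE t in I_meas. (\<lambda>n. \<Sum>k\<le>N n. c n k *\<^sub>R u' k t) \<longlonglongrightarrow> u'l t"
  proof -
    show "AE t in I_meas. (\<lambda>n. \<Sum>k\<le>N n. c n k *\<^sub>R w k t) \<longlonglongrightarrow> wl t"
      using zl by eventually_elim (drule tendsto_fst, simp add: fst_sum z_def wl_def)
    show "AE t in I_meas. (\<lambda>n. \<Sum>k\<le>N n. c n k *\<^sub>R f k t) \<longlonglongrightarrow> fl t"
      using zl by eventually_elim (drule tendsto_fst[OF tendsto_snd], simp add: fst_sum snd_sum z_def fl_def)
    show "AE t in I_meas. (\<lambda>n. \<Sum>k\<le>N n. c n k *\<^sub>R g k t) \<longlonglongrightarrow> gl t"
      using zl by eventually_elim (drule tendsto_fst[OF tendsto_snd[OF tendsto_snd]], simp add: fst_sum snd_sum z_def gl_def)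
    show "AE t in I_meas. (\<lambda>n. \<Sum>k\<le>N n. c n k *\<^sub>R u' k t) \<longlonglongrightarrow> u'l t"
      using zl by eventually_elim (drule tendsto_snd[OF tendsto_snd[OF tendsto_snd]], simp add: snd_sum z_def u'l_def)
  qed
  have Ah: "AE t in I_meas. (\<lambda>n. \<Sum>k\<le>N n. c n k *\<^sub>R h k t) \<longlonglongrightarrow> hl t"
    using Aw Af
  proof eventually_elim
    case (elim t)
    have "(\<lambda>n. (\<Sum>k\<le>N n. c n k *\<^sub>R f k t) + blinfun_apply \<B> (\<Sum>k\<le>N n. c n k *\<^sub>R w k t)) \<longlonglongrightarrow> hl t"
      unfolding hl_def by (intro tendsto_intros elim)
    then show ?case
      by (simp add: h_def scaleR_add_right sum.distrib blinfun.sum_right blinfun.scaleR_right)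
  qed
  have bl: "integrable I_meas q" "integrable I_meas (\<lambda>t. (norm (q t))\<^sup>2)"
    if "q \<in> borel_measurable I_meas" "AE t in I_meas. norm (q t) \<le> \<psi> t" for q :: "real \<Rightarrow> 'c::{banach, second_countable_topology}"
  proof -
    have ae: "AE t in I_meas. norm (q t) \<le> norm (\<psi> t)" "AE t in I_meas. norm ((norm (q t))\<^sup>2) \<le> norm ((\<psi> t)\<^sup>2)"
      using that(2) by (eventually_elim, auto intro: power_mono)+
    show "integrable I_meas q" by (rule Bochner_Integration.integrable_bound[OF \<psi> that(1) ae(1)])
    show "integrable I_meas (\<lambda>t. (norm (q t))\<^sup>2)"
      by (rule Bochner_Integration.integrable_bound[OF \<psi>2 _ ae(2)]) (use that(1) in simp)
  qed
  note lw = bl[OF m(1) convex_comb_AE_bound(2)[OF c aw Aw]] and lf = bl[OF m(2) convex_comb_AE_bound(2)[OF c af Af]]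
    and lg = bl[OF m(3) convex_comb_AE_bound(2)[OF c ag Ag]] and lu = bl[OF m(4) convex_comb_AE_bound(2)[OF c au Au]]
  have wadm: "wl \<in> admissible_controls b W"
  proof -
    have "AE t in I_meas. \<forall>n. w n t \<in> W t" using w by (simp add: AE_all_countable admissible_controls_def)
    then have "AE t in I_meas. wl t \<in> W t" using Aw AE_space
    proof eventually_elim
      case (elim t)
      then have W: "closed (W t)" "convex (W t)" using hyp_W unfolding hyp_W_def by auto
      have mem: "(\<Sum>k\<le>N n. c n k *\<^sub>R w k t) \<in> W t" for n
        using c[of n] elim(1) by (intro convex_sum W) (auto simp: tail_weights_def)
      show ?case by (rule closed_sequentially[OF W(1) mem elim(2)])
    qed
    then show ?thesis using m(1) lw(2) by (simp add: admissible_controls_def L2_space_def)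
  qed
  have hli: "integrable I_meas hl" unfolding hl_def[abs_def] using lf(1) control_integrable[OF wadm] by simp
  have AF: "AE t in I_meas. fl t \<in> F t (xl t) (ul t) \<zeta>l"
  proof -
    have vals: "\<forall>t\<in>{0..b}. \<forall>x u \<zeta>. F t x u \<zeta> \<noteq> {} \<and> weakly_compact (F t x u \<zeta>) \<and> convex (F t x u \<zeta>)"
      by (rule conjunct1[OF hyp_F[unfolded hyp_F_def]])
    have lip: "\<forall>D. bounded D \<longrightarrow> (\<exists>k\<in>L1_nonneg b. \<forall>\<zeta>\<in>D. AE t in I_meas. \<forall>x u y v.
        Haus (F t x u \<zeta>) (F t y v \<zeta>) \<le> ereal (k t * (norm (x - y) + norm (u - v))))"
      by (rule conjunct1[OF conjunct2[OF conjunct2[OF hyp_F[unfolded hyp_F_def]]]])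
    obtain \<gamma> \<rho> where \<gamma>: "(\<gamma> \<longlongrightarrow> 0) (at_right (0::real))"
      and par: "\<forall>\<zeta>\<^sub>1 \<zeta>\<^sub>2. AE t in I_meas. \<forall>x u. Haus (F t x u \<zeta>\<^sub>1) (F t x u \<zeta>\<^sub>2) \<le> ereal (\<gamma> (dist \<zeta>\<^sub>1 \<zeta>\<^sub>2) * \<rho> t (norm x) (norm u))"
      using hyp_F unfolding hyp_F_def by (elim conjE exE)
    obtain k where k: "\<forall>\<zeta>\<in>fst ` P. AE t in I_meas. \<forall>x u y v.
        Haus (F t x u \<zeta>) (F t y v \<zeta>) \<le> ereal (k t * (norm (x - y) + norm (u - v)))"
      using mp[OF spec[OF lip] bounded_params(2)] by (elim bexE)
    show ?thesis
    proof (rule inclusion_limit[where D = "fst ` P" and k = k and \<gamma> = \<gamma> and \<rho> = \<rho> and p = \<zeta> and x = x and u = u and f = f])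
      show "AE t in I_meas. f n t \<in> F t (x n t) (u n t) (\<zeta> n)" for n by (rule trajectoryD(6)[OF tr])
    qed (use vals k par in blast | rule \<gamma> \<zeta>P \<zeta>l c Af | erule xl ul)+
  qed
  have AG: "AE t in I_meas. gl t \<in> G t (xl t) (ul t) \<eta>l"
  proof -
    have vals: "\<forall>t\<in>{0..b}. \<forall>x u \<eta>. G t x u \<eta> \<noteq> {} \<and> weakly_compact (G t x u \<eta>) \<and> convex (G t x u \<eta>)"
      by (rule conjunct1[OF hyp_G[unfolded hyp_G_def]])
    have lip: "\<forall>D. bounded D \<longrightarrow> (\<exists>l\<in>L1_nonneg b. \<forall>\<eta>\<in>D. AE t in I_meas. \<forall>x u y v.
        Haus (G t x u \<eta>) (G t y v \<eta>) \<le> ereal (l t * (norm (x - y) + norm (u - v))))"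
      by (rule conjunct1[OF conjunct2[OF conjunct2[OF hyp_G[unfolded hyp_G_def]]]])
    obtain \<gamma> \<rho> where \<gamma>: "(\<gamma> \<longlongrightarrow> 0) (at_right (0::real))"
      and par: "\<forall>\<eta>\<^sub>1 \<eta>\<^sub>2. AE t in I_meas. \<forall>x u. Haus (G t x u \<eta>\<^sub>1) (G t x u \<eta>\<^sub>2) \<le> ereal (\<gamma> (dist \<eta>\<^sub>1 \<eta>\<^sub>2) * \<rho> t (norm x) (norm u))"
      using hyp_G unfolding hyp_G_def by (elim conjE exE)
    obtain l where l: "\<forall>\<eta>\<in>snd ` P. AE t in I_meas. \<forall>x u y v.
        Haus (G t x u \<eta>) (G t y v \<eta>) \<le> ereal (l t * (norm (x - y) + norm (u - v)))"
      using mp[OF spec[OF lip] bounded_params(3)] by (elim bexE)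
    show ?thesis
    proof (rule inclusion_limit[where D = "snd ` P" and k = l and \<gamma> = \<gamma> and \<rho> = \<rho> and p = \<eta> and x = x and u = u and f = g])
      show "AE t in I_meas. g n t \<in> G t (x n t) (u n t) (\<eta> n)" for n by (rule trajectoryD(7)[OF tr])
    qed (use vals l par in blast | rule \<gamma> \<eta>P \<eta>l c Ag | erule xl ul)+
  qed
  have AB: "AE t in I_meas. - u'l t + gl t \<in> B t (ul t) \<eta>l (ul t)"
  proof (rule monotone_inclusion_limit[OF \<eta>l ul, where y = "\<lambda>n t. - u' n t + g n t" and \<psi> = "\<lambda>t. \<psi> t + \<psi> t"])
    show "AE t in I_meas. - u' n t + g n t \<in> B t (u n t) (\<eta> n) (u n t)" for n by (rule trajectoryD(8)[OF tr])
    show "AE t in I_meas. norm (- u' n t + g n t) \<le> \<psi> t + \<psi> t" for n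
      using au[of n] ag[of n]
    proof eventually_elim
      case (elim t)
      then show ?case using norm_triangle_ineq[of "- u' n t" "g n t"] by simp
    qed
    show "AE t in I_meas. (\<lambda>n. \<Sum>k\<le>N n. c n k *\<^sub>R (- u' k t + g k t)) \<longlonglongrightarrow> - u'l t + gl t"
      using Au Ag
    proof eventually_elim
      case (elim t)
      have "(\<lambda>n. - (\<Sum>k\<le>N n. c n k *\<^sub>R u' k t) + (\<Sum>k\<le>N n. c n k *\<^sub>R g k t)) \<longlonglongrightarrow> - u'l t + gl t"
        by (intro tendsto_intros elim)
      then show ?case by (simp add: scaleR_diff_right sum_subtractf)
    qed
  qed (auto intro: c)
  have u0: "(\<lambda>n. u\<^sub>0 (\<eta> n)) \<longlonglongrightarrow> u\<^sub>0 \<eta>l" and x0: "(\<lambda>n. x\<^sub>0 (\<zeta> n)) \<longlonglongrightarrow> x\<^sub>0 \<zeta>l"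
  proof -
    have "isCont u\<^sub>0 \<eta>l" "isCont x\<^sub>0 \<zeta>l" using hyp_0 by (auto simp: hyp_0_def continuous_on_eq_continuous_at)
    then show "(\<lambda>n. u\<^sub>0 (\<eta> n)) \<longlonglongrightarrow> u\<^sub>0 \<eta>l" "(\<lambda>n. x\<^sub>0 (\<zeta> n)) \<longlonglongrightarrow> x\<^sub>0 \<zeta>l"
      using \<eta>l \<zeta>l by (auto intro: isCont_tendsto_compose)
  qed
  have ul_eq: "ul t = u\<^sub>0 \<eta>l + (\<integral>s. u'l s \<partial>lebesgue_on {0..t})" if t: "t \<in> {0..b}" for t
  proof (rule LIMSEQ_unique[OF tail_weights_tendsto[OF c ul[OF t]]])
    have sub: "{0..t} \<subseteq> {0..b}" using t by auto
    have "(\<lambda>n. \<Sum>k\<le>N n. c n k *\<^sub>R (\<integral>s. u' k s \<partial>lebesgue_on {0..t})) \<longlonglongrightarrow> (\<integral>s. u'l s \<partial>lebesgue_on {0..t})"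
    proof (rule convex_comb_integral_tendsto[OF c, where \<psi> = \<psi>])
      show "integrable (lebesgue_on {0..t}) (u' k)" for k
        by (rule integrable_lebesgue_on_subset[OF trajectoryD(10)[OF tr] sub]) auto
      show "AE s in lebesgue_on {0..t}. norm (u' k s) \<le> \<psi> s" for k
        by (rule AE_lebesgue_on_subset[OF au sub]) auto
      show "integrable (lebesgue_on {0..t}) \<psi>" by (rule integrable_lebesgue_on_subset[OF \<psi> sub]) auto
      show "u'l \<in> borel_measurable (lebesgue_on {0..t})" using m(4) sub by (rule measurable_restrict_mono)
      show "AE s in lebesgue_on {0..t}. (\<lambda>n. \<Sum>k\<le>N n. c n k *\<^sub>R u' k s) \<longlonglongrightarrow> u'l s"
        by (rule AE_lebesgue_on_subset[OF Au sub]) auto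
    qed
    from tendsto_add[OF tail_weights_tendsto[OF c u0] this]
    have "(\<lambda>n. \<Sum>k\<le>N n. c n k *\<^sub>R (u\<^sub>0 (\<eta> k) + (\<integral>s. u' k s \<partial>lebesgue_on {0..t}))) \<longlonglongrightarrow> u\<^sub>0 \<eta>l + (\<integral>s. u'l s \<partial>lebesgue_on {0..t})"
      by (simp add: scaleR_add_right sum.distrib)
    moreover have "u k t = u\<^sub>0 (\<eta> k) + (\<integral>s. u' k s \<partial>lebesgue_on {0..t})" for k
      using trajectoryD(2,3)[OF tr, of k] t unfolding has_W12_derivative_def by metis
    ultimately show "(\<lambda>n. \<Sum>k\<le>N n. c n k *\<^sub>R u k t) \<longlonglongrightarrow> u\<^sub>0 \<eta>l + (\<integral>s. u'l s \<partial>lebesgue_on {0..t})" by simp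
  qed
  have xl_eq: "xl t = blinfun_apply (T \<zeta>l t) (x\<^sub>0 \<zeta>l) + (\<integral>s. blinfun_apply (T \<zeta>l (t - s)) (hl s) \<partial>lebesgue_on {0..t})"
    if t: "t \<in> {0..b}" for t
  proof -
    have sub: "{0..t} \<subseteq> {0..b}" using t by auto
    \<comment> \<open>The integral with the limit semigroup: as a fixed linear map of
      \<open>h k\<close> it commutes with convex combinations, unlike the integral with
      \<open>\<zeta> k\<close>.\<close>
    define I where "I k = (\<integral>s. blinfun_apply (T \<zeta>l (t - s)) (h k s) \<partial>lebesgue_on {0..t})" for k
    have int: "integrable (lebesgue_on {0..t}) (\<lambda>r. blinfun_apply (T \<zeta>l (t - r)) (q r))" if "integrable I_meas q" for q
      using mild_integrand_integrable[OF semigroup M(2)[OF \<zeta>P(2)] that, of 0 t] t by simp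
    have 1: "(\<lambda>n. \<Sum>k\<le>N n. c n k *\<^sub>R I k) \<longlonglongrightarrow> (\<integral>s. blinfun_apply (T \<zeta>l (t - s)) (hl s) \<partial>lebesgue_on {0..t})"
      unfolding I_def
    proof (rule convex_comb_integral_tendsto[OF c, where \<psi> = "\<lambda>s. M * \<psi> s"])
      show "integrable (lebesgue_on {0..t}) (\<lambda>s. blinfun_apply (T \<zeta>l (t - s)) (h k s))" for k
        by (rule int[OF hi])
      show "(\<lambda>s. blinfun_apply (T \<zeta>l (t - s)) (hl s)) \<in> borel_measurable (lebesgue_on {0..t})"
        using int[OF hli] by simp
      show "integrable (lebesgue_on {0..t}) (\<lambda>s. M * \<psi> s)"
        using integrable_lebesgue_on_subset[OF \<psi> sub] by simp
      fix k
      have "AE s in lebesgue_on {0..t}. norm (h k s) \<le> \<psi> s"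
        by (rule AE_lebesgue_on_subset[OF ahh sub]) auto
      then show "AE s in lebesgue_on {0..t}. norm (blinfun_apply (T \<zeta>l (t - s)) (h k s)) \<le> M * \<psi> s"
        using AE_space
      proof eventually_elim
        case (elim s)
        then have "norm (T \<zeta>l (t - s)) \<le> M" using t by (intro M(2)[OF \<zeta>P(2)]) auto
        then show ?case using elim(1) M(1) by (intro order_trans[OF norm_blinfun] mult_mono) auto
      qed
    next
      have "AE s in lebesgue_on {0..t}. (\<lambda>n. \<Sum>k\<le>N n. c n k *\<^sub>R h k s) \<longlonglongrightarrow> hl s"
        by (rule AE_lebesgue_on_subset[OF Ah sub]) auto
      then show "AE s in lebesgue_on {0..t}. (\<lambda>n. \<Sum>k\<le>N n. c n k *\<^sub>R blinfun_apply (T \<zeta>l (t - s)) (h k s))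
          \<longlonglongrightarrow> blinfun_apply (T \<zeta>l (t - s)) (hl s)"
      proof eventually_elim
        case (elim s)
        have "(\<lambda>n. blinfun_apply (T \<zeta>l (t - s)) (\<Sum>k\<le>N n. c n k *\<^sub>R h k s)) \<longlonglongrightarrow> blinfun_apply (T \<zeta>l (t - s)) (hl s)"
          by (intro tendsto_intros elim)
        then show ?case by (simp add: blinfun.sum_right blinfun.scaleR_right)
      qed
    qed
    have 2: "(\<lambda>k. (\<integral>s. blinfun_apply (T (\<zeta> k) (t - s)) (h k s) \<partial>lebesgue_on {0..t}) - I k) \<longlonglongrightarrow> 0"
      unfolding I_def using \<zeta>P by (intro mild_integral_parameter_limit[OF \<zeta>l _ _ t hi ahh \<psi> \<psi>0]) auto
    have 3: "(\<lambda>k. blinfun_apply (T (\<zeta> k) t) (x\<^sub>0 (\<zeta> k))) \<longlonglongrightarrow> blinfun_apply (T \<zeta>l t) (x\<^sub>0 \<zeta>l)"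
      using \<zeta>P by (intro semigroup_strong_convergence[OF \<zeta>l _ t x0]) auto
    \<comment> \<open>All other terms of the mild formula converge, so \<open>I\<close> itself
      converges. Averaging keeps that limit and identifies it through \<open>hl\<close>.\<close>
    have "(\<lambda>k. x k t - (blinfun_apply (T (\<zeta> k) t) (x\<^sub>0 (\<zeta> k)) + ((\<integral>s. blinfun_apply (T (\<zeta> k) (t - s)) (h k s) \<partial>lebesgue_on {0..t}) - I k)))
        \<longlonglongrightarrow> xl t - (blinfun_apply (T \<zeta>l t) (x\<^sub>0 \<zeta>l) + 0)"
      by (intro tendsto_diff tendsto_add xl t 2 3)
    moreover have "x k t - (blinfun_apply (T (\<zeta> k) t) (x\<^sub>0 (\<zeta> k)) + ((\<integral>s. blinfun_apply (T (\<zeta> k) (t - s)) (h k s) \<partial>lebesgue_on {0..t}) - I k)) = I k" for k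
      using trajectoryD(9)[OF tr t, of k] by (simp add: h_def)
    ultimately have "I \<longlonglongrightarrow> xl t - blinfun_apply (T \<zeta>l t) (x\<^sub>0 \<zeta>l)" by simp
    from LIMSEQ_unique[OF tail_weights_tendsto[OF c this] 1] show ?thesis by (simp add: algebra_simps)
  qed
  have "continuous_on {0..b} (\<lambda>t. blinfun_apply (T \<zeta>l t) (x\<^sub>0 \<zeta>l) + (\<integral>s. blinfun_apply (T \<zeta>l (t - s)) (hl s) \<partial>lebesgue_on {0..t}))"
    using C0_semigroup_continuous_on[OF semigroup M(2)[OF \<zeta>P(2)]]
      mild_integral_continuous[OF semigroup M(2)[OF \<zeta>P(2)] _ hli] b_pos
    by (intro continuous_on_add) auto
  then have xc: "continuous_on {0..b} xl" by (rule continuous_on_eq) (simp add: xl_eq)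
  have ul0: "ul 0 = u\<^sub>0 \<eta>l"
    using ul_eq[of 0] b_pos integral_lebesgue_on_singleton[of 0 u'l] by simp
  have "trajectory \<zeta>l \<eta>l wl xl ul u'l fl gl"
    unfolding trajectory_def
  proof (intro conjI ballI)
    show "has_W12_derivative b ul u'l"
      unfolding has_W12_derivative_def L2_space_def using m(4) lu(2) ul_eq ul0 by auto
    show "AE t in I_meas. fl t \<in> F t (xl t) (ul t) \<zeta>l \<and> gl t \<in> G t (xl t) (ul t) \<eta>l \<and> - u'l t + gl t \<in> B t (ul t) \<eta>l (ul t)"
      using AF AG AB by eventually_elim blast
    show "xl t = blinfun_apply (T \<zeta>l t) (x\<^sub>0 \<zeta>l) + (\<integral>s. blinfun_apply (T \<zeta>l (t - s)) (fl s + blinfun_apply \<B> (wl s)) \<partial>lebesgue_on {0..t})"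
      if "t \<in> {0..b}" for t using xl_eq[OF that] by (simp add: hl_def)
  qed (use xc ul0 lf lg in auto)
  then have "(xl, ul) \<in> mild_solutions b T B F G \<B> x\<^sub>0 u\<^sub>0 \<zeta>l \<eta>l wl" unfolding mem_mild_solutions_iff by blast
  then show ?thesis using that c wadm Aw by blast
qed

end

section \<open>Convergence of the costs and optimality\<close>

text \<open>Completeness of Lebesgue measure: the pointwise \<open>lim\<close> is measurable, and
  altering it on a negligible set preserves this.\<close>

lemma borel_measurable_lebesgue_on_AE_limit:
  fixes s :: "nat \<Rightarrow> real \<Rightarrow> real"
  assumes S: "S \<in> sets lebesgue" and s: "\<And>m. s m \<in> borel_measurable (lebesgue_on S)"
    and lim: "AE t in lebesgue_on S. (\<lambda>m. s m t) \<longlonglongrightarrow> f t"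
  shows "f \<in> borel_measurable (lebesgue_on S)"
proof -
  have "(\<lambda>t. lim (\<lambda>m. s m t)) \<in> borel_measurable (lebesgue_on S)" by (rule borel_measurable_lim_metric[OF s])
  then have g: "(\<lambda>t. lim (\<lambda>m. s m t)) measurable_on S" by (simp add: measurable_on_iff_borel_measurable[OF S])
  have "AE t in lebesgue. t \<in> S \<longrightarrow> (\<lambda>m. s m t) \<longlonglongrightarrow> f t" using lim S by (simp add: AE_restrict_space_iff)
  then obtain N where N: "negligible N" "{t. \<not> (t \<in> S \<longrightarrow> (\<lambda>m. s m t) \<longlonglongrightarrow> f t)} \<subseteq> N"
    unfolding eventually_ae_filter_negligible by blast
  have "f t = lim (\<lambda>m. s m t)" if "t \<in> S - N" for t
  proof -
    have "(\<lambda>m. s m t) \<longlonglongrightarrow> f t" using that N(2) by blast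
    then show ?thesis by (simp add: limI)
  qed
  from measurable_on_spike[OF g N(1) this] show ?thesis by (simp add: measurable_on_iff_borel_measurable[OF S])
qed

text \<open>The argument \<open>z\<close> is sampled on a grid: for each mesh only countably many
  constants are inserted into \<open>L\<close>, and continuity of \<open>L t\<close> and of
  \<open>z\<close> recovers the composition as the mesh shrinks.\<close>

lemma Caratheodory_compose_measurable:
  fixes L :: "real \<Rightarrow> 'a::metric_space \<Rightarrow> real"
  assumes L: "\<And>a. (\<lambda>t. L t a) \<in> borel_measurable (lebesgue_on {0..b})"
    and cont: "AE t in lebesgue_on {0..b}. continuous_on UNIV (L t)" and z: "continuous_on {0..b} z"
  shows "(\<lambda>t. L t (z t)) \<in> borel_measurable (lebesgue_on {0..b})"
proof (rule borel_measurable_lebesgue_on_AE_limit)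
  \<comment> \<open>Rounding down to a multiple of \<open>1 / Suc m\<close> keeps the sample time
    inside \<open>{0..b}\<close>, where \<open>z\<close> is continuous.\<close>
  define \<tau> where "\<tau> m t = real_of_int \<lfloor>real (Suc m) * t\<rfloor> / real (Suc m)" for m t
  have [measurable]: "(\<lambda>t. t) \<in> borel_measurable (lebesgue_on {0..b})"
    using id_borel_measurable_lebesgue_on by (simp add: id_def)
  show "(\<lambda>t. L t (z (\<tau> m t))) \<in> borel_measurable (lebesgue_on {0..b})" for m
  proof -
    have "(\<lambda>t. \<lfloor>real (Suc m) * t\<rfloor>) \<in> measurable (lebesgue_on {0..b}) (count_space UNIV)" by measurable
    from measurable_compose_countable[where f = "\<lambda>i t. L t (z (real_of_int i / real (Suc m)))", OF L this]
    show ?thesis by (simp add: \<tau>_def)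
  qed
  have \<tau>: "\<tau> m t \<in> {0..b}" "\<bar>\<tau> m t - t\<bar> \<le> 1 / real (Suc m)" if "t \<in> {0..b}" for m t
  proof -
    define p where "p = real (Suc m)"
    have p: "0 < p" by (simp add: p_def)
    have "p * t - 1 \<le> real_of_int \<lfloor>p * t\<rfloor>" "real_of_int \<lfloor>p * t\<rfloor> \<le> p * t" by linarith+
    from this[THEN divide_right_mono, of p]
    have "t - 1 / p \<le> real_of_int \<lfloor>p * t\<rfloor> / p" "real_of_int \<lfloor>p * t\<rfloor> / p \<le> t"
      using p by (simp_all add: diff_divide_distrib)
    moreover have "0 \<le> real_of_int \<lfloor>p * t\<rfloor> / p" using that p by simp
    ultimately show "\<tau> m t \<in> {0..b}" "\<bar>\<tau> m t - t\<bar> \<le> 1 / real (Suc m)"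
      using that unfolding \<tau>_def p_def[symmetric] by auto
  qed
  show "AE t in lebesgue_on {0..b}. (\<lambda>m. L t (z (\<tau> m t))) \<longlonglongrightarrow> L t (z t)"
    using cont AE_space
  proof eventually_elim
    case (elim t)
    then have t: "t \<in> {0..b}" by simp
    have "(\<lambda>m. \<tau> m t - t) \<longlonglongrightarrow> 0"
      using \<tau>(2)[OF t] by (intro Lim_null_comparison[OF _ LIMSEQ_Suc[OF lim_1_over_n]] always_eventually) auto
    then have "(\<lambda>m. \<tau> m t) \<longlonglongrightarrow> t" by (simp add: LIM_zero_iff)
    then have "(\<lambda>m. z (\<tau> m t)) \<longlonglongrightarrow> z t" using \<tau>(1)[OF t] t by (intro continuous_on_tendsto_compose[OF z]) auto
    then show ?case using elim(1) by (intro continuous_on_tendsto_compose[where f = "L t"]) auto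
  qed
qed simp

text \<open>The states converge strongly at every time, so dominated convergence gives the limit of
  the cost. The majorant compares \<open>ell\<close> with its value at \<open>x = 0\<close>: the
  growth bound there yields \<open>\<theta> t * (1 + R)\<close>, the modulus \<kappa> on
  \<open>{0..R}\<close> yields \<open>(1 + R) * \<beta> t\<close>.\<close>

lemma cost_tendsto:
  fixes ell :: "real \<Rightarrow> 'e::real_normed_vector \<Rightarrow> 'h::real_normed_vector \<Rightarrow> 'l::metric_space \<Rightarrow> 'x::metric_space \<Rightarrow> real"
  assumes b: "0 < b" and ell: "hyp_ell b ell" and \<phi>: "hyp_phi \<phi>" and D: "bounded D" "\<And>n. (\<zeta> n, \<eta> n) \<in> D"
    and lim: "\<zeta> \<longlonglongrightarrow> \<zeta>l" "\<eta> \<longlonglongrightarrow> \<eta>l"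
    and c: "\<And>n. continuous_on {0..b} (x n)" "\<And>n. continuous_on {0..b} (u n)" "continuous_on {0..b} xl" "continuous_on {0..b} ul"
    and R: "0 < R" "\<And>n t. t \<in> {0..b} \<Longrightarrow> norm (x n t) \<le> R \<and> norm (u n t) \<le> R"
    and xl: "\<And>t. t \<in> {0..b} \<Longrightarrow> (\<lambda>n. x n t) \<longlonglongrightarrow> xl t" and ul: "\<And>t. t \<in> {0..b} \<Longrightarrow> (\<lambda>n. u n t) \<longlonglongrightarrow> ul t"
  shows "(\<lambda>n. cost b ell \<phi> (\<zeta> n) (\<eta> n) (x n, u n)) \<longlonglongrightarrow> cost b ell \<phi> \<zeta>l \<eta>l (xl, ul)"
proof -
  note E = ell[unfolded hyp_ell_def]
  have meas: "\<And>x u \<zeta> \<eta>. (\<lambda>t. ell t x u \<zeta> \<eta>) \<in> borel_measurable (lebesgue_on {0..b})" using E by blast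
  have cont: "AE t in lebesgue_on {0..b}. continuous_on UNIV (\<lambda>(x, u, \<zeta>, \<eta>). ell t x u \<zeta> \<eta>)" using E by blast
  obtain \<kappa> where \<kappa>: "hyp_kappa b \<kappa>" "AE t in lebesgue_on {0..b}. \<forall>x y u \<zeta> \<eta>.
      \<bar>ell t x u \<zeta> \<eta> - ell t y u \<zeta> \<eta>\<bar> \<le> (1 + max (norm x) (norm y)) * \<kappa> t (norm (x - y))" using E by blast
  obtain \<beta> where \<beta>: "\<beta> \<in> L1_nonneg b" "AE t in lebesgue_on {0..b}. \<forall>r\<in>{0..R}. \<kappa> t r \<le> \<beta> t"
    using \<kappa>(1) R(1) unfolding hyp_kappa_def by blast
  obtain \<theta> where \<theta>: "\<theta> \<in> L1_nonneg b" "AE t in lebesgue_on {0..b}. \<forall>u. \<forall>(\<zeta>, \<eta>)\<in>D. \<bar>ell t 0 u \<zeta> \<eta>\<bar> \<le> \<theta> t * (1 + norm u)"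
    using E D(1) by blast
  have mc: "(\<lambda>t. ell t (y t) (v t) p q) \<in> borel_measurable (lebesgue_on {0..b})"
    if "continuous_on {0..b} y" "continuous_on {0..b} v" for y v p q
  proof -
    have "(\<lambda>t. case (y t, v t) of (x, u) \<Rightarrow> ell t x u p q) \<in> borel_measurable (lebesgue_on {0..b})"
    proof (rule Caratheodory_compose_measurable[where L = "\<lambda>t (x, u). ell t x u p q" and z = "\<lambda>t. (y t, v t)"])
      show "(\<lambda>t. case a of (x, u) \<Rightarrow> ell t x u p q) \<in> borel_measurable (lebesgue_on {0..b})" for a
        using meas by (cases a) simp
      show "AE t in lebesgue_on {0..b}. continuous_on UNIV (\<lambda>(x, u). ell t x u p q)"
        using cont
      proof eventually_elim
        case (elim t)
        have "continuous_on UNIV (\<lambda>a. (\<lambda>(x, u, \<zeta>, \<eta>). ell t x u \<zeta> \<eta>) (fst a, snd a, p, q))"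
          by (rule continuous_on_compose2[OF elim]) (auto intro!: continuous_intros)
        then show ?case by (simp add: case_prod_beta')
      qed
      show "continuous_on {0..b} (\<lambda>t. (y t, v t))" using that by (intro continuous_intros)
    qed
    then show ?thesis by simp
  qed
  have "(\<lambda>n. \<integral>t. ell t (x n t) (u n t) (\<zeta> n) (\<eta> n) \<partial>lebesgue_on {0..b}) \<longlonglongrightarrow> (\<integral>t. ell t (xl t) (ul t) \<zeta>l \<eta>l \<partial>lebesgue_on {0..b})"
  proof (rule integral_dominated_convergence[where w = "\<lambda>t. \<theta> t * (1 + R) + (1 + R) * \<beta> t"])
    show "integrable (lebesgue_on {0..b}) (\<lambda>t. \<theta> t * (1 + R) + (1 + R) * \<beta> t)"
      using \<theta>(1) \<beta>(1) by (simp add: L1_nonneg_def)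
    show "AE t in lebesgue_on {0..b}. (\<lambda>n. ell t (x n t) (u n t) (\<zeta> n) (\<eta> n)) \<longlonglongrightarrow> ell t (xl t) (ul t) \<zeta>l \<eta>l"
      using cont AE_space
    proof eventually_elim
      case (elim t)
      then have "t \<in> {0..b}" by simp
      then have "(\<lambda>n. (x n t, u n t, \<zeta> n, \<eta> n)) \<longlonglongrightarrow> (xl t, ul t, \<zeta>l, \<eta>l)" by (intro tendsto_Pair xl ul lim)
      from continuous_on_tendsto_compose[OF elim(1) this] show ?case by simp
    qed
    show "AE t in lebesgue_on {0..b}. norm (ell t (x n t) (u n t) (\<zeta> n) (\<eta> n)) \<le> \<theta> t * (1 + R) + (1 + R) * \<beta> t" for n
      using \<kappa>(2) \<beta>(2) \<theta>(2) AE_space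
    proof eventually_elim
      case (elim t)
      then have t: "t \<in> {0..b}" by simp
      have b0: "0 \<le> \<theta> t" "0 \<le> \<beta> t" using \<theta>(1) \<beta>(1) t by (auto simp: L1_nonneg_def)
      have "\<bar>ell t (x n t) (u n t) (\<zeta> n) (\<eta> n) - ell t 0 (u n t) (\<zeta> n) (\<eta> n)\<bar> \<le> (1 + norm (x n t)) * \<kappa> t (norm (x n t))"
        using elim(1)[rule_format, of "x n t" "u n t" "\<zeta> n" "\<eta> n" 0] by simp
      also have "\<dots> \<le> (1 + norm (x n t)) * \<beta> t"
        using elim(2) R(2)[OF t, of n] by (intro mult_left_mono) auto
      also have "\<dots> \<le> (1 + R) * \<beta> t" using R(2)[OF t, of n] b0 by (intro mult_right_mono) auto
      finally have 1: "\<bar>ell t (x n t) (u n t) (\<zeta> n) (\<eta> n) - ell t 0 (u n t) (\<zeta> n) (\<eta> n)\<bar> \<le> (1 + R) * \<beta> t" .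
      have "\<bar>ell t 0 (u n t) (\<zeta> n) (\<eta> n)\<bar> \<le> \<theta> t * (1 + norm (u n t))" using elim(3) D(2)[of n] by auto
      also have "\<dots> \<le> \<theta> t * (1 + R)" using R(2)[OF t, of n] b0 by (intro mult_left_mono) auto
      finally show ?case using 1 by simp
    qed
  qed (use mc c in auto)
  moreover have "(\<lambda>n. \<phi> (x n b) (u n b) (\<zeta> n) (\<eta> n)) \<longlonglongrightarrow> \<phi> (xl b) (ul b) \<zeta>l \<eta>l"
  proof -
    have "(\<lambda>n. (x n b, u n b, \<zeta> n, \<eta> n)) \<longlonglongrightarrow> (xl b, ul b, \<zeta>l, \<eta>l)" using b by (intro tendsto_Pair xl ul lim) auto
    from continuous_on_tendsto_compose[OF \<phi>[unfolded hyp_phi_def] this] show ?thesis by simp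
  qed
  ultimately show ?thesis unfolding cost_def by (simp add: tendsto_add)
qed

text \<open>The difference of the two sides is the variance, that is, the weighted mean of the
  squared distances to the average.\<close>

lemma norm_convex_comb_square_le:
  fixes y :: "nat \<Rightarrow> 'a::real_inner"
  assumes "tail_weights n c N"
  shows "(norm (\<Sum>k\<le>N. c k *\<^sub>R y k))\<^sup>2 \<le> (\<Sum>k\<le>N. c k * (norm (y k))\<^sup>2)"
proof -
  define l where "l = (\<Sum>k\<le>N. c k *\<^sub>R y k)"
  have c: "\<And>k. 0 \<le> c k" "sum c {..N} = 1" using assms by (auto simp: tail_weights_def)
  have "0 \<le> (\<Sum>k\<le>N. c k * (norm (y k - l))\<^sup>2)" using c by (intro sum_nonneg) auto
  also have "\<dots> = (\<Sum>k\<le>N. c k * (norm (y k))\<^sup>2 + (norm l)\<^sup>2 * c k - 2 * ((c k *\<^sub>R y k) \<bullet> l))"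
    unfolding power2_norm_eq_inner by (intro sum.cong) (auto simp: inner_simps inner_commute algebra_simps)
  also have "\<dots> = (\<Sum>k\<le>N. c k * (norm (y k))\<^sup>2) + (norm l)\<^sup>2 * sum c {..N} - 2 * (\<Sum>k\<le>N. (c k *\<^sub>R y k) \<bullet> l)"
    by (simp add: sum.distrib sum_subtractf sum_distrib_left)
  also have "(\<Sum>k\<le>N. (c k *\<^sub>R y k) \<bullet> l) = (norm l)\<^sup>2"
    by (simp add: l_def power2_norm_eq_inner inner_sum_left)
  finally show ?thesis using c by (simp add: l_def)
qed

text \<open>The control costs need not converge along the sequence. They are compared with
  convergent majorants \<open>a k\<close> for late \<open>k\<close>, whose tail averages keep the
  limit.\<close>

lemma control_cost_limit_le:
  fixes w :: "nat \<Rightarrow> real \<Rightarrow> 'y::{real_inner, banach, second_countable_topology}"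
  assumes w: "\<And>k. w k \<in> L2_space b" "wl \<in> L2_space b"
    and \<psi>: "\<And>k. AE t in lebesgue_on {0..b}. norm (w k t) \<le> \<psi> t" "integrable (lebesgue_on {0..b}) (\<lambda>t. (\<psi> t)\<^sup>2)"
    and c: "\<And>n. tail_weights n (c n) (N n)"
    and lim: "AE t in lebesgue_on {0..b}. (\<lambda>n. \<Sum>k\<le>N n. c n k *\<^sub>R w k t) \<longlonglongrightarrow> wl t"
    and a: "\<And>k. k0 \<le> k \<Longrightarrow> control_cost b (w k) \<le> a k" "a \<longlonglongrightarrow> al"
  shows "control_cost b wl \<le> al"
proof -
  have wm [measurable]: "w k \<in> borel_measurable (lebesgue_on {0..b})" "wl \<in> borel_measurable (lebesgue_on {0..b})" for k
    using w by (auto simp: L2_space_def)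
  have wi: "integrable (lebesgue_on {0..b}) (\<lambda>t. (norm (w k t))\<^sup>2)" for k using w by (auto simp: L2_space_def)
  define y where "y n t = (\<Sum>k\<le>N n. c n k *\<^sub>R w k t)" for n t
  have ym [measurable]: "y n \<in> borel_measurable (lebesgue_on {0..b})" for n unfolding y_def[abs_def] by measurable
  have yb: "AE t in lebesgue_on {0..b}. norm ((norm (y n t))\<^sup>2) \<le> (\<psi> t)\<^sup>2" for n
    using convex_comb_AE_bound(1)[OF c \<psi>(1) lim, of n] unfolding y_def
    by eventually_elim (auto intro: power_mono)
  have "(\<lambda>n. \<integral>t. (norm (y n t))\<^sup>2 \<partial>lebesgue_on {0..b}) \<longlonglongrightarrow> (\<integral>t. (norm (wl t))\<^sup>2 \<partial>lebesgue_on {0..b})"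
  proof (rule integral_dominated_convergence[OF _ _ \<psi>(2) _ yb])
    show "AE t in lebesgue_on {0..b}. (\<lambda>n. (norm (y n t))\<^sup>2) \<longlonglongrightarrow> (norm (wl t))\<^sup>2"
      using lim by eventually_elim (auto simp: y_def intro!: tendsto_intros)
  qed measurable
  then have 1: "(\<lambda>n. control_cost b (y n)) \<longlonglongrightarrow> control_cost b wl"
    unfolding control_cost_def by (intro tendsto_intros)
  have "control_cost b (y n) \<le> (\<Sum>k\<le>N n. c n k *\<^sub>R a k)" if "k0 \<le> n" for n
  proof -
    have "integrable (lebesgue_on {0..b}) (\<lambda>t. (norm (y n t))\<^sup>2)"
    proof (rule Bochner_Integration.integrable_bound[OF \<psi>(2)])
      show "AE t in lebesgue_on {0..b}. norm ((norm (y n t))\<^sup>2) \<le> norm ((\<psi> t)\<^sup>2)"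
        using yb[of n] by eventually_elim simp
    qed measurable
    then have "(\<integral>t. (norm (y n t))\<^sup>2 \<partial>lebesgue_on {0..b}) \<le> (\<integral>t. (\<Sum>k\<le>N n. c n k * (norm (w k t))\<^sup>2) \<partial>lebesgue_on {0..b})"
      using wi by (intro integral_mono) (auto simp: y_def intro!: norm_convex_comb_square_le[OF c])
    also have "\<dots> = (\<Sum>k\<le>N n. c n k * (\<integral>t. (norm (w k t))\<^sup>2 \<partial>lebesgue_on {0..b}))"
      using wi by (subst Bochner_Integration.integral_sum) auto
    finally have "control_cost b (y n) \<le> (\<Sum>k\<le>N n. c n k * control_cost b (w k))"
      unfolding control_cost_def by (simp add: sum_distrib_left algebra_simps)
    also have "\<dots> \<le> (\<Sum>k\<le>N n. c n k * a k)"
    proof (rule sum_mono)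
      fix k
      show "c n k * control_cost b (w k) \<le> c n k * a k"
        using c[of n] a(1)[of k] that by (cases "k < n") (auto simp: tail_weights_def intro!: mult_left_mono)
    qed
    finally show ?thesis by simp
  qed
  then show ?thesis using LIMSEQ_le[OF 1 tail_weights_tendsto[OF c a(2)]] by blast
qed

context control_system
begin

lemma optimal_triplet:
  assumes ell: "hyp_ell b ell" and \<phi>: "hyp_phi \<phi>" and ne: "P \<noteq> {}"
  shows "\<exists>w\<in>admissible_controls b W. \<exists>(\<zeta>, \<eta>)\<in>P.
           min_cost b T B F G \<B> x\<^sub>0 u\<^sub>0 ell \<phi> \<zeta> \<eta> w + ereal (control_cost b w) =
           (INF (w', \<zeta>', \<eta>') \<in> admissible_controls b W \<times> P.
              min_cost b T B F G \<B> x\<^sub>0 u\<^sub>0 ell \<phi> \<zeta>' \<eta>' w' + ereal (control_cost b w'))"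
proof -
  define S where "S \<zeta> \<eta> w = mild_solutions b T B F G \<B> x\<^sub>0 u\<^sub>0 \<zeta> \<eta> w" for \<zeta> \<eta> w
  define J where "J \<zeta> \<eta> p = cost b ell \<phi> \<zeta> \<eta> p" for \<zeta> \<eta> p
  define val where "val \<zeta> \<eta> w = min_cost b T B F G \<B> x\<^sub>0 u\<^sub>0 ell \<phi> \<zeta> \<eta> w + ereal (control_cost b w)" for \<zeta> \<eta> w
  define V where "V = (INF (w', \<zeta>', \<eta>') \<in> admissible_controls b W \<times> P. val \<zeta>' \<eta>' w')"
  have lower: "V \<le> val \<zeta> \<eta> w" if "w \<in> admissible_controls b W" "(\<zeta>, \<eta>) \<in> P" for \<zeta> \<eta> w
    unfolding V_def using that by (intro INF_lower2[of "(w, \<zeta>, \<eta>)"]) auto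
  have mc: "min_cost b T B F G \<B> x\<^sub>0 u\<^sub>0 ell \<phi> \<zeta> \<eta> w = (INF p \<in> S \<zeta> \<eta> w. ereal (J \<zeta> \<eta> p))" for \<zeta> \<eta> w
    unfolding min_cost_def S_def J_def ..
  have "\<exists>w\<in>admissible_controls b W. \<exists>(\<zeta>, \<eta>)\<in>P. val \<zeta> \<eta> w \<le> V"
  proof (cases "V = \<infinity>")
    case True
    then show ?thesis using admissible_controls_nonempty[OF hyp_W] ne by fastforce
  next
    case False
    then have "V < \<infinity>" by simp
    \<comment> \<open>The infimum might still be minus infinity, so it is approached from above in
      the extended reals. A control and a trajectory are then chosen together, as the infimum in
      \<open>min_cost\<close> need not be attained.\<close>
    then obtain a where a: "\<And>n. V < a n" "a \<longlonglongrightarrow> V" using approx_from_above_dense_linorder[of V \<infinity>] by blast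
    have "\<exists>w \<zeta> \<eta> x u. w \<in> admissible_controls b W \<and> (\<zeta>, \<eta>) \<in> P \<and> (x, u) \<in> S \<zeta> \<eta> w \<and>
        ereal (J \<zeta> \<eta> (x, u) + control_cost b w) < a n" for n
    proof -
      from a(1)[of n] obtain w \<zeta> \<eta> where w: "w \<in> admissible_controls b W" "(\<zeta>, \<eta>) \<in> P" "val \<zeta> \<eta> w < a n"
        unfolding V_def INF_less_iff by auto
      then have "(INF p \<in> S \<zeta> \<eta> w. ereal (J \<zeta> \<eta> p)) < a n - ereal (control_cost b w)"
        unfolding val_def mc by (subst ereal_less_minus) auto
      then obtain p where p: "p \<in> S \<zeta> \<eta> w" "ereal (J \<zeta> \<eta> p) < a n - ereal (control_cost b w)"
        unfolding INF_less_iff by blast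
      then have "ereal (J \<zeta> \<eta> p + control_cost b w) < a n" by (subst (asm) ereal_less_minus) auto
      then show ?thesis using w(1,2) p(1) by (metis surj_pair)
    qed
    then obtain w \<zeta> \<eta> x u where w: "\<And>n. w n \<in> admissible_controls b W" and P: "\<And>n. (\<zeta> n, \<eta> n) \<in> P"
      and S: "\<And>n. (x n, u n) \<in> S (\<zeta> n) (\<eta> n) (w n)"
      and less: "\<And>n. ereal (J (\<zeta> n) (\<eta> n) (x n, u n) + control_cost b (w n)) < a n" by metis
    from S obtain u' f g where tr: "\<And>n. trajectory (\<zeta> n) (\<eta> n) (w n) (x n) (u n) (u' n) (f n) (g n)"
      unfolding S_def mem_mild_solutions_iff by metis
    obtain l r1 where l: "l \<in> P" "strict_mono (r1 :: nat \<Rightarrow> nat)" "((\<lambda>n. (\<zeta> n, \<eta> n)) \<circ> r1) \<longlonglongrightarrow> l"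
      using compact_imp_seq_compact[OF P_compact] P by (elim seq_compactE) auto
    define \<zeta>l \<eta>l where "\<zeta>l = fst l" and "\<eta>l = snd l"
    have Pl: "(\<zeta>l, \<eta>l) \<in> P" using l(1) by (simp add: \<zeta>l_def \<eta>l_def)
    have lim1: "(\<lambda>n. \<zeta> (r1 n)) \<longlonglongrightarrow> \<zeta>l" "(\<lambda>n. \<eta> (r1 n)) \<longlonglongrightarrow> \<eta>l"
      using tendsto_fst[OF l(3)] tendsto_snd[OF l(3)] by (auto simp: o_def \<zeta>l_def \<eta>l_def)
    obtain r2 xl ul where r2: "strict_mono (r2 :: nat \<Rightarrow> nat)"
      and xl: "\<And>t. t \<in> {0..b} \<Longrightarrow> (\<lambda>n. x (r1 (r2 n)) t) \<longlonglongrightarrow> xl t"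
      and ul: "\<And>t. t \<in> {0..b} \<Longrightarrow> (\<lambda>n. u (r1 (r2 n)) t) \<longlonglongrightarrow> ul t"
      by (rule pointwise_convergent_subseq[where \<zeta> = "\<lambda>n. \<zeta> (r1 n)" and \<eta> = "\<lambda>n. \<eta> (r1 n)", OF P lim1 w tr]) (blast intro: that)
    define r where "r n = r1 (r2 n)" for n
    have r: "strict_mono r" unfolding r_def[abs_def] using strict_mono_o[OF l(2) r2] by (simp add: o_def)
    have lim: "(\<lambda>n. \<zeta> (r n)) \<longlonglongrightarrow> \<zeta>l" "(\<lambda>n. \<eta> (r n)) \<longlonglongrightarrow> \<eta>l"
      using LIMSEQ_subseq_LIMSEQ[OF lim1(1) r2] LIMSEQ_subseq_LIMSEQ[OF lim1(2) r2] by (simp_all add: o_def r_def)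
    note xl = xl[folded r_def] and ul = ul[folded r_def]
    obtain c N wl where c: "\<And>n. tail_weights n (c n) (N n)" and wl: "wl \<in> admissible_controls b W"
      and Aw: "AE t in I_meas. (\<lambda>n. \<Sum>k\<le>N n. c n k *\<^sub>R w (r k) t) \<longlonglongrightarrow> wl t"
      and sol: "(xl, ul) \<in> mild_solutions b T B F G \<B> x\<^sub>0 u\<^sub>0 \<zeta>l \<eta>l wl"
      by (rule limit_trajectory[where w = "\<lambda>n. w (r n)" and x = "\<lambda>n. x (r n)" and u = "\<lambda>n. u (r n)",
            OF P Pl lim w tr xl ul]) (blast intro: that)+
    obtain R \<psi> where R: "0 < R" and \<psi>L: "\<psi> \<in> L2_space b"
      and bd: "\<And>\<zeta> \<eta> w x u u' f g. (\<zeta>, \<eta>) \<in> P \<Longrightarrow> w \<in> admissible_controls b W \<Longrightarrow> trajectory \<zeta> \<eta> w x u u' f g \<Longrightarrow>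
         (\<forall>t\<in>{0..b}. norm (x t) \<le> R \<and> norm (u t) \<le> R) \<and>
         (AE t in I_meas. norm (w t) \<le> \<psi> t \<and> norm (f t) \<le> \<psi> t \<and> norm (g t) \<le> \<psi> t \<and> norm (u' t) \<le> \<psi> t \<and>
            norm (f t + blinfun_apply \<B> (w t)) \<le> \<psi> t)"
      by (rule uniform_bounds) (blast intro: that)
    have aw: "AE t in I_meas. norm (w n t) \<le> \<psi> t" for n
      using conjunct2[OF bd[OF P w tr, of n]] by eventually_elim blast
    have \<psi>2: "integrable I_meas (\<lambda>t. (\<psi> t)\<^sup>2)" using \<psi>L by (simp add: L2_space_def)
    obtain u'l fl gl where trl: "trajectory \<zeta>l \<eta>l wl xl ul u'l fl gl" using sol unfolding mem_mild_solutions_iff by blast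
    have Jlim: "(\<lambda>n. J (\<zeta> (r n)) (\<eta> (r n)) (x (r n), u (r n))) \<longlonglongrightarrow> J \<zeta>l \<eta>l (xl, ul)"
      unfolding J_def
    proof (rule cost_tendsto[OF b_pos ell \<phi> bounded_params(1) P lim])
      show "continuous_on {0..b} (x (r n))" "continuous_on {0..b} (u (r n))" for n
        using trajectoryD(1)[OF tr] has_W12_derivative_continuous_on[OF trajectoryD(3)[OF tr]] by auto
      show "continuous_on {0..b} xl" "continuous_on {0..b} ul"
        using trajectoryD(1)[OF trl] has_W12_derivative_continuous_on[OF trajectoryD(3)[OF trl]] by auto
      show "norm (x (r n) t) \<le> R \<and> norm (u (r n) t) \<le> R" if "t \<in> {0..b}" for n t
        using bd[OF P w tr, of "r n"] that by blast
    qed (use R xl ul in auto)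
    \<comment> \<open>Any real \<open>v\<close> strictly between \<open>V\<close> and the limiting
      value eventually bounds the total costs, which returns the argument to real arithmetic. The
      conclusion also shows that \<open>V\<close> exceeds minus infinity.\<close>
    have le: "ereal (J \<zeta>l \<eta>l (xl, ul) + control_cost b wl) \<le> V"
    proof (rule ccontr)
      assume "\<not> ereal (J \<zeta>l \<eta>l (xl, ul) + control_cost b wl) \<le> V"
      then have "V < ereal (J \<zeta>l \<eta>l (xl, ul) + control_cost b wl)" by simp
      from ereal_dense2[OF this]
      obtain v where v: "V < ereal v" "ereal v < ereal (J \<zeta>l \<eta>l (xl, ul) + control_cost b wl)" by blast
      have "(\<lambda>n. a (r n)) \<longlonglongrightarrow> V" using LIMSEQ_subseq_LIMSEQ[OF a(2) r] by (simp add: o_def)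
      then have "\<forall>\<^sub>F n in sequentially. a (r n) < ereal v" using v(1) by (rule order_tendstoD(2))
      then obtain k0 where k0: "\<And>k. k0 \<le> k \<Longrightarrow> a (r k) < ereal v" by (auto simp: eventually_sequentially)
      \<comment> \<open>Subtracting the state cost, which converges, leaves a convergent majorant
        for the control costs, as the lower semicontinuity lemma requires.\<close>
      have "control_cost b wl \<le> v - J \<zeta>l \<eta>l (xl, ul)"
      proof (rule control_cost_limit_le[where w = "\<lambda>n. w (r n)" and a = "\<lambda>n. v - J (\<zeta> (r n)) (\<eta> (r n)) (x (r n), u (r n))",
            OF _ _ aw \<psi>2 c Aw])
        show "control_cost b (w (r k)) \<le> v - J (\<zeta> (r k)) (\<eta> (r k)) (x (r k), u (r k))" if "k0 \<le> k" for k
        proof -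
          have "ereal (J (\<zeta> (r k)) (\<eta> (r k)) (x (r k), u (r k)) + control_cost b (w (r k))) < ereal v"
            using less[of "r k"] k0[OF that] by (rule less_trans)
          then show ?thesis by simp
        qed
        show "(\<lambda>n. v - J (\<zeta> (r n)) (\<eta> (r n)) (x (r n), u (r n))) \<longlonglongrightarrow> v - J \<zeta>l \<eta>l (xl, ul)"
          by (intro tendsto_intros Jlim)
      qed (use w wl in \<open>auto simp: admissible_controls_def\<close>)
      then show False using v(2) by simp
    qed
    have "(INF p \<in> S \<zeta>l \<eta>l wl. ereal (J \<zeta>l \<eta>l p)) \<le> ereal (J \<zeta>l \<eta>l (xl, ul))"
      using sol by (intro INF_lower) (simp add: S_def)
    then have "val \<zeta>l \<eta>l wl \<le> ereal (J \<zeta>l \<eta>l (xl, ul)) + ereal (control_cost b wl)"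
      unfolding val_def mc by (rule add_right_mono)
    also have "\<dots> \<le> V" using le by simp
    finally show ?thesis using wl Pl by blast
  qed
  then obtain w \<zeta> \<eta> where "w \<in> admissible_controls b W" "(\<zeta>, \<eta>) \<in> P" "val \<zeta> \<eta> w \<le> V" by blast
  moreover from this have "val \<zeta> \<eta> w = V" using lower by (simp add: antisym)
  ultimately show ?thesis unfolding V_def val_def by blast
qed

end

theorem theorem5p2:
  fixes b :: real
    and domA :: "'l::metric_space \<Rightarrow> 'e::{real_inner, banach, second_countable_topology} set"
    and A :: "'l \<Rightarrow> 'e \<Rightarrow> 'e"
    and T :: "'l \<Rightarrow> real \<Rightarrow> 'e \<Rightarrow>\<^sub>L 'e"
    and B :: "real \<Rightarrow> 'h::{real_inner, banach, second_countable_topology} \<Rightarrow> 'x::metric_space \<Rightarrow> 'h \<Rightarrow> 'h set"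
    and F :: "real \<Rightarrow> 'e \<Rightarrow> 'h \<Rightarrow> 'l \<Rightarrow> 'e set"
    and G :: "real \<Rightarrow> 'e \<Rightarrow> 'h \<Rightarrow> 'x \<Rightarrow> 'h set"
    and W :: "real \<Rightarrow> 'y::{real_inner, banach, second_countable_topology} set"
    and \<B> :: "'y \<Rightarrow>\<^sub>L 'e"
    and x\<^sub>0 :: "'l \<Rightarrow> 'e"
    and u\<^sub>0 :: "'x \<Rightarrow> 'h"
    and ell :: "real \<Rightarrow> 'e \<Rightarrow> 'h \<Rightarrow> 'l \<Rightarrow> 'x \<Rightarrow> real"
    and \<phi> :: "'e \<Rightarrow> 'h \<Rightarrow> 'l \<Rightarrow> 'x \<Rightarrow> real"
    and P :: "('l \<times> 'x) set"
  assumes "0 < b"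
    and "\<And>\<zeta>. linear_operator_on (domA \<zeta>) (A \<zeta>)"
    and "\<And>t u \<eta>. t \<in> {0..b} \<Longrightarrow> maximal_monotone (B t u \<eta>)"
    and "\<And>\<eta>. u\<^sub>0 \<eta> \<in> op_dom (B 0 (u\<^sub>0 \<eta>) \<eta>)"
    and "hyp_A b domA A T"
    and "hyp_B b B"
    and "hyp_F b F"
    and "hyp_G b G"
    and "hyp_0 x\<^sub>0 u\<^sub>0"
    and "hyp_W b W"
    and "hyp_ell b ell"
    and "hyp_phi \<phi>"
    and "P \<noteq> {}"
    and "compact P"
  shows "\<exists>w\<in>admissible_controls b W. \<exists>(\<zeta>, \<eta>)\<in>P.
           min_cost b T B F G \<B> x\<^sub>0 u\<^sub>0 ell \<phi> \<zeta> \<eta> w + ereal (control_cost b w) =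
           (INF (w', \<zeta>', \<eta>') \<in> admissible_controls b W \<times> P.
              min_cost b T B F G \<B> x\<^sub>0 u\<^sub>0 ell \<phi> \<zeta>' \<eta>' w' + ereal (control_cost b w'))"
proof -
  interpret control_system b domA A T B F G W \<B> x\<^sub>0 u\<^sub>0 P
    using assms by unfold_locales
  show ?thesis by (rule optimal_triplet) fact+
qed

end
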